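(* Let $(x_*(\cdot),u_*(\cdot))$ be a strong local minimum of the finite-horizon problem (E) (see context), where the data satisfy the regularity assumption stated in the context along $x_*(\cdot)$. Then there exist $\lambda_0\ge0$, $p(\cdot)\in W^1_\infty([t_0,t_1],\mathbb{R}^n)$ and $l_i\in\mathbb{R}^{s_i}$, $i=0,1$, not all zero, such that: (a) $p(\cdot)$ satisfies (for almost every $t\in[t_0,t_1]$) $$\dot p(t)=-\varphi_x^T(t,x_*(t),u_*(t))\,p(t)+\lambda_0 f_x(t,x_*(t),u_*(t))$$ and $$p(t_0)={h_0'}^T(x_*(t_0))\,l_0,\qquad p(t_1)=-{h_1'}^T(x_*(t_1))\,l_1;$$ (b) for almost every $t\in[t_0,t_1]$ $$H(t,x_*(t),u_*(t),p(t),\lambda_0)=\max_{u\in U}H(t,x_*(t),u,p(t),\lambda_0).$$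
   Context: Problem (E), on a compact interval $[t_0,t_1]$, $t_0<t_1$: $$J(x(\cdot),u(\cdot))=\int_{t_0}^{t_1}f(t,x(t),u(t))\,dt\to\inf,\quad \dot x(t)=\varphi(t,x(t),u(t)),\quad h_0(x(t_0))=0,\quad h_1(x(t_1))=0,\quad u(t)\in U,$$ with $\emptyset\ne U\subseteq\mathbb{R}^m$, $f$ real-valued and $\varphi$ $\mathbb{R}^n$-valued functions of $(t,x,u)\in[t_0,t_1]\times\mathbb{R}^n\times\mathbb{R}^m$, $h_0:\mathbb{R}^n\to\mathbb{R}^{s_0}$, $h_1:\mathbb{R}^n\to\mathbb{R}^{s_1}$. A process $(x(\cdot),u(\cdot))\in W^1_\infty([t_0,t_1],\mathbb{R}^n)\times L_\infty([t_0,t_1],U)$ is admissible if it satisfies the differential equation (in the sense of Carathéodory) and the boundary conditions, and the integral $J$ is finite. An admissible $(x_*(\cdot),u_*(\cdot))$ is a strong local minimum if there is $\varepsilon>0$ with $J(x(\cdot),u(\cdot))\ge J(x_*(\cdot),u_*(\cdot))$ for all admissible $(x(\cdot),u(\cdot))$ with $\|x(\cdot)-x_*(\cdot)\|_\infty\le\varepsilon$. $W^1_\infty([t_0,t_1],\mathbb{R}^n)$ denotes the absolutely continuous functions with essentially bounded derivative. Regularity assumption: for every compact $U_1\subseteq\mathbb{R}^m$ there is $\gamma>0$ such that on $V_\gamma\times U_1$, $V_\gamma=\{(t,x)\in[t_0,t_1]\times\mathbb{R}^n:\|x-x_*(t)\|\le\gamma\}$, the maps $f(t,x,u)$, $\varphi(t,x,u)$,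 $h_0(x)$, $h_1(x)$ are uniformly continuous and differentiable in $x$ with uniformly continuous $x$-derivatives. Pontryagin function: $H(t,x,u,p,\lambda_0)=\langle p,\varphi(t,x,u)\rangle-\lambda_0 f(t,x,u)$. *)

theory Defs
  imports "HOL-Analysis.Analysis"
begin

text \<open>
  Functions on the compact interval from a to b are total functions on the reals; only
  their values on the interval matter. Elements of the spaces of essentially bounded functions
  are represented by measurable functions, so membership of a set is required almost everywhere.
\<close>

definition Linf_on :: "real \<Rightarrow> real \<Rightarrow> (real \<Rightarrow> 'a::euclidean_space) \<Rightarrow> bool" where
  "Linf_on a b u \<longleftrightarrow>
     u \<in> borel_measurable (lebesgue_on {a..b}) \<and>
     (\<exists>C. AE t in lebesgue_on {a..b}. norm (u t) \<le> C)"

text \<open>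
  Absolute continuity in the epsilon-delta sense: a division of a subset of the interval is
  a finite family of non-overlapping compact intervals K = [Inf K, Sup K].
\<close>

definition abs_continuous_on_interval ::
    "real \<Rightarrow> real \<Rightarrow> (real \<Rightarrow> 'a::real_normed_vector) \<Rightarrow> bool" where
  "abs_continuous_on_interval a b x \<longleftrightarrow>
     (\<forall>\<epsilon>>0. \<exists>\<delta>>0. \<forall>D S. D division_of S \<and> S \<subseteq> {a..b} \<and> (\<Sum>K\<in>D. Sup K - Inf K) < \<delta> \<longrightarrow>
        (\<Sum>K\<in>D. norm (x (Sup K) - x (Inf K))) < \<epsilon>)"

definition W1inf_on :: "real \<Rightarrow> real \<Rightarrow> (real \<Rightarrow> 'a::euclidean_space) \<Rightarrow> bool" where
  "W1inf_on a b x \<longleftrightarrow>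
     abs_continuous_on_interval a b x \<and>
     (\<exists>v. Linf_on a b v \<and>
        (AE t in lebesgue_on {a..b}. (x has_vector_derivative v t) (at t within {a..b})))"

definition sup_dist_on :: "real \<Rightarrow> real \<Rightarrow> (real \<Rightarrow> 'a::real_normed_vector) \<Rightarrow> (real \<Rightarrow> 'a) \<Rightarrow> real" where
  "sup_dist_on a b x y = (SUP t\<in>{a..b}. norm (x t - y t))"

definition cost :: "real \<Rightarrow> real \<Rightarrow> (real \<Rightarrow> 'x \<Rightarrow> 'u \<Rightarrow> real) \<Rightarrow>
    (real \<Rightarrow> 'x) \<Rightarrow> (real \<Rightarrow> 'u) \<Rightarrow> real" where
  "cost t0 t1 f x u = (LINT t|lebesgue_on {t0..t1}. f t (x t) (u t))"

text \<open>
  The integrability clause says that the cost functional is finite; a non-integrable integrand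
  would otherwise get the integral 0.
\<close>

definition admissible :: "real \<Rightarrow> real \<Rightarrow>
    (real \<Rightarrow> real^'n \<Rightarrow> real^'m \<Rightarrow> real) \<Rightarrow> (real \<Rightarrow> real^'n \<Rightarrow> real^'m \<Rightarrow> real^'n) \<Rightarrow>
    (real^'n \<Rightarrow> real^'s0) \<Rightarrow> (real^'n \<Rightarrow> real^'s1) \<Rightarrow> (real^'m) set \<Rightarrow>
    (real \<Rightarrow> real^'n) \<Rightarrow> (real \<Rightarrow> real^'m) \<Rightarrow> bool" where
  "admissible t0 t1 f \<phi> h0 h1 U x u \<longleftrightarrow>
     W1inf_on t0 t1 x \<and>
     Linf_on t0 t1 u \<and> (AE t in lebesgue_on {t0..t1}. u t \<in> U) \<and>
     (AE t in lebesgue_on {t0..t1}.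
        (x has_vector_derivative \<phi> t (x t) (u t)) (at t within {t0..t1})) \<and>
     h0 (x t0) = 0 \<and> h1 (x t1) = 0 \<and>
     integrable (lebesgue_on {t0..t1}) (\<lambda>t. f t (x t) (u t))"

definition strong_local_minimum :: "real \<Rightarrow> real \<Rightarrow>
    (real \<Rightarrow> real^'n \<Rightarrow> real^'m \<Rightarrow> real) \<Rightarrow> (real \<Rightarrow> real^'n \<Rightarrow> real^'m \<Rightarrow> real^'n) \<Rightarrow>
    (real^'n \<Rightarrow> real^'s0) \<Rightarrow> (real^'n \<Rightarrow> real^'s1) \<Rightarrow> (real^'m) set \<Rightarrow>
    (real \<Rightarrow> real^'n) \<Rightarrow> (real \<Rightarrow> real^'m) \<Rightarrow> bool" where
  "strong_local_minimum t0 t1 f \<phi> h0 h1 U xs us \<longleftrightarrow>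
     admissible t0 t1 f \<phi> h0 h1 U xs us \<and>
     (\<exists>\<epsilon>>0. \<forall>x u. admissible t0 t1 f \<phi> h0 h1 U x u \<and> sup_dist_on t0 t1 x xs \<le> \<epsilon> \<longrightarrow>
        cost t0 t1 f x u \<ge> cost t0 t1 f xs us)"

definition tube :: "real \<Rightarrow> real \<Rightarrow> (real \<Rightarrow> 'a::real_normed_vector) \<Rightarrow> real \<Rightarrow> (real \<times> 'a) set" where
  "tube t0 t1 xs \<gamma> = {(t, x). t \<in> {t0..t1} \<and> norm (x - xs t) \<le> \<gamma>}"

definition unif_x_differentiable_on ::
    "((real \<times> 'a::real_normed_vector) \<times> 'b::real_normed_vector) set \<Rightarrow>
     (real \<Rightarrow> 'a \<Rightarrow> 'b \<Rightarrow> 'c::real_normed_vector) \<Rightarrow> bool" where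
  "unif_x_differentiable_on S g \<longleftrightarrow>
     uniformly_continuous_on S (\<lambda>((t, x), u). g t x u) \<and>
     (\<exists>g' :: real \<Rightarrow> 'a \<Rightarrow> 'b \<Rightarrow> 'a \<Rightarrow>\<^sub>L 'c.
        (\<forall>((t, x), u) \<in> S. ((\<lambda>y. g t y u) has_derivative blinfun_apply (g' t x u)) (at x)) \<and>
        uniformly_continuous_on S (\<lambda>((t, x), u). g' t x u))"

definition regular_along :: "real \<Rightarrow> real \<Rightarrow>
    (real \<Rightarrow> real^'n \<Rightarrow> real^'m \<Rightarrow> real) \<Rightarrow> (real \<Rightarrow> real^'n \<Rightarrow> real^'m \<Rightarrow> real^'n) \<Rightarrow>
    (real^'n \<Rightarrow> real^'s0) \<Rightarrow> (real^'n \<Rightarrow> real^'s1) \<Rightarrow> (real \<Rightarrow> real^'n) \<Rightarrow> bool" where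
  "regular_along t0 t1 f \<phi> h0 h1 xs \<longleftrightarrow>
     (\<forall>U1 :: (real^'m) set. compact U1 \<longrightarrow>
       (\<exists>\<gamma>>0.
          unif_x_differentiable_on (tube t0 t1 xs \<gamma> \<times> U1) f \<and>
          unif_x_differentiable_on (tube t0 t1 xs \<gamma> \<times> U1) \<phi> \<and>
          unif_x_differentiable_on (tube t0 t1 xs \<gamma> \<times> U1) (\<lambda>t x u. h0 x) \<and>
          unif_x_differentiable_on (tube t0 t1 xs \<gamma> \<times> U1) (\<lambda>t x u. h1 x)))"

definition pontryagin :: "(real \<Rightarrow> 'x \<Rightarrow> 'u \<Rightarrow> real) \<Rightarrow> (real \<Rightarrow> 'x \<Rightarrow> 'u \<Rightarrow> 'x::real_inner) \<Rightarrow>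
    real \<Rightarrow> 'x \<Rightarrow> 'u \<Rightarrow> 'x \<Rightarrow> real \<Rightarrow> real" where
  "pontryagin f \<phi> t x u p lam0 = p \<bullet> \<phi> t x u - lam0 * f t x u"

definition gradient :: "('a::real_inner \<Rightarrow> real) \<Rightarrow> 'a \<Rightarrow> 'a" where
  "gradient g x = (THE d. GDERIV g x :> d)"

end

theory Submission
  imports Defs
begin

text \<open>
  The cost is adjoined to the state, so that a process improves on the given one iff its endpoints
  satisfy finitely many equations and one inequality. Replace the optimal control by constants v_i on
  short intervals of length eps_i r placed to the right of finitely many Lebesgue points, and shift the
  initial state by xi. Up to o(r) the endpoint data depend linearly on (eps, xi); by
  duality with the adjoint equation the coefficient of eps_i is a pairing of the costate with the jump
  of the dynamics at the i-th point. Let K be the convex cone of all these first-order variations,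
  enlarged by the direction of increasing cost. If K were the whole space, a positively homogeneous
  Lipschitz right inverse of the linearisation and Brouwer's fixed point theorem would produce an
  admissible process of smaller cost. Hence K has a supporting hyperplane at 0; its normal
  consists of the multipliers, and nonnegativity on the needles is the maximum condition at almost every
  time, first for a countable dense set of control values and then for all by continuity.
\<close>

subsection \<open>Bounded measurable functions on an interval\<close>

definition bmeas :: "real \<Rightarrow> real \<Rightarrow> (real \<Rightarrow> 'a::euclidean_space) \<Rightarrow> bool" where
  "bmeas a b f \<longleftrightarrow> f \<in> borel_measurable (lebesgue_on {a..b}) \<and> (\<exists>C. \<forall>t\<in>{a..b}. norm (f t) \<le> C)"

lemma bmeasI:
  "f \<in> borel_measurable (lebesgue_on {a..b}) \<Longrightarrow> (\<And>t. t \<in> {a..b} \<Longrightarrow> norm (f t) \<le> C) \<Longrightarrow> bmeas a b f"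
  unfolding bmeas_def by blast

lemma bmeas_measurable: "bmeas a b f \<Longrightarrow> f \<in> borel_measurable (lebesgue_on {a..b})"
  by (simp add: bmeas_def)

lemma bmeas_bound:
  assumes "bmeas a b f"
  obtains C where "C \<ge> 0" "\<And>t. t \<in> {a..b} \<Longrightarrow> norm (f t) \<le> C"
proof -
  obtain C where "\<forall>t\<in>{a..b}. norm (f t) \<le> C"
    using assms unfolding bmeas_def by blast
  then show ?thesis
    by (intro that[of "max C 0"]) (auto intro: le_max_iff_disj[THEN iffD2])
qed

lemma bmeas_cong: "(\<And>t. t \<in> {a..b} \<Longrightarrow> f t = g t) \<Longrightarrow> bmeas a b f \<longleftrightarrow> bmeas a b g"
  unfolding bmeas_def using measurable_lebesgue_cong[of "{a..b}" f g] by simp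

lemma bmeas_absolutely_integrable:
  assumes "bmeas a b f"
  shows "f absolutely_integrable_on {a..b}"
proof -
  obtain C where C: "\<And>t. t \<in> {a..b} \<Longrightarrow> norm (f t) \<le> C"
    using assms by (rule bmeas_bound) blast
  show ?thesis
    by (rule measurable_bounded_by_integrable_imp_absolutely_integrable[where g="\<lambda>_. C"])
       (use assms C in \<open>auto simp: bmeas_def\<close>)
qed

lemma bmeas_integrable: "bmeas a b f \<Longrightarrow> f integrable_on {a..b}"
  using bmeas_absolutely_integrable set_lebesgue_integral_eq_integral(1) by blast

lemma bmeas_subinterval: "bmeas a b f \<Longrightarrow> {c..d} \<subseteq> {a..b} \<Longrightarrow> bmeas c d f"
  unfolding bmeas_def by (meson measurable_restrict_mono subsetD)

lemma integrable_bounded_imp_bmeas: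
  "f integrable_on {a..b} \<Longrightarrow> (\<And>t. t \<in> {a..b} \<Longrightarrow> norm (f t) \<le> C) \<Longrightarrow> bmeas a b f"
  by (meson bmeasI integrable_imp_measurable)

lemma bmeas_integrable_sub: "bmeas a b f \<Longrightarrow> {c..d} \<subseteq> {a..b} \<Longrightarrow> f integrable_on {c..d}"
  using bmeas_integrable bmeas_subinterval by blast

lemma bmeas_continuous:
  assumes "continuous_on {a..b} f"
  shows "bmeas a b f"
proof -
  have "bounded (f ` {a..b})"
    using assms compact_continuous_image compact_imp_bounded by blast
  then obtain C where "\<And>t. t \<in> {a..b} \<Longrightarrow> norm (f t) \<le> C"
    unfolding bounded_iff by blast
  then show ?thesis
    using assms integrable_bounded_imp_bmeas integrable_continuous_real by blast
qed

lemma bmeas_const [simp]: "bmeas a b (\<lambda>_. c)"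
  by (simp add: bmeas_continuous)

lemma bmeas_add: assumes "bmeas a b f" "bmeas a b g" shows "bmeas a b (\<lambda>t. f t + g t)"
proof -
  obtain C where C: "\<And>t. t \<in> {a..b} \<Longrightarrow> norm (f t) \<le> C"
    using assms(1) by (rule bmeas_bound) blast
  obtain D where D: "\<And>t. t \<in> {a..b} \<Longrightarrow> norm (g t) \<le> D"
    using assms(2) by (rule bmeas_bound) blast
  then show ?thesis
    using assms C D by (intro bmeasI[where C="C+D"] borel_measurable_add norm_triangle_mono)
      (simp_all add: bmeas_def)
qed

lemma bmeas_inner: assumes "bmeas a b f" "bmeas a b g" shows "bmeas a b (\<lambda>t. f t \<bullet> g t)"
proof -
  obtain C where C: "\<And>t. t \<in> {a..b} \<Longrightarrow> norm (f t) \<le> C"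
    using assms(1) by (rule bmeas_bound) blast
  obtain D where D: "\<And>t. t \<in> {a..b} \<Longrightarrow> norm (g t) \<le> D"
    using assms(2) by (rule bmeas_bound) blast
  have "norm (f t \<bullet> g t) \<le> C * D" if "t \<in> {a..b}" for t
    using Cauchy_Schwarz_ineq2[of "f t" "g t"] mult_mono'[OF C[OF that] D[OF that]] by simp
  then show ?thesis
    using assms by (intro bmeasI[where C="C*D"] borel_measurable_inner) (auto simp: bmeas_def)
qed

lemma bmeas_scaleR: assumes "bmeas a b f" "bmeas a b g" shows "bmeas a b (\<lambda>t. f t *\<^sub>R g t)"
proof -
  obtain C where C: "\<And>t. t \<in> {a..b} \<Longrightarrow> norm (f t) \<le> C"
    using assms(1) by (rule bmeas_bound) blast
  obtain D where D: "\<And>t. t \<in> {a..b} \<Longrightarrow> norm (g t) \<le> D"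
    using assms(2) by (rule bmeas_bound) blast
  have "norm (f t *\<^sub>R g t) \<le> C * D" if "t \<in> {a..b}" for t
    using mult_mono'[OF C[OF that] D[OF that]] by simp
  then show ?thesis
    using assms by (intro bmeasI[where C="C*D"] borel_measurable_scaleR) (auto simp: bmeas_def)
qed

lemma bmeas_uminus: "bmeas a b f \<Longrightarrow> bmeas a b (\<lambda>t. - f t)"
  using bmeas_scaleR[of a b "\<lambda>_. -1" f] by simp

lemma bmeas_diff: "bmeas a b f \<Longrightarrow> bmeas a b g \<Longrightarrow> bmeas a b (\<lambda>t. f t - g t)"
  using bmeas_add[of a b f "\<lambda>t. - g t"] bmeas_uminus[of a b g] by simp

lemma bmeas_sum: "finite I \<Longrightarrow> (\<And>i. i \<in> I \<Longrightarrow> bmeas a b (f i)) \<Longrightarrow> bmeas a b (\<lambda>t. \<Sum>i\<in>I. f i t)"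
  by (induction I rule: finite_induct) (auto intro: bmeas_add)

lemma bmeas_indicator: "S \<in> sets lebesgue \<Longrightarrow> bmeas a b (indicat_real S)"
  by (rule bmeasI[where C=1])
     (auto simp: indicator_def intro: measurable_restrict_space1[OF borel_measurable_indicator])

lemma bmeas_reflect:
  fixes f :: "real \<Rightarrow> 'a::euclidean_space"
  assumes "bmeas a b f"
  shows "bmeas (-b) (-a) (\<lambda>t. f (-t))"
proof -
  obtain C where C: "\<And>t. t \<in> {a..b} \<Longrightarrow> norm (f t) \<le> C"
    using assms by (rule bmeas_bound) blast
  show ?thesis
    by (rule integrable_bounded_imp_bmeas[where C=C])
       (use bmeas_integrable[OF assms] in \<open>auto intro: C\<close>)
qed

lemma norm_integral_le_integral:
  fixes f :: "real \<Rightarrow> 'a::euclidean_space"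
  assumes "bmeas c d f" "h integrable_on {c..d}" "\<And>t. t \<in> {c..d} \<Longrightarrow> norm (f t) \<le> h t"
  shows "norm (integral {c..d} f) \<le> integral {c..d} h"
  using assms bmeas_integrable integral_norm_bound_integral by blast

lemma norm_integral_le:
  fixes f :: "real \<Rightarrow> 'a::euclidean_space"
  assumes "bmeas c d f" "c \<le> d" "\<And>t. t \<in> {c..d} \<Longrightarrow> norm (f t) \<le> C"
  shows "norm (integral {c..d} f) \<le> C * (d - c)"
  using norm_integral_le_integral[OF assms(1), of "\<lambda>_. C"] assms(2,3)
  by (auto simp: mult.commute)

lemma integral_diff_interval:
  fixes f :: "real \<Rightarrow> 'a::euclidean_space"
  assumes "bmeas a b f" "a \<le> s" "s \<le> t" "t \<le> b"
  shows "integral {a..t} f - integral {a..s} f = integral {s..t} f"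
  using Henstock_Kurzweil_Integration.integral_combine[of a s t f]
    bmeas_integrable_sub[OF assms(1), of a t] assms
  by (auto simp: algebra_simps)

lemma integral_lipschitz:
  fixes f :: "real \<Rightarrow> 'a::euclidean_space"
  assumes f: "bmeas a b f" and C: "\<And>t. t \<in> {a..b} \<Longrightarrow> norm (f t) \<le> C"
    and "s \<in> {a..b}" "t \<in> {a..b}"
  shows "norm (integral {a..t} f - integral {a..s} f) \<le> C * \<bar>t - s\<bar>"
proof -
  have *: "norm (integral {a..t} f - integral {a..s} f) \<le> C * (t - s)" if "s \<le> t" "s \<in> {a..b}" "t \<in> {a..b}" for s t
    using that integral_diff_interval[OF f, of s t] norm_integral_le[OF bmeas_subinterval[OF f], of s t C] C
    by auto
  show ?thesis
    using *[of s t] *[of t s] assms(3,4) by (cases "s \<le> t") (auto simp: norm_minus_commute)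
qed

lemma integral_indicator_interval:
  fixes f :: "real \<Rightarrow> 'a::euclidean_space"
  assumes "{c..d} \<subseteq> {a..b}"
  shows "integral {a..b} (\<lambda>t. indicat_real {c..d} t *\<^sub>R f t) = integral {c..d} f"
proof -
  have "(\<lambda>t. indicat_real {c..d} t *\<^sub>R f t) = (\<lambda>t. if t \<in> {c..d} then f t else 0)"
    by (auto simp: indicator_def)
  then show ?thesis
    using integral_restrict_Int[of "{a..b}" "{c..d}" f] assms by (metis Int_absorb2)
qed

lemma lebesgue_differentiation_right:
  fixes f :: "real \<Rightarrow> 'a::euclidean_space"
  assumes "bmeas a b f"
  obtains N where "negligible N"
    "\<And>t e. t \<in> {a..<b} - N \<Longrightarrow> 0 < e \<Longrightarrow>
       \<exists>d>0. \<forall>h. 0 \<le> h \<and> h < d \<and> t + h \<le> b \<longrightarrow> norm (integral {t..t+h} f - h *\<^sub>R f t) \<le> e * h"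
proof -
  define F where "F = (\<lambda>t. if t \<in> {a..b} then f t else 0)"
  have "F integrable_on cbox c d" for c d
  proof -
    have "F integrable_on UNIV"
      using bmeas_integrable[OF assms] unfolding F_def by (subst integrable_restrict_UNIV)
    then show ?thesis
      using integrable_on_subcbox by blast
  qed
  then obtain N where N: "negligible N" and
     *: "\<And>x e. \<lbrakk>x \<notin> N; 0 < e\<rbrakk> \<Longrightarrow> \<exists>d>0. \<forall>h. 0 < h \<and> h < d \<longrightarrow>
           norm (integral (cbox x (x + h *\<^sub>R One)) F /\<^sub>R h ^ DIM(real) - F x) < e"
    using integrable_ccontinuous_explicit[of F] by blast
  show ?thesis
  proof (rule that[OF N])
    fix t e :: real assume t: "t \<in> {a..<b} - N" and "0 < e"
    obtain d where "d > 0" and d: "\<And>h. 0 < h \<Longrightarrow> h < d \<Longrightarrow>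
         norm (integral {t..t+h} F /\<^sub>R h - F t) < e"
      using *[of t e] t \<open>0 < e\<close> by auto
    have "norm (integral {t..t+h} f - h *\<^sub>R f t) \<le> e * h" if "0 \<le> h" "h < d" "t + h \<le> b" for h
    proof (cases "h = 0")
      case False
      then have "h > 0" using that by simp
      have eq: "integral {t..t+h} F = integral {t..t+h} f"
        by (rule integral_cong) (use t that in \<open>auto simp: F_def\<close>)
      have "integral {t..t+h} f - h *\<^sub>R f t = h *\<^sub>R (integral {t..t+h} F /\<^sub>R h - F t)"
        using \<open>h > 0\<close> t that eq by (simp add: F_def algebra_simps)
      then show ?thesis
        using d[OF \<open>h > 0\<close> \<open>h < d\<close>] \<open>h > 0\<close> by (simp add: mult.commute mult_left_mono)
    qed simp
    then show "\<exists>d>0. \<forall>h. 0 \<le> h \<and> h < d \<and> t + h \<le> b \<longrightarrow> norm (integral {t..t+h} f - h *\<^sub>R f t) \<le> e * h"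
      using \<open>d > 0\<close> by blast
  qed
qed

lemma lebesgue_differentiation:
  fixes f :: "real \<Rightarrow> 'a::euclidean_space"
  assumes f: "bmeas a b f"
  obtains N where "negligible N"
    "\<And>t. t \<in> {a..b} - N \<Longrightarrow> ((\<lambda>t. integral {a..t} f) has_vector_derivative f t) (at t within {a..b})"
proof -
  obtain N1 where N1: "negligible N1" and r: "\<And>t e. t \<in> {a..<b} - N1 \<Longrightarrow> 0 < e \<Longrightarrow>
       \<exists>d>0. \<forall>h. 0 \<le> h \<and> h < d \<and> t + h \<le> b \<longrightarrow> norm (integral {t..t+h} f - h *\<^sub>R f t) \<le> e * h"
    using lebesgue_differentiation_right[OF f] by blast
  obtain N2 where N2: "negligible N2" and l: "\<And>t e. t \<in> {-b..<-a} - N2 \<Longrightarrow> 0 < e \<Longrightarrow>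
       \<exists>d>0. \<forall>h. 0 \<le> h \<and> h < d \<and> t + h \<le> -a \<longrightarrow>
         norm (integral {t..t+h} (\<lambda>t. f (-t)) - h *\<^sub>R f (-t)) \<le> e * h"
    using lebesgue_differentiation_right[OF bmeas_reflect[OF f]] by blast
  have neg: "negligible (uminus ` N2)"
    using N2 by (intro negligible_differentiable_image_negligible) (auto intro!: derivative_intros)
  show ?thesis
  proof (rule that[of "N1 \<union> uminus ` N2 \<union> {a,b}"])
    show "negligible (N1 \<union> uminus ` N2 \<union> {a,b})"
      using N1 neg by auto
    fix t assume t: "t \<in> {a..b} - (N1 \<union> uminus ` N2 \<union> {a,b})"
    have tN: "t \<in> {a..<b} - N1" "-t \<in> {-b..<-a} - N2"
      using t by (auto simp: image_iff)
    show "((\<lambda>t. integral {a..t} f) has_vector_derivative f t) (at t within {a..b})"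
      unfolding has_vector_derivative_def has_derivative_within_alt
    proof (intro conjI allI impI bounded_linear_scaleR_left)
      fix e :: real assume "e > 0"
      obtain d1 where "d1 > 0" and d1: "\<And>h. 0 \<le> h \<Longrightarrow> h < d1 \<Longrightarrow> t + h \<le> b \<Longrightarrow> norm (integral {t..t+h} f - h *\<^sub>R f t) \<le> e * h"
        using r[OF tN(1) \<open>e > 0\<close>] by blast
      obtain d2 where "d2 > 0" and d2: "\<And>h. 0 \<le> h \<Longrightarrow> h < d2 \<Longrightarrow> - t + h \<le> -a \<Longrightarrow>
           norm (integral {-t..-t+h} (\<lambda>t. f (-t)) - h *\<^sub>R f t) \<le> e * h"
        using l[OF tN(2) \<open>e > 0\<close>] by auto
      show "\<exists>d>0. \<forall>y\<in>{a..b}. norm (y - t) < d \<longrightarrow>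
          norm (integral {a..y} f - integral {a..t} f - (y - t) *\<^sub>R f t) \<le> e * norm (y - t)"
      proof (intro exI[of _ "min d1 d2"] conjI ballI impI)
        fix y assume y: "y \<in> {a..b}" "norm (y - t) < min d1 d2"
        show "norm (integral {a..y} f - integral {a..t} f - (y - t) *\<^sub>R f t) \<le> e * norm (y - t)"
        proof (cases "t \<le> y")
          case True
          then have "integral {a..y} f - integral {a..t} f = integral {t..t+(y-t)} f"
            using integral_diff_interval[OF f, of t y] t y by simp
          then show ?thesis
            using d1[of "y - t"] y True by simp
        next
          case False
          have "integral {-t..-t+(t-y)} (\<lambda>t. f (-t)) = integral {y..t} f"
            using Henstock_Kurzweil_Integration.integral_reflect_real[of t y f] by simp
          moreover have "integral {a..t} f - integral {a..y} f = integral {y..t} f"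
            using integral_diff_interval[OF f, of y t] t y False by simp
          ultimately have "norm (integral {a..t} f - integral {a..y} f - (t - y) *\<^sub>R f t) \<le> e * (t - y)"
            using d2[of "t - y"] y False by auto
          moreover have "integral {a..y} f - integral {a..t} f - (y - t) *\<^sub>R f t
             = - (integral {a..t} f - integral {a..y} f - (t - y) *\<^sub>R f t)"
            by (simp add: algebra_simps)
          ultimately show ?thesis
            using False by (simp only: norm_minus_cancel) simp
        qed
      qed (use \<open>d1 > 0\<close> \<open>d2 > 0\<close> in auto)
    qed
  qed
qed

subsection \<open>Absolutely continuous functions\<close>

lemma lipschitz_imp_abs_continuous:
  fixes F :: "real \<Rightarrow> 'a::real_normed_vector"
  assumes "\<And>s t. s \<in> {a..b} \<Longrightarrow> t \<in> {a..b} \<Longrightarrow> norm (F t - F s) \<le> C * \<bar>t - s\<bar>"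
  shows "abs_continuous_on_interval a b F"
  unfolding abs_continuous_on_interval_def
proof (intro allI impI)
  fix e :: real assume "e > 0"
  show "\<exists>\<delta>>0. \<forall>D S. D division_of S \<and> S \<subseteq> {a..b} \<and> (\<Sum>K\<in>D. Sup K - Inf K) < \<delta> \<longrightarrow>
        (\<Sum>K\<in>D. norm (F (Sup K) - F (Inf K))) < e"
  proof (intro exI[of _ "e / (\<bar>C\<bar> + 1)"] conjI allI impI)
    fix D S assume D: "D division_of S \<and> S \<subseteq> {a..b} \<and> (\<Sum>K\<in>D. Sup K - Inf K) < e / (\<bar>C\<bar> + 1)"
    have "norm (F (Sup K) - F (Inf K)) \<le> (\<bar>C\<bar> + 1) * (Sup K - Inf K)" if "K \<in> D" for K
    proof -
      obtain u v where K: "K = {u..v}" "K \<noteq> {}"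
        using division_ofD(3,4)[OF D[THEN conjunct1] \<open>K \<in> D\<close>] by auto
      then have uv: "u \<le> v" "u \<in> {a..b}" "v \<in> {a..b}"
        using subset_trans[OF division_ofD(2)[OF D[THEN conjunct1] that] D[THEN conjunct2, THEN conjunct1]] by auto
      have "norm (F v - F u) \<le> C * (v - u)"
        using assms[OF uv(2,3)] uv(1) by simp
      also have "\<dots> \<le> (\<bar>C\<bar> + 1) * (v - u)"
        using uv(1) by (intro mult_right_mono) auto
      finally show ?thesis using K uv by simp
    qed
    then have "(\<Sum>K\<in>D. norm (F (Sup K) - F (Inf K))) \<le> (\<Sum>K\<in>D. (\<bar>C\<bar> + 1) * (Sup K - Inf K))"
      by (rule sum_mono)
    also have "\<dots> = (\<bar>C\<bar> + 1) * (\<Sum>K\<in>D. Sup K - Inf K)"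
      by (simp add: sum_distrib_left)
    also have "\<dots> < (\<bar>C\<bar> + 1) * (e / (\<bar>C\<bar> + 1))"
      using D by (intro mult_strict_left_mono) auto
    finally show "(\<Sum>K\<in>D. norm (F (Sup K) - F (Inf K))) < e" by simp
  qed (use \<open>e > 0\<close> in auto)
qed

lemma abs_continuous_negligible_gauge:
  fixes F :: "real \<Rightarrow> 'a::real_normed_vector"
  assumes F: "abs_continuous_on_interval a b F" and N: "negligible N" and "e > 0"
  obtains \<gamma> where "gauge \<gamma>"
    "\<And>p. p tagged_division_of {a..b} \<Longrightarrow> \<gamma> fine p \<Longrightarrow>
       (\<Sum>(x,K)\<in>{(x,K)\<in>p. x \<in> N}. norm (F (Sup K) - F (Inf K))) < e"
proof -
  obtain \<delta> where "\<delta> > 0" and \<delta>: "\<And>D S. D division_of S \<Longrightarrow> S \<subseteq> {a..b} \<Longrightarrow> (\<Sum>K\<in>D. Sup K - Inf K) < \<delta> \<Longrightarrow>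
        (\<Sum>K\<in>D. norm (F (Sup K) - F (Inf K))) < e"
    using F \<open>e > 0\<close> unfolding abs_continuous_on_interval_def by metis
  obtain T where T: "open T" "N \<subseteq> T" "T - N \<in> lmeasurable" "emeasure lebesgue (T - N) < ennreal \<delta>"
    using sets_lebesgue_outer_open[of N \<delta>] N \<open>\<delta> > 0\<close> negligible_imp_sets by blast
  have Tm: "T \<in> lmeasurable" "measure lebesgue T < \<delta>"
  proof -
    have "T = (T - N) \<union> N" using T by auto
    then show Tl: "T \<in> lmeasurable"
      using T(3) N by (metis fmeasurable.Un negligible_imp_measurable)
    have "measure lebesgue T = measure lebesgue (T - N)"
      using N Tl by (simp add: measure_Diff_null_set negligible_iff_null_sets fmeasurableD)
    also have "\<dots> < \<delta>"
      using T(3,4) \<open>\<delta> > 0\<close> by (simp add: emeasure_eq_measure2 ennreal_less_iff)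
    finally show "measure lebesgue T < \<delta>" .
  qed
  define \<gamma> where "\<gamma> = (\<lambda>x. if x \<in> N then T else UNIV)"
  show ?thesis
  proof (rule that[of \<gamma>])
    show "gauge \<gamma>"
      using T by (auto simp: gauge_def \<gamma>_def)
    fix p assume p: "p tagged_division_of {a..b}" and fine: "\<gamma> fine p"
    define r where "r = {(x,K)\<in>p. x \<in> N}"
    define q where "q = {(x,K)\<in>r. Inf K < Sup K}"
    have fin: "finite r" "finite q"
      using p unfolding r_def q_def by (auto intro!: finite_subset[OF _ tagged_division_of_finite[OF p]])
    have q: "q tagged_partial_division_of {a..b}"
      by (rule tagged_partial_division_subset[where s=p])
         (use p in \<open>auto simp: q_def r_def tagged_division_of_def\<close>)
    have ivl: "\<exists>u v. K = {u..v} \<and> u \<le> v" if "(x,K) \<in> p" for x K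
      using tagged_division_ofD(2,4)[OF p that] by (metis atLeastAtMost_iff box_real(2) order_trans)
    have inj: "inj_on snd q"
    proof (rule inj_onI, rule ccontr)
      fix y z assume yz: "y \<in> q" "z \<in> q" "snd y = snd z" "y \<noteq> z"
      obtain x1 x2 K where e: "y = (x1,K)" "z = (x2,K)" using yz by (cases y; cases z) auto
      have "interior K = {}"
        using tagged_partial_division_ofD(5)[OF q, of x1 K x2 K] yz e by auto
      moreover obtain u v where "K = {u..v}" "u \<le> v" using ivl[of x1 K] yz e by (auto simp: q_def r_def)
      ultimately show False using yz e by (auto simp: q_def interior_atLeastAtMost_real split: if_splits)
    qed
    have div: "snd ` q division_of \<Union>(snd ` q)"
      by (rule partial_division_of_tagged_division[OF q])
    have sub: "\<Union>(snd ` q) \<subseteq> T"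
      using fine by (fastforce simp: q_def r_def \<gamma>_def fine_def)
    have "(\<Sum>K\<in>snd ` q. Sup K - Inf K) = sum (measure lebesgue) (snd ` q)"
    proof (rule sum.cong[OF refl])
      fix K assume "K \<in> snd ` q"
      then obtain x where "(x,K) \<in> p" by (auto simp: q_def r_def)
      then obtain u v where "K = {u..v}" "u \<le> v" using ivl by blast
      then show "Sup K - Inf K = measure lebesgue K" by simp
    qed
    also have "\<dots> = measure lebesgue (\<Union>(snd ` q))"
      using content_division[OF div] by simp
    also have "\<dots> \<le> measure lebesgue T"
      by (rule measure_mono_fmeasurable[OF sub])
         (use Tm div in \<open>auto simp: fmeasurableD lmeasurable_division[THEN fmeasurableD]\<close>)
    finally have "(\<Sum>K\<in>snd ` q. Sup K - Inf K) < \<delta>"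
      using Tm(2) by simp
    moreover have "\<Union>(snd ` q) \<subseteq> {a..b}"
      using tagged_division_ofD(3)[OF p] by (fastforce simp: q_def r_def)
    ultimately have "(\<Sum>K\<in>snd ` q. norm (F (Sup K) - F (Inf K))) < e"
      using \<delta>[OF div] by blast
    also have "(\<Sum>K\<in>snd ` q. norm (F (Sup K) - F (Inf K))) = (\<Sum>(x,K)\<in>q. norm (F (Sup K) - F (Inf K)))"
      by (subst sum.reindex[OF inj]) (simp add: case_prod_beta)
    also have "\<dots> = (\<Sum>(x,K)\<in>r. norm (F (Sup K) - F (Inf K)))"
    proof (rule sum.mono_neutral_left[OF fin(1)])
      show "q \<subseteq> r" by (auto simp: q_def)
      show "\<forall>i\<in>r - q. (case i of (x, K) \<Rightarrow> norm (F (Sup K) - F (Inf K))) = 0"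
      proof
        fix i assume i: "i \<in> r - q"
        obtain x K where ik: "i = (x,K)" by (cases i)
        then obtain u v where "K = {u..v}" "u \<le> v" using ivl[of x K] i by (auto simp: r_def)
        moreover have "\<not> Inf K < Sup K" using i ik by (auto simp: q_def)
        ultimately show "(case i of (x, K) \<Rightarrow> norm (F (Sup K) - F (Inf K))) = 0" using ik by auto
      qed
    qed
    finally show "(\<Sum>(x,K)\<in>{(x,K)\<in>p. x \<in> N}. norm (F (Sup K) - F (Inf K))) < e"
      by (simp add: r_def)
  qed
qed

lemma has_integral_abs_continuous:
  fixes F :: "real \<Rightarrow> 'a::euclidean_space"
  assumes "a \<le> b" and F: "abs_continuous_on_interval a b F" and N: "negligible N"
    and deriv: "\<And>t. t \<in> {a..b} - N \<Longrightarrow> (F has_vector_derivative g t) (at t within {a..b})"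
  shows "(g has_integral (F b - F a)) {a..b}"
proof (cases "a = b")
  case False
  then have "a < b" using \<open>a \<le> b\<close> by simp
  define g' where "g' = (\<lambda>t. if t \<in> N then 0 else g t)"
  have "(g' has_integral (F b - F a)) {a..b}"
    unfolding has_integral_factor_content_real
  proof (intro allI impI)
    fix e :: real assume "e > 0"
    have "\<forall>x. \<exists>d>0. x \<in> {a..b} - N \<longrightarrow>
         (\<forall>y\<in>{a..b}. norm (y-x) < d \<longrightarrow> norm (F y - F x - (y-x) *\<^sub>R g x) \<le> (e/2) * norm (y-x))"
      using deriv[unfolded has_vector_derivative_def has_derivative_within_alt] \<open>e > 0\<close>
      by (metis half_gt_zero zero_less_one)
    then obtain d where d0: "\<And>x. 0 < d x" and
      d: "\<And>x y. x \<in> {a..b} - N \<Longrightarrow> y \<in> {a..b} \<Longrightarrow> norm (y-x) < d x \<Longrightarrow>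
             norm (F y - F x - (y-x) *\<^sub>R g x) \<le> (e/2) * norm (y-x)"
      by metis
    have "e / 2 * (b - a) > 0" using \<open>e > 0\<close> \<open>a < b\<close> by simp
    then obtain \<gamma> where \<gamma>: "gauge \<gamma>" "\<And>p. p tagged_division_of {a..b} \<Longrightarrow> \<gamma> fine p \<Longrightarrow>
       (\<Sum>(x,K)\<in>{(x,K)\<in>p. x \<in> N}. norm (F (Sup K) - F (Inf K))) < e / 2 * (b - a)"
      by (rule abs_continuous_negligible_gauge[OF F N]) blast
    show "\<exists>d. gauge d \<and> (\<forall>p. p tagged_division_of {a..b} \<and> d fine p \<longrightarrow>
       norm ((\<Sum>(x, k)\<in>p. measure lborel k *\<^sub>R g' x) - (F b - F a)) \<le> e * measure lborel {a..b})"
    proof (intro exI[of _ "\<lambda>x. \<gamma> x \<inter> ball x (d x)"] conjI allI impI)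
      show "gauge (\<lambda>x. \<gamma> x \<inter> ball x (d x))"
        using gauge_Int[OF \<gamma>(1) gauge_ball_dependent, of d] d0 by simp
      fix p assume p: "p tagged_division_of {a..b} \<and> (\<lambda>x. \<gamma> x \<inter> ball x (d x)) fine p"
      then have pt: "p tagged_division_of {a..b}" and f1: "\<gamma> fine p" and f2: "(\<lambda>x. ball x (d x)) fine p"
        by (auto simp: fine_Int)
      have finp: "finite p" using pt by (rule tagged_division_of_finite)
      have ba: "b - a = (\<Sum>(x,K)\<in>p. Sup K - Inf K)" "F b - F a = (\<Sum>(x,K)\<in>p. F (Sup K) - F (Inf K))"
        using additive_tagged_division_1[OF \<open>a \<le> b\<close> pt, of F] additive_tagged_division_1[OF \<open>a \<le> b\<close> pt, of "\<lambda>x. x"]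
        by auto
      have 1: "norm (measure lborel K *\<^sub>R g' x - (F (Sup K) - F (Inf K)))
          \<le> (e/2) * (Sup K - Inf K) + (if x \<in> N then norm (F (Sup K) - F (Inf K)) else 0)"
        if xK: "(x,K) \<in> p" for x K
      proof -
        obtain u v where K: "K = {u..v}" and xuv: "u \<le> x" "x \<le> v"
          using tagged_division_ofD(2,4)[OF pt xK] by auto
        have uvab: "u \<in> {a..b}" "v \<in> {a..b}" "x \<in> {a..b}"
          using tagged_division_ofD(3)[OF pt xK] K xuv by auto
        show ?thesis
        proof (cases "x \<in> N")
          case True
          then show ?thesis using K xuv \<open>e > 0\<close> by (simp add: g'_def norm_minus_commute)
        next
          case False
          have "K \<subseteq> ball x (d x)"
            using f2 xK by (auto simp: fine_def)
          moreover have "u \<in> K" "v \<in> K"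
            using K xuv by auto
          ultimately have "norm (u - x) < d x" "norm (v - x) < d x"
            by (auto simp: dist_norm norm_minus_commute)
          then have a1: "norm (F u - F x - (u-x) *\<^sub>R g x) \<le> (e/2) * (x - u)"
            and a2: "norm (F v - F x - (v-x) *\<^sub>R g x) \<le> (e/2) * (v - x)"
            using d[of x u] d[of x v] uvab False xuv by auto
          have "(v - u) *\<^sub>R g x - (F v - F u) = (F u - F x - (u-x) *\<^sub>R g x) - (F v - F x - (v-x) *\<^sub>R g x)"
            by (simp add: algebra_simps)
          then have "norm ((v - u) *\<^sub>R g x - (F v - F u)) \<le> (e/2) * (x - u) + (e/2) * (v - x)"
            using order_trans[OF norm_triangle_ineq4 add_mono[OF a1 a2]] by (simp only:)
          also have "\<dots> = (e/2) * (v - u)"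
            by (simp add: field_simps)
          finally show ?thesis
            using False K xuv by (simp add: g'_def)
        qed
      qed
      have "(\<Sum>(x, k)\<in>p. measure lborel k *\<^sub>R g' x) - (F b - F a)
           = (\<Sum>(x,K)\<in>p. measure lborel K *\<^sub>R g' x - (F (Sup K) - F (Inf K)))"
        unfolding ba(2) by (simp add: sum_subtractf case_prod_beta)
      also have "norm \<dots> \<le> (\<Sum>(x,K)\<in>p. (e/2) * (Sup K - Inf K) + (if x \<in> N then norm (F (Sup K) - F (Inf K)) else 0))"
        by (rule sum_norm_le) (use 1 in auto)
      also have "\<dots> = (e/2) * (b - a) + (\<Sum>(x,K)\<in>p. if x \<in> N then norm (F (Sup K) - F (Inf K)) else 0)"
        unfolding ba(1) by (simp add: sum.distrib sum_distrib_left case_prod_beta)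
      also have "(\<Sum>(x,K)\<in>p. if x \<in> N then norm (F (Sup K) - F (Inf K)) else 0)
          = (\<Sum>(x,K)\<in>{(x,K)\<in>p. x \<in> N}. norm (F (Sup K) - F (Inf K)))"
        by (rule sum.mono_neutral_cong_right[OF finp]) (auto split: if_splits)
      also have "\<dots> < e / 2 * (b - a)"
        by (rule \<gamma>(2)[OF pt f1])
      finally show "norm ((\<Sum>(x, k)\<in>p. measure lborel k *\<^sub>R g' x) - (F b - F a)) \<le> e * measure lborel {a..b}"
        using \<open>a \<le> b\<close> by simp
    qed
  qed
  then show ?thesis
    by (rule has_integral_spike[OF N, rotated]) (auto simp: g'_def)
qed (use has_integral_refl[of g b] in simp)

subsection \<open>Integral equations\<close>

lemma integral_exp_weight:
  fixes a t K :: real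
  assumes "K > 0" "a \<le> t"
  shows "((\<lambda>s. exp (K * (s - a))) has_integral (exp (K * (t - a)) - 1) / K) {a..t}"
proof -
  have "((\<lambda>s. exp (K * (s - a))) has_integral exp (K * (t - a)) / K - exp (K * (a - a)) / K) {a..t}"
    by (rule fundamental_theorem_of_calculus[OF assms(2)])
       (use assms(1) in \<open>auto intro!: derivative_eq_intros simp: has_real_derivative_iff_has_vector_derivative[symmetric]\<close>)
  then show ?thesis by (simp add: diff_divide_distrib)
qed

text \<open>Measuring functions in the norm weighted by the factor exp(-(2 L + 1)(t - a)) makes Volterra
  operators with Lipschitz constant L contract by 1/2. This yields both Gronwall's inequality and
  global solvability.\<close>

lemma weighted_integral_le:
  fixes L m :: real
  assumes "L \<ge> 0" "m \<ge> 0" "a \<le> t"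
  shows "integral {a..t} (\<lambda>s. L * (m * exp ((2 * L + 1) * (s - a)))) \<le> m / 2 * exp ((2 * L + 1) * (t - a))"
proof -
  define K where "K = 2 * L + 1"
  have K: "K > 0" using assms by (simp add: K_def)
  have "integral {a..t} (\<lambda>s. L * (m * exp (K * (s - a)))) = L * m * ((exp (K * (t - a)) - 1) / K)"
    using integral_unique[OF has_integral_mult_right[OF integral_exp_weight[OF K assms(3)], of "L * m"]]
    by (simp add: mult.assoc)
  also have "\<dots> = (L / K) * (m * (exp (K * (t - a)) - 1))"
    by simp
  also have "\<dots> \<le> (1/2) * (m * exp (K * (t - a)))"
  proof (intro mult_mono mult_left_mono)
    show "L / K \<le> 1 / 2" using assms K by (simp add: K_def field_simps)
    show "0 \<le> m * (exp (K * (t - a)) - 1)" using assms K by simp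
  qed (use assms K in auto)
  finally show ?thesis by (simp add: K_def)
qed

lemma gronwall:
  fixes z :: "real \<Rightarrow> 'a::euclidean_space"
  assumes "L \<ge> 0" and cont: "continuous_on {a..b} z"
    and bound: "\<And>t. t \<in> {a..b} \<Longrightarrow> norm (z t) \<le> c + integral {a..t} (\<lambda>s. L * norm (z s))"
    and t: "t \<in> {a..b}"
  shows "norm (z t) \<le> 2 * c * exp ((2 * L + 1) * (b - a))"
proof -
  define K where "K = 2 * L + 1"
  have K: "K > 0" using assms by (simp add: K_def)
  have "a \<in> {a..b}" using t by auto
  from bound[OF this] have c0: "0 \<le> c"
    by simp (meson norm_ge_zero order_trans)
  have exp_cancel: "exp (- K * x) * exp (K * x) = 1" for x
    by (simp flip: exp_add)
  have "continuous_on {a..b} (\<lambda>t. exp (- K * (t - a)) * norm (z t))"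
    by (intro continuous_intros cont)
  then have "\<exists>u\<in>{a..b}. \<forall>s\<in>{a..b}. exp (- K * (s - a)) * norm (z s) \<le> exp (- K * (u - a)) * norm (z u)"
    by (rule continuous_attains_sup[OF compact_Icc, rotated]) (use t in auto)
  then obtain u where u: "u \<in> {a..b}" and
    max: "\<And>s. s \<in> {a..b} \<Longrightarrow> exp (- K * (s - a)) * norm (z s) \<le> exp (- K * (u - a)) * norm (z u)"
    by blast
  define m where "m = exp (- K * (u - a)) * norm (z u)"
  have m0: "m \<ge> 0" by (simp add: m_def)
  have zm: "norm (z s) \<le> m * exp (K * (s - a))" if "s \<in> {a..b}" for s
  proof -
    have "norm (z s) = exp (- K * (s - a)) * norm (z s) * exp (K * (s - a))"
      using exp_cancel[of "s - a"] by (simp add: mult.commute mult.left_commute)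
    also have "\<dots> \<le> m * exp (K * (s - a))"
      using max[OF that] by (intro mult_right_mono) (auto simp: m_def)
    finally show ?thesis .
  qed
  have "norm (z u) \<le> c + integral {a..u} (\<lambda>s. L * norm (z s))"
    by (rule bound[OF u])
  also have "integral {a..u} (\<lambda>s. L * norm (z s)) \<le> integral {a..u} (\<lambda>s. L * (m * exp (K * (s - a))))"
  proof (rule integral_le)
    show "(\<lambda>s. L * norm (z s)) integrable_on {a..u}"
      using u by (intro integrable_continuous_real continuous_intros continuous_on_subset[OF cont]) auto
    show "(\<lambda>s. L * (m * exp (K * (s - a)))) integrable_on {a..u}"
      by (intro integrable_continuous_real continuous_intros)
    show "L * norm (z s) \<le> L * (m * exp (K * (s - a)))" if "s \<in> {a..u}" for s
      using zm[of s] that u \<open>L \<ge> 0\<close> by (intro mult_left_mono) auto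
  qed
  also have "\<dots> \<le> m / 2 * exp (K * (u - a))"
    unfolding K_def by (rule weighted_integral_le) (use assms m0 u in auto)
  finally have "norm (z u) \<le> c + m / 2 * exp (K * (u - a))" by simp
  then have "exp (- K * (u - a)) * norm (z u) \<le> exp (- K * (u - a)) * (c + m / 2 * exp (K * (u - a)))"
    by (rule mult_left_mono) simp
  also have "\<dots> = exp (- K * (u - a)) * c + m / 2 * (exp (- K * (u - a)) * exp (K * (u - a)))"
    by (simp only: distrib_left mult.left_commute mult.assoc)
  also have "\<dots> = exp (- K * (u - a)) * c + m / 2"
    by (simp only: exp_cancel mult_1_right)
  also have "exp (- K * (u - a)) * c \<le> 1 * c"
    using c0 K u by (intro mult_right_mono) auto
  finally have "m \<le> 2 * c"
    by (simp add: m_def)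
  have "norm (z t) \<le> m * exp (K * (t - a))" by (rule zm[OF t])
  also have "\<dots> \<le> 2 * c * exp (K * (b - a))"
    using \<open>m \<le> 2 * c\<close> m0 K t c0 by (intro mult_mono) auto
  finally show ?thesis by (simp add: K_def)
qed

lemma picard:
  fixes g :: "real \<Rightarrow> 'a::euclidean_space \<Rightarrow> 'a"
  assumes "L \<ge> 0"
    and meas: "\<And>x. continuous_on {a..b} x \<Longrightarrow> bmeas a b (\<lambda>t. g t (x t))"
    and lip: "\<And>t x y. t \<in> {a..b} \<Longrightarrow> norm (g t x - g t y) \<le> L * norm (x - y)"
  obtains x where "continuous_on {a..b} x"
    "\<And>t. t \<in> {a..b} \<Longrightarrow> x t = x0 + integral {a..t} (\<lambda>s. g s (x s))"
proof (cases "a \<le> b")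
  case False
  then show ?thesis by (intro that[of "\<lambda>_. 0"]) auto
next
  case True
  define K where "K = 2 * L + 1"
  have K: "K > 0" using assms by (simp add: K_def)
  define X where "X = (\<lambda>(z :: real \<Rightarrow>\<^sub>C 'a) s. exp (K * (s - a)) *\<^sub>R apply_bcontfun z s)"
  define T where "T = (\<lambda>z t. exp (- K * (t - a)) *\<^sub>R (x0 + integral {a..t} (\<lambda>s. g s (X z s))))"
  have contX: "continuous_on S (X z)" for S z
    unfolding X_def by (intro continuous_intros continuous_on_apply_bcontfun)
  have bm: "bmeas a b (\<lambda>s. g s (X z s))" for z
    by (intro meas contX)
  have "continuous_on {a..b} (T z)" for z
    unfolding T_def by (intro continuous_intros indefinite_integral_continuous_1 bmeas_integrable bm)
  then have "\<exists>h :: real \<Rightarrow>\<^sub>C 'a. \<forall>x. apply_bcontfun h x = T z (clamp a b x)" for z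
    using continuous_on_cbox_bcontfunE[of a b "T z"] by (metis box_real(2))
  then obtain G :: "(real \<Rightarrow>\<^sub>C 'a) \<Rightarrow> real \<Rightarrow>\<^sub>C 'a" where G: "\<And>z x. apply_bcontfun (G z) x = T z (clamp a b x)"
    by metis
  have contr: "norm (T z t - T w t) \<le> (1/2) * dist z w" if t: "t \<in> {a..b}" for z w t
  proof -
    have "integral {a..t} (\<lambda>s. g s (X z s)) - integral {a..t} (\<lambda>s. g s (X w s))
        = integral {a..t} (\<lambda>s. g s (X z s) - g s (X w s))"
      using t by (intro integral_diff[symmetric] bmeas_integrable_sub[OF bm]) auto
    also have "norm \<dots> \<le> integral {a..t} (\<lambda>s. L * (dist z w * exp (K * (s - a))))"
    proof (rule norm_integral_le_integral)
      show "bmeas a t (\<lambda>s. g s (X z s) - g s (X w s))"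
        using t by (intro bmeas_diff bmeas_subinterval[OF bm]) auto
      show "(\<lambda>s. L * (dist z w * exp (K * (s - a)))) integrable_on {a..t}"
        by (intro integrable_continuous_real continuous_intros)
      fix s assume s: "s \<in> {a..t}"
      have "norm (g s (X z s) - g s (X w s)) \<le> L * norm (X z s - X w s)"
        using s t by (intro lip) auto
      also have "norm (X z s - X w s) = exp (K * (s - a)) * dist (apply_bcontfun z s) (apply_bcontfun w s)"
        by (simp add: X_def dist_norm flip: scaleR_diff_right)
      also have "\<dots> \<le> exp (K * (s - a)) * dist z w"
        by (intro mult_left_mono dist_bounded) auto
      finally show "norm (g s (X z s) - g s (X w s)) \<le> L * (dist z w * exp (K * (s - a)))"
        using \<open>L \<ge> 0\<close> by (simp add: mult_left_mono mult.commute[of "dist z w"])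
    qed
    also have "\<dots> \<le> dist z w / 2 * exp (K * (t - a))"
      unfolding K_def by (rule weighted_integral_le) (use assms t in auto)
    finally have *: "norm (integral {a..t} (\<lambda>s. g s (X z s)) - integral {a..t} (\<lambda>s. g s (X w s)))
       \<le> dist z w / 2 * exp (K * (t - a))" .
    have "norm (T z t - T w t) = exp (- K * (t - a)) *
        norm (integral {a..t} (\<lambda>s. g s (X z s)) - integral {a..t} (\<lambda>s. g s (X w s)))"
      by (simp add: T_def flip: scaleR_diff_right)
    also have "\<dots> \<le> exp (- K * (t - a)) * (dist z w / 2 * exp (K * (t - a)))"
      using * by (intro mult_left_mono) auto
    also have "\<dots> = dist z w / 2 * (exp (- K * (t - a)) * exp (K * (t - a)))"
      by (simp only: mult.left_commute mult.assoc)
    also have "\<dots> = (1/2) * dist z w"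
      by (simp flip: exp_add)
    finally show ?thesis .
  qed
  have clamp: "clamp a b x \<in> {a..b}" for x :: real
    using clamp_in_interval[of a b x] True by simp
  have "dist (G z) (G w) \<le> (1/2) * dist z w" for z w
    by (rule dist_bound) (use contr[OF clamp] in \<open>simp add: G dist_norm\<close>)
  then obtain z where z: "G z = z"
    using banach_fix_type[of "1/2" G] by auto
  show ?thesis
  proof (rule that[of "X z"])
    show "continuous_on {a..b} (X z)" by (rule contX)
    fix t assume t: "t \<in> {a..b}"
    have "apply_bcontfun z t = T z t"
      using G[of z t] t z by (simp add: clamp_cancel_cbox)
    then show "X z t = x0 + integral {a..t} (\<lambda>s. g s (X z s))"
      unfolding X_def[of] T_def by (simp add: exp_minus X_def)
  qed
qed

lemma picard_backward:
  fixes g :: "real \<Rightarrow> 'a::euclidean_space \<Rightarrow> 'a"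
  assumes "L \<ge> 0"
    and meas: "\<And>x. continuous_on {a..b} x \<Longrightarrow> bmeas a b (\<lambda>t. g t (x t))"
    and lip: "\<And>t x y. t \<in> {a..b} \<Longrightarrow> norm (g t x - g t y) \<le> L * norm (x - y)"
  obtains x where "continuous_on {a..b} x"
    "\<And>t. t \<in> {a..b} \<Longrightarrow> x t = x0 + integral {t..b} (\<lambda>s. g s (x s))"
proof -
  have meas': "bmeas (-b) (-a) (\<lambda>t. g (-t) (x t))" if "continuous_on {-b..-a} x" for x
  proof -
    have "continuous_on {a..b} (x \<circ> uminus)"
      by (intro continuous_on_compose continuous_intros) (use that in simp)
    then show ?thesis
      using bmeas_reflect[OF meas] by fastforce
  qed
  obtain x where x: "continuous_on {-b..-a} x"
    "\<And>t. t \<in> {-b..-a} \<Longrightarrow> x t = x0 + integral {-b..t} (\<lambda>s. g (-s) (x s))"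
    using picard[where g = "\<lambda>t. g (-t)" and a = "-b" and b = "-a" and L = L and ?x0.0 = x0] meas' lip \<open>L \<ge> 0\<close>
    by auto
  show ?thesis
  proof (rule that[of "\<lambda>t. x (-t)"])
    show "continuous_on {a..b} (\<lambda>t. x (-t))"
      by (rule continuous_on_compose2[OF x(1)]) (auto intro!: continuous_intros)
    show "x (-t) = x0 + integral {t..b} (\<lambda>s. g s (x (-s)))" if "t \<in> {a..b}" for t
      using x(2)[of "-t"] that Henstock_Kurzweil_Integration.integral_reflect_real[of b t "\<lambda>s. g s (x (-s))"] by simp
  qed
qed

lemma integral_parts_lipschitz:
  fixes P y :: "real \<Rightarrow> 'a::euclidean_space"
  assumes "a \<le> b" and k: "bmeas a b k" and h: "bmeas a b h"
    and P: "\<And>t. t \<in> {a..b} \<Longrightarrow> P t = q + integral {t..b} k"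
    and y: "\<And>t. t \<in> {a..b} \<Longrightarrow> y t = y0 + integral {a..t} h"
  shows "((\<lambda>t. P t \<bullet> h t - k t \<bullet> y t) has_integral (P b \<bullet> y b - P a \<bullet> y a)) {a..b}"
proof -
  have P': "P t = P a - integral {a..t} k" if "t \<in> {a..b}" for t
    using that P[of t] P[of a] Henstock_Kurzweil_Integration.integral_combine[of a t b k]
      bmeas_integrable[OF k] by (auto simp: algebra_simps)
  obtain N1 where N1: "negligible N1"
    "\<And>t. t \<in> {a..b} - N1 \<Longrightarrow> ((\<lambda>t. integral {a..t} k) has_vector_derivative k t) (at t within {a..b})"
    using lebesgue_differentiation[OF k] by blast
  obtain N2 where N2: "negligible N2"
    "\<And>t. t \<in> {a..b} - N2 \<Longrightarrow> ((\<lambda>t. integral {a..t} h) has_vector_derivative h t) (at t within {a..b})"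
    using lebesgue_differentiation[OF h] by blast
  obtain Ck where Ck: "Ck \<ge> 0" "\<And>t. t \<in> {a..b} \<Longrightarrow> norm (k t) \<le> Ck"
    using bmeas_bound[OF k] by blast
  obtain Ch where Ch: "Ch \<ge> 0" "\<And>t. t \<in> {a..b} \<Longrightarrow> norm (h t) \<le> Ch"
    using bmeas_bound[OF h] by blast
  have lipP: "norm (P t - P s) \<le> Ck * \<bar>t - s\<bar>" if "s \<in> {a..b}" "t \<in> {a..b}" for s t
    using integral_lipschitz[OF k Ck(2), of s t] P'[OF that(1)] P'[OF that(2)] that
    by (simp add: norm_minus_commute)
  have lipy: "norm (y t - y s) \<le> Ch * \<bar>t - s\<bar>" if "s \<in> {a..b}" "t \<in> {a..b}" for s t
    using integral_lipschitz[OF h Ch(2), of s t] y[OF that(1)] y[OF that(2)] that by simp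
  define BP where "BP = norm (P a) + Ck * (b - a)"
  define By where "By = norm (y a) + Ch * (b - a)"
  have BP: "norm (P t) \<le> BP" if t: "t \<in> {a..b}" for t
  proof -
    have "Ck * \<bar>t - a\<bar> \<le> Ck * (b - a)" using t Ck(1) by (intro mult_left_mono) auto
    then show ?thesis
      using lipP[of a t] t norm_triangle_ineq[of "P a" "P t - P a"] unfolding BP_def by auto
  qed
  have By: "norm (y t) \<le> By" if t: "t \<in> {a..b}" for t
  proof -
    have "Ch * \<bar>t - a\<bar> \<le> Ch * (b - a)" using t Ch(1) by (intro mult_left_mono) auto
    then show ?thesis
      using lipy[of a t] t norm_triangle_ineq[of "y a" "y t - y a"] unfolding By_def by auto
  qed
  have ac: "abs_continuous_on_interval a b (\<lambda>t. P t \<bullet> y t)"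
  proof (rule lipschitz_imp_abs_continuous[where C="BP * Ch + Ck * By"])
    fix s t assume st: "s \<in> {a..b}" "t \<in> {a..b}"
    have "P t \<bullet> y t - P s \<bullet> y s = P t \<bullet> (y t - y s) + (P t - P s) \<bullet> y s"
      by (simp add: inner_simps)
    also have "norm \<dots> \<le> norm (P t) * norm (y t - y s) + norm (P t - P s) * norm (y s)"
      by (intro norm_triangle_mono) (simp_all add: Cauchy_Schwarz_ineq2)
    also have "\<dots> \<le> BP * (Ch * \<bar>t - s\<bar>) + (Ck * \<bar>t - s\<bar>) * By"
      using BP[OF st(2)] By[OF st(1)] lipP[OF st] lipy[OF st] Ck(1) Ch(1)
      by (intro add_mono mult_mono) (auto intro: order_trans[OF norm_ge_zero])
    finally show "norm (P t \<bullet> y t - P s \<bullet> y s) \<le> (BP * Ch + Ck * By) * \<bar>t - s\<bar>"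
      by (simp add: algebra_simps)
  qed
  show ?thesis
  proof (rule has_integral_abs_continuous[OF \<open>a \<le> b\<close> ac, of "N1 \<union> N2"])
    show "negligible (N1 \<union> N2)" using N1 N2 by simp
    fix t assume t: "t \<in> {a..b} - (N1 \<union> N2)"
    have "((\<lambda>t. P a - integral {a..t} k) has_vector_derivative 0 - k t) (at t within {a..b})"
      using N1(2)[of t] t by (intro derivative_intros) auto
    then have dP: "(P has_vector_derivative - k t) (at t within {a..b})"
      using has_vector_derivative_transform[OF _ P'] t by fastforce
    have "((\<lambda>t. y0 + integral {a..t} h) has_vector_derivative 0 + h t) (at t within {a..b})"
      using N2(2)[of t] t by (intro derivative_intros) auto
    then have dy: "(y has_vector_derivative h t) (at t within {a..b})"
      using has_vector_derivative_transform[OF _ y] t by fastforce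
    have "P t \<bullet> h t + - k t \<bullet> y t = P t \<bullet> h t - k t \<bullet> y t"
      by simp
    then show "((\<lambda>t. P t \<bullet> y t) has_vector_derivative P t \<bullet> h t - k t \<bullet> y t) (at t within {a..b})"
      using bounded_bilinear.has_vector_derivative[OF bounded_bilinear_inner dP dy] by metis
  qed
qed

lemma integral_indicator_le:
  fixes c d :: real
  assumes "c \<le> d"
  shows "integral {a..t} (indicat_real {c..<d}) \<le> d - c"
proof -
  have *: "{c..<d} \<in> lmeasurable"
    by (rule bounded_set_imp_lmeasurable) (auto intro: bounded_subset[OF bounded_closed_interval[of c d]])
  have "integral {a..t} (indicat_real {c..<d}) = measure lebesgue ({c..<d} \<inter> {a..t})"
    by (intro integral_indicator fmeasurable.Int * ) auto
  also have "\<dots> \<le> measure lebesgue {c..<d}"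
    by (rule measure_mono_fmeasurable) (use * in auto)
  also have "\<dots> = d - c" using assms by simp
  finally show ?thesis .
qed

lemma integral_indicator_halfopen:
  fixes f :: "real \<Rightarrow> 'a::euclidean_space"
  assumes "a \<le> c" "d \<le> b"
  shows "integral {a..b} (\<lambda>t. indicat_real {c..<d} t *\<^sub>R f t) = integral {c..d} f"
proof (cases "c \<le> d")
  case True
  have "integral {a..b} (\<lambda>t. indicat_real {c..<d} t *\<^sub>R f t) = integral {a..b} (\<lambda>t. indicat_real {c..d} t *\<^sub>R f t)"
    by (rule integral_spike[of "{d}"]) (auto simp: indicator_def)
  then show ?thesis
    using integral_indicator_interval[of c d a b f] assms True by simp
qed auto

subsection \<open>Needle variations of a reference trajectory\<close>

lemma adjoint_euclidean_representation:
  fixes F :: "'a::euclidean_space \<Rightarrow> 'a"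
  assumes "linear F"
  shows "adjoint F y = (\<Sum>\<beta>\<in>Basis. (F \<beta> \<bullet> y) *\<^sub>R \<beta>)"
  using euclidean_representation[of "adjoint F y"] adjoint_works[OF assms]
  by (simp add: inner_commute)

lemma norm_adjoint_le:
  fixes F :: "'a::euclidean_space \<Rightarrow> 'a"
  assumes "linear F" "\<And>x. norm (F x) \<le> L * norm x"
  shows "norm (adjoint F y) \<le> L * norm y"
proof (cases "adjoint F y = 0")
  case True
  have "0 \<le> L * norm y" using assms(2)[of y] norm_ge_zero order_trans by blast
  then show ?thesis using True by simp
next
  case False
  have "norm (adjoint F y) * norm (adjoint F y) = adjoint F y \<bullet> adjoint F y"
    by (simp add: dot_square_norm power2_eq_square)
  also have "\<dots> = F (adjoint F y) \<bullet> y"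
    by (rule adjoint_works[OF assms(1)])
  also have "\<dots> \<le> norm (F (adjoint F y)) * norm y"
    by (rule norm_cauchy_schwarz)
  also have "\<dots> \<le> (L * norm (adjoint F y)) * norm y"
    by (intro mult_right_mono assms(2)) simp
  finally have "norm (adjoint F y) * norm (adjoint F y) \<le> norm (adjoint F y) * (L * norm y)"
    by (simp add: mult_ac)
  then show ?thesis
    using False by simp
qed

text \<open>In the application g is the dynamics under the optimal control and D n is the change of the
  dynamics caused by switching to the n-th constant control value. The variation adds D n on short
  intervals without asking these to be disjoint, which keeps the vector field Lipschitz and makes it
  additive in the needles.\<close>

locale needle_variation =
  fixes a b :: real
    and g :: "real \<Rightarrow> 'a::euclidean_space \<Rightarrow> 'a"
    and D :: "nat \<Rightarrow> real \<Rightarrow> 'a \<Rightarrow> 'a"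
    and A :: "real \<Rightarrow> 'a \<Rightarrow> 'a"
    and Xs :: "real \<Rightarrow> 'a"
    and L :: real and LD :: "nat \<Rightarrow> real"
  assumes ab: "a < b"
    and L_nonneg: "L \<ge> 0" and LD_nonneg: "LD n \<ge> 0"
    and Xs_cont: "continuous_on {a..b} Xs"
    and Xs_eq: "t \<in> {a..b} \<Longrightarrow> Xs t = Xs a + integral {a..t} (\<lambda>s. g s (Xs s))"
    and g_meas: "continuous_on {a..b} x \<Longrightarrow> bmeas a b (\<lambda>t. g t (x t))"
    and D_meas: "continuous_on {a..b} x \<Longrightarrow> bmeas a b (\<lambda>t. D n t (x t))"
    and g_lip: "t \<in> {a..b} \<Longrightarrow> norm (g t x1 - g t x2) \<le> L * norm (x1 - x2)"
    and D_lip: "t \<in> {a..b} \<Longrightarrow> norm (D n t x1 - D n t x2) \<le> LD n * norm (x1 - x2)"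
    and A_linear: "t \<in> {a..b} \<Longrightarrow> linear (A t)"
    and A_bound: "t \<in> {a..b} \<Longrightarrow> norm (A t y) \<le> L * norm y"
    and A_meas: "bmeas a b (\<lambda>t. A t y)"
    and g_diff: "e > 0 \<Longrightarrow> \<exists>d>0. \<forall>t\<in>{a..b}. \<forall>y. norm y \<le> d \<longrightarrow>
                   norm (g t (Xs t + y) - g t (Xs t) - A t y) \<le> e * norm y"
begin

lemma adjoint_meas:
  assumes "bmeas a b x"
  shows "bmeas a b (\<lambda>t. adjoint (A t) (x t))"
proof -
  have "bmeas a b (\<lambda>t. \<Sum>\<beta>\<in>Basis. (A t \<beta> \<bullet> x t) *\<^sub>R \<beta>)"
    by (intro bmeas_sum bmeas_scaleR bmeas_inner A_meas assms bmeas_const finite_Basis)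
  then show ?thesis
    using bmeas_cong[of a b "\<lambda>t. adjoint (A t) (x t)" "\<lambda>t. \<Sum>\<beta>\<in>Basis. (A t \<beta> \<bullet> x t) *\<^sub>R \<beta>"]
      adjoint_euclidean_representation[OF A_linear] by blast
qed

lemma A_comp_meas:
  assumes "bmeas a b x"
  shows "bmeas a b (\<lambda>t. A t (x t))"
proof -
  have "bmeas a b (\<lambda>t. \<Sum>\<beta>\<in>Basis. (x t \<bullet> \<beta>) *\<^sub>R A t \<beta>)"
    by (intro bmeas_sum bmeas_scaleR bmeas_inner A_meas assms bmeas_const finite_Basis)
  moreover have "A t (x t) = (\<Sum>\<beta>\<in>Basis. (x t \<bullet> \<beta>) *\<^sub>R A t \<beta>)" if "t \<in> {a..b}" for t
    using Linear_Algebra.linear_componentwise[OF A_linear[OF that]]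
      linear_sum[OF A_linear[OF that]] linear_scale[OF A_linear[OF that]]
      euclidean_representation[of "x t"]
    by (metis (no_types, lifting) sum.cong)
  ultimately show ?thesis
    using bmeas_cong[of a b "\<lambda>t. A t (x t)" "\<lambda>t. \<Sum>\<beta>\<in>Basis. (x t \<bullet> \<beta>) *\<^sub>R A t \<beta>"] by blast
qed

lemma costate_exists:
  "\<exists>P. continuous_on {a..b} P \<and> (\<forall>t\<in>{a..b}. P t = q + integral {t..b} (\<lambda>s. adjoint (A s) (P s)))"
proof -
  have lip: "norm (adjoint (A t) x - adjoint (A t) y) \<le> L * norm (x - y)" if "t \<in> {a..b}" for t x y
    using norm_adjoint_le[OF A_linear[OF that] A_bound[OF that], of "x - y"]
      linear_diff[OF adjoint_linear[OF A_linear[OF that]]] by simp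
  show ?thesis
    by (rule picard_backward[where g = "\<lambda>s. adjoint (A s)" and a = a and b = b and L = L and ?x0.0 = q])
       (use lip L_nonneg in \<open>auto intro: adjoint_meas bmeas_continuous\<close>)
qed

definition costate :: "'a \<Rightarrow> real \<Rightarrow> 'a" where
  "costate q = (SOME P. continuous_on {a..b} P \<and>
     (\<forall>t\<in>{a..b}. P t = q + integral {t..b} (\<lambda>s. adjoint (A s) (P s))))"

lemma costate_cont: "continuous_on {a..b} (costate q)"
  and costate_eq: "t \<in> {a..b} \<Longrightarrow> costate q t = q + integral {t..b} (\<lambda>s. adjoint (A s) (costate q s))"
  using someI_ex[OF costate_exists[of q]] unfolding costate_def[symmetric] by blast+

text \<open>The linearised flow from time t to the end of the interval, represented through its adjoint.\<close>

definition transfer :: "real \<Rightarrow> 'a \<Rightarrow> 'a" where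
  "transfer t y = (\<Sum>\<beta>\<in>Basis. (costate \<beta> t \<bullet> y) *\<^sub>R \<beta>)"

lemma transfer_add: "transfer t (x + y) = transfer t x + transfer t y"
  by (simp add: transfer_def inner_add_right scaleR_add_left sum.distrib)

lemma transfer_scaleR: "transfer t (c *\<^sub>R x) = c *\<^sub>R transfer t x"
  by (simp add: transfer_def scaleR_sum_right)

lemma linear_transfer: "linear (transfer t)"
  by (rule linearI) (simp_all add: transfer_add transfer_scaleR)

lemma transfer_meas: "bmeas a b x \<Longrightarrow> bmeas a b (\<lambda>t. transfer t (x t))"
  unfolding transfer_def
  by (intro bmeas_sum bmeas_scaleR bmeas_inner bmeas_const finite_Basis bmeas_continuous[OF costate_cont])

lemma transfer_bound: "\<exists>B\<ge>0. \<forall>t\<in>{a..b}. \<forall>y. norm (transfer t y) \<le> B * norm y"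
proof -
  have "\<exists>C. \<forall>t\<in>{a..b}. norm (costate \<beta> t) \<le> C" for \<beta>
    using bmeas_continuous[OF costate_cont[of \<beta>]] by (auto simp: bmeas_def)
  then obtain C where C: "\<And>\<beta> t. t \<in> {a..b} \<Longrightarrow> norm (costate \<beta> t) \<le> C \<beta>"
    by metis
  have C0: "C \<beta> \<ge> 0" for \<beta>
    using order_trans[OF norm_ge_zero C[of a \<beta>]] ab by simp
  have "norm (transfer t y) \<le> (\<Sum>\<beta>\<in>Basis. C \<beta>) * norm y" if t: "t \<in> {a..b}" for t y
  proof -
    have "norm (transfer t y) \<le> (\<Sum>\<beta>\<in>(Basis::'a set). \<bar>costate \<beta> t \<bullet> y\<bar>)"
      unfolding transfer_def by (rule sum_norm_le) simp
    also have "\<dots> \<le> (\<Sum>\<beta>\<in>(Basis::'a set). C \<beta> * norm y)"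
      by (intro sum_mono order_trans[OF Cauchy_Schwarz_ineq2] mult_right_mono C t norm_ge_zero)
    finally show ?thesis by (simp add: sum_distrib_right)
  qed
  then show ?thesis
    using C0 by (intro exI[of _ "\<Sum>\<beta>\<in>Basis. C \<beta>"]) (simp add: sum_nonneg)
qed

definition slot :: "(real \<times> nat \<Rightarrow> nat) \<Rightarrow> real \<Rightarrow> (real \<times> nat \<Rightarrow> real) \<Rightarrow> real \<times> nat \<Rightarrow> real set" where
  "slot idx r eps p = {fst p + real (idx p) * r ..< fst p + real (idx p) * r + eps p}"

definition pert :: "(real \<times> nat) set \<Rightarrow> (real \<times> nat \<Rightarrow> nat) \<Rightarrow> real \<Rightarrow> (real \<times> nat \<Rightarrow> real) \<Rightarrow> real \<Rightarrow> 'a \<Rightarrow> 'a" where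
  "pert T idx r eps t x = g t x + (\<Sum>p\<in>T. indicat_real (slot idx r eps p) t *\<^sub>R D (snd p) t x)"

definition trajectory :: "(real \<times> nat) set \<Rightarrow> (real \<times> nat \<Rightarrow> nat) \<Rightarrow> real \<Rightarrow> (real \<times> nat \<Rightarrow> real) \<Rightarrow> (real \<Rightarrow> 'a) \<Rightarrow> bool" where
  "trajectory T idx r eps X \<longleftrightarrow> continuous_on {a..b} X \<and>
     (\<forall>t\<in>{a..b}. X t = X a + integral {a..t} (\<lambda>s. pert T idx r eps s (X s)))"

lemma trajectory_cont: "trajectory T idx r eps X \<Longrightarrow> continuous_on {a..b} X"
  by (simp add: trajectory_def)

lemma trajectory_eq:
  "trajectory T idx r eps X \<Longrightarrow> t \<in> {a..b} \<Longrightarrow> X t = X a + integral {a..t} (\<lambda>s. pert T idx r eps s (X s))"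
  unfolding trajectory_def by (drule conjunct2, erule bspec)

lemma slot_meas: "bmeas a b (indicat_real (slot idx r eps p))"
  by (rule bmeas_indicator) (simp add: slot_def)

lemma pert_meas:
  assumes "finite T" "continuous_on {a..b} x"
  shows "bmeas a b (\<lambda>t. pert T idx r eps t (x t))"
  unfolding pert_def
  by (intro bmeas_add bmeas_sum bmeas_scaleR slot_meas g_meas D_meas assms)

lemma indicator_scaleR_le: "norm (indicat_real S t *\<^sub>R (v::'a)) \<le> norm v"
  by (auto simp: indicator_def)

lemma pert_lip:
  assumes t: "t \<in> {a..b}"
  shows "norm (pert T idx r eps t x1 - pert T idx r eps t x2) \<le> (L + (\<Sum>p\<in>T. LD (snd p))) * norm (x1 - x2)"
proof -
  have "pert T idx r eps t x1 - pert T idx r eps t x2 = (g t x1 - g t x2)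
     + (\<Sum>p\<in>T. indicat_real (slot idx r eps p) t *\<^sub>R (D (snd p) t x1 - D (snd p) t x2))"
    by (simp add: pert_def sum_subtractf scaleR_diff_right)
  also have "norm \<dots> \<le> L * norm (x1 - x2) + (\<Sum>p\<in>T. LD (snd p) * norm (x1 - x2))"
    by (intro norm_triangle_mono g_lip t sum_norm_le order_trans[OF indicator_scaleR_le] D_lip)
  finally show ?thesis by (simp add: distrib_right sum_distrib_right)
qed

lemma trajectory_exists:
  assumes "finite T"
  shows "\<exists>X. trajectory T idx r eps X \<and> X a = x0"
proof -
  have "L + (\<Sum>p\<in>T. LD (snd p)) \<ge> 0"
    using L_nonneg LD_nonneg by (simp add: add_nonneg_nonneg sum_nonneg)
  then show ?thesis
  proof (rule picard[where g = "pert T idx r eps" and a = a and b = b and ?x0.0 = x0,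
        OF _ pert_meas[OF assms] pert_lip])
    fix X assume X: "continuous_on {a..b} X"
      "\<And>t. t \<in> {a..b} \<Longrightarrow> X t = x0 + integral {a..t} (\<lambda>s. pert T idx r eps s (X s))"
    have Xa: "X a = x0" using X(2)[of a] ab by simp
    have "trajectory T idx r eps X"
      unfolding trajectory_def Xa using X by blast
    then show ?thesis using Xa by blast
  qed
qed

lemma Xs_trajectory: "trajectory T idx r (\<lambda>_. 0) Xs"
proof -
  have "pert T idx r (\<lambda>_. 0) = g"
    by (intro ext) (simp add: pert_def slot_def)
  then show ?thesis
    unfolding trajectory_def by (intro conjI ballI) (rule Xs_cont, simp only: Xs_eq[symmetric])
qed

lemma trajectory_diff:
  assumes T: "finite T" and X: "trajectory T idx r eps X" and Y: "trajectory T idx r eps' Y"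
    and eps: "\<And>p. p \<in> T \<Longrightarrow> eps p \<ge> 0" "\<And>p. p \<in> T \<Longrightarrow> eps' p \<ge> 0"
    and M: "M \<ge> 0" "\<And>p s. p \<in> T \<Longrightarrow> s \<in> {a..b} \<Longrightarrow> norm (D (snd p) s (Y s)) \<le> M"
    and t: "t \<in> {a..b}"
  shows "norm (X t - Y t) \<le> 2 * (norm (X a - Y a) + M * (\<Sum>p\<in>T. \<bar>eps p - eps' p\<bar>)) *
           exp ((2 * (L + (\<Sum>p\<in>T. LD (snd p))) + 1) * (b - a))"
proof -
  define LT where "LT = L + (\<Sum>p\<in>T. LD (snd p))"
  define J where "J = (\<lambda>p. {fst p + real (idx p) * r + min (eps p) (eps' p) ..< fst p + real (idx p) * r + max (eps p) (eps' p)})"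
  have LT: "LT \<ge> 0"
    using L_nonneg LD_nonneg by (simp add: LT_def add_nonneg_nonneg sum_nonneg)
  note Xc = trajectory_cont[OF X] and Yc = trajectory_cont[OF Y]
  have J: "\<bar>indicat_real (slot idx r eps p) s - indicat_real (slot idx r eps' p) s\<bar> \<le> indicat_real (J p) s"
    if "p \<in> T" for p s
    using eps[OF that] by (auto simp: slot_def J_def indicator_def)
  have pt: "norm (pert T idx r eps s (X s) - pert T idx r eps' s (Y s))
      \<le> LT * norm (X s - Y s) + M * (\<Sum>p\<in>T. indicat_real (J p) s)" if s: "s \<in> {a..b}" for s
  proof -
    have "pert T idx r eps s (X s) - pert T idx r eps' s (Y s) = (pert T idx r eps s (X s) - pert T idx r eps s (Y s))
       + (\<Sum>p\<in>T. (indicat_real (slot idx r eps p) s - indicat_real (slot idx r eps' p) s) *\<^sub>R D (snd p) s (Y s))"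
      by (simp add: pert_def sum_subtractf scaleR_diff_left)
    also have "norm \<dots> \<le> LT * norm (X s - Y s) + (\<Sum>p\<in>T. indicat_real (J p) s * M)"
      unfolding LT_def
    proof (intro norm_triangle_mono pert_lip s sum_norm_le)
      fix p assume p: "p \<in> T"
      show "norm ((indicat_real (slot idx r eps p) s - indicat_real (slot idx r eps' p) s) *\<^sub>R D (snd p) s (Y s)) \<le> indicat_real (J p) s * M"
        unfolding norm_scaleR by (intro mult_mono) (use J[OF p] M p s in auto)
    qed
    finally show ?thesis by (simp add: sum_distrib_left mult.commute)
  qed
  have Jm: "bmeas a b (\<lambda>s. \<Sum>p\<in>T. indicat_real (J p) s)"
    by (intro bmeas_sum T bmeas_indicator) (simp add: J_def)
  have "norm (X u - Y u) \<le> (norm (X a - Y a) + M * (\<Sum>p\<in>T. \<bar>eps p - eps' p\<bar>)) + integral {a..u} (\<lambda>s. LT * norm (X s - Y s))"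
    if u: "u \<in> {a..b}" for u
  proof -
    have sub: "{a..u} \<subseteq> {a..b}" using u by auto
    have ci: "(\<lambda>s. LT * norm (X s - Y s)) integrable_on {a..u}"
      by (intro integrable_continuous_real continuous_intros continuous_on_subset[OF Xc sub] continuous_on_subset[OF Yc sub])
    have ji: "(\<lambda>s. indicat_real (J p) s) integrable_on {a..u}" for p
      by (rule bmeas_integrable) (auto intro: bmeas_indicator simp: J_def)
    have mi: "(\<lambda>s. M * (\<Sum>p\<in>T. indicat_real (J p) s)) integrable_on {a..u}"
      by (intro integrable_on_mult_right integrable_sum T ji)
    have Ju: "integral {a..u} (indicat_real (J p)) \<le> \<bar>eps p - eps' p\<bar>" for p
      using integral_indicator_le[of "fst p + real (idx p) * r + min (eps p) (eps' p)" "fst p + real (idx p) * r + max (eps p) (eps' p)" a u]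
      by (cases "eps p \<le> eps' p") (simp_all add: J_def)
    have d: "integral {a..u} (\<lambda>s. pert T idx r eps s (X s) - pert T idx r eps' s (Y s))
        = integral {a..u} (\<lambda>s. pert T idx r eps s (X s)) - integral {a..u} (\<lambda>s. pert T idx r eps' s (Y s))"
      by (intro integral_diff bmeas_integrable_sub[OF _ sub] pert_meas T Xc Yc)
    have "norm (X u - Y u) = norm ((X a - Y a) + integral {a..u} (\<lambda>s. pert T idx r eps s (X s) - pert T idx r eps' s (Y s)))"
      unfolding d trajectory_eq[OF X u] trajectory_eq[OF Y u] add_diff_add ..
    then have 1: "norm (X u - Y u) \<le> norm (X a - Y a) + norm (integral {a..u} (\<lambda>s. pert T idx r eps s (X s) - pert T idx r eps' s (Y s)))"
      by (metis norm_triangle_ineq)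
    have 2: "norm (integral {a..u} (\<lambda>s. pert T idx r eps s (X s) - pert T idx r eps' s (Y s)))
        \<le> integral {a..u} (\<lambda>s. LT * norm (X s - Y s) + M * (\<Sum>p\<in>T. indicat_real (J p) s))"
    proof (rule norm_integral_le_integral)
      show "bmeas a u (\<lambda>s. pert T idx r eps s (X s) - pert T idx r eps' s (Y s))"
        by (rule bmeas_subinterval[OF _ sub]) (intro bmeas_diff pert_meas T Xc Yc)
      show "(\<lambda>s. LT * norm (X s - Y s) + M * (\<Sum>p\<in>T. indicat_real (J p) s)) integrable_on {a..u}"
        by (intro integrable_add ci mi)
      show "norm (pert T idx r eps s (X s) - pert T idx r eps' s (Y s))
          \<le> LT * norm (X s - Y s) + M * (\<Sum>p\<in>T. indicat_real (J p) s)" if "s \<in> {a..u}" for s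
        by (rule pt[OF subsetD[OF sub that]])
    qed
    have 3: "integral {a..u} (\<lambda>s. LT * norm (X s - Y s) + M * (\<Sum>p\<in>T. indicat_real (J p) s))
        = integral {a..u} (\<lambda>s. LT * norm (X s - Y s)) + M * (\<Sum>p\<in>T. integral {a..u} (indicat_real (J p)))"
      by (simp add: integral_add[OF ci mi] integral_sum[OF T ji])
    have "M * (\<Sum>p\<in>T. integral {a..u} (indicat_real (J p))) \<le> M * (\<Sum>p\<in>T. \<bar>eps p - eps' p\<bar>)"
      by (intro mult_left_mono sum_mono Ju M)
    with 1 2 3 show ?thesis by linarith
  qed
  from gronwall[OF LT _ this t] show ?thesis
    unfolding LT_def[symmetric] by (simp add: continuous_on_diff Xc Yc)
qed

lemma trajectory_near:
  assumes "finite T"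
  obtains C where "C \<ge> 0" "\<And>idx r eps X t. trajectory T idx r eps X \<Longrightarrow> (\<And>p. p \<in> T \<Longrightarrow> eps p \<ge> 0) \<Longrightarrow> t \<in> {a..b} \<Longrightarrow>
     norm (X t - Xs t) \<le> C * (norm (X a - Xs a) + (\<Sum>p\<in>T. eps p))"
proof -
  have "\<exists>C\<ge>0. \<forall>s\<in>{a..b}. norm (D n s (Xs s)) \<le> C" for n
    using bmeas_bound[OF D_meas[OF Xs_cont, of n]] by metis
  then obtain m where m: "\<And>n. m n \<ge> 0" "\<And>n s. s \<in> {a..b} \<Longrightarrow> norm (D n s (Xs s)) \<le> m n"
    by metis
  define M where "M = (\<Sum>p\<in>T. m (snd p))"
  have M: "M \<ge> 0" unfolding M_def by (intro sum_nonneg m)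
  have MD: "norm (D (snd p) s (Xs s)) \<le> M" if "p \<in> T" "s \<in> {a..b}" for p s
    using m(2)[OF that(2), of "snd p"] member_le_sum[OF that(1), of "\<lambda>p. m (snd p)"] m(1) assms
    by (simp add: M_def)
  define E where "E = exp ((2 * (L + (\<Sum>p\<in>T. LD (snd p))) + 1) * (b - a))"
  show ?thesis
  proof (rule that[of "2 * (1 + M) * E"])
    show "0 \<le> 2 * (1 + M) * E" using M by (simp add: E_def)
    fix idx r eps X t
    assume X: "trajectory T idx r eps X" and eps: "\<And>p. p \<in> T \<Longrightarrow> eps p \<ge> 0" and t: "t \<in> {a..b}"
    have S: "(\<Sum>p\<in>T. \<bar>eps p - 0\<bar>) = (\<Sum>p\<in>T. eps p)" "(\<Sum>p\<in>T. eps p) \<ge> 0"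
      using eps by (auto intro!: sum.cong sum_nonneg)
    have "norm (X t - Xs t) \<le> 2 * (norm (X a - Xs a) + M * (\<Sum>p\<in>T. eps p)) * E"
      using trajectory_diff[OF assms X Xs_trajectory eps _ M MD t] S by (simp add: E_def)
    also have "\<dots> \<le> 2 * ((1 + M) * (norm (X a - Xs a) + (\<Sum>p\<in>T. eps p))) * E"
      using M S(2) by (intro mult_right_mono mult_left_mono) (auto simp: E_def algebra_simps)
    finally show "norm (X t - Xs t) \<le> 2 * (1 + M) * E * (norm (X a - Xs a) + (\<Sum>p\<in>T. eps p))"
      by (simp only: mult_ac)
  qed
qed

lemma trajectory_lipschitz:
  assumes "finite T"
  obtains C where "C \<ge> 0" "\<And>idx r eps eps' X Y t. trajectory T idx r eps X \<Longrightarrow> trajectory T idx r eps' Y \<Longrightarrow>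
     (\<And>p. p \<in> T \<Longrightarrow> eps p \<ge> 0) \<Longrightarrow> (\<And>p. p \<in> T \<Longrightarrow> 0 \<le> eps' p) \<Longrightarrow> (\<And>p. p \<in> T \<Longrightarrow> eps' p \<le> 1) \<Longrightarrow>
     norm (Y a - Xs a) \<le> 1 \<Longrightarrow> t \<in> {a..b} \<Longrightarrow>
     norm (X t - Y t) \<le> C * (norm (X a - Y a) + (\<Sum>p\<in>T. \<bar>eps p - eps' p\<bar>))"
proof -
  obtain C0 where C0: "C0 \<ge> 0" "\<And>idx r eps X t. trajectory T idx r eps X \<Longrightarrow> (\<And>p. p \<in> T \<Longrightarrow> eps p \<ge> 0) \<Longrightarrow> t \<in> {a..b} \<Longrightarrow>
     norm (X t - Xs t) \<le> C0 * (norm (X a - Xs a) + (\<Sum>p\<in>T. eps p))"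
    using trajectory_near[OF assms] by blast
  have "\<exists>C\<ge>0. \<forall>s\<in>{a..b}. norm (D n s (Xs s)) \<le> C" for n
    using bmeas_bound[OF D_meas[OF Xs_cont, of n]] by metis
  then obtain m where m: "\<And>n. m n \<ge> 0" "\<And>n s. s \<in> {a..b} \<Longrightarrow> norm (D n s (Xs s)) \<le> m n"
    by metis
  define c where "c = C0 * (1 + real (card T))"
  have c: "c \<ge> 0" using C0(1) by (simp add: c_def)
  define M where "M = (\<Sum>p\<in>T. m (snd p) + LD (snd p) * c)"
  have M: "M \<ge> 0" unfolding M_def by (intro sum_nonneg add_nonneg_nonneg m mult_nonneg_nonneg LD_nonneg c)
  define E where "E = exp ((2 * (L + (\<Sum>p\<in>T. LD (snd p))) + 1) * (b - a))"
  show ?thesis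
  proof (rule that[of "2 * (1 + M) * E"])
    show "0 \<le> 2 * (1 + M) * E" using M by (simp add: E_def)
    fix idx r eps eps' X Y t
    assume X: "trajectory T idx r eps X" and Y: "trajectory T idx r eps' Y"
      and eps: "\<And>p. p \<in> T \<Longrightarrow> eps p \<ge> 0" "\<And>p. p \<in> T \<Longrightarrow> eps' p \<ge> 0" "\<And>p. p \<in> T \<Longrightarrow> eps' p \<le> 1"
      and Ya: "norm (Y a - Xs a) \<le> 1" and t: "t \<in> {a..b}"
    have S: "(\<Sum>p\<in>T. \<bar>eps p - eps' p\<bar>) \<ge> 0"
      by (auto intro!: sum_nonneg)
    have MD: "norm (D (snd p) s (Y s)) \<le> M" if p: "p \<in> T" and s: "s \<in> {a..b}" for p s
    proof -
      have "(\<Sum>p\<in>T. eps' p) \<le> real (card T)"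
        using sum_bounded_above[of T eps' 1] eps(3) by simp
      then have "norm (Y s - Xs s) \<le> c"
        using C0(2)[OF Y eps(2) s] Ya C0(1) unfolding c_def
        by (meson add_mono mult_left_mono order_trans)
      then have "norm (D (snd p) s (Y s) - D (snd p) s (Xs s)) \<le> LD (snd p) * c"
        using D_lip[OF s, of "snd p" "Y s" "Xs s"] LD_nonneg by (meson mult_left_mono order_trans)
      then have "norm (D (snd p) s (Y s)) \<le> m (snd p) + LD (snd p) * c"
        using norm_triangle_sub[of "D (snd p) s (Y s)" "D (snd p) s (Xs s)"] m(2)[OF s, of "snd p"] by linarith
      also have "\<dots> \<le> M"
        unfolding M_def by (rule member_le_sum[OF p _ assms]) (intro add_nonneg_nonneg m mult_nonneg_nonneg LD_nonneg c)
      finally show ?thesis .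
    qed
    have "norm (X t - Y t) \<le> 2 * (norm (X a - Y a) + M * (\<Sum>p\<in>T. \<bar>eps p - eps' p\<bar>)) * E"
      using trajectory_diff[OF assms X Y eps(1,2) M MD t] by (simp add: E_def)
    also have "\<dots> \<le> 2 * ((1 + M) * (norm (X a - Y a) + (\<Sum>p\<in>T. \<bar>eps p - eps' p\<bar>))) * E"
      using M S by (intro mult_right_mono mult_left_mono) (auto simp: E_def algebra_simps)
    finally show "norm (X t - Y t) \<le> 2 * (1 + M) * E * (norm (X a - Y a) + (\<Sum>p\<in>T. \<bar>eps p - eps' p\<bar>))"
      by (simp only: mult_ac)
  qed
qed

end

subsection \<open>First-order expansion of the endpoint\<close>

context needle_variation
begin

definition needle_effect :: "nat \<Rightarrow> real \<Rightarrow> 'a" where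
  "needle_effect n t = transfer t (D n t (Xs t))"

definition regular_time :: "real \<Rightarrow> bool" where
  "regular_time t \<longleftrightarrow> t \<in> {a..<b} \<and> (\<forall>n. \<forall>e>0. \<exists>d>0. \<forall>h. 0 \<le> h \<and> h < d \<and> t + h \<le> b \<longrightarrow>
     norm (integral {t..t+h} (needle_effect n) - h *\<^sub>R needle_effect n t) \<le> e * h)"

lemma needle_effect_meas: "bmeas a b (needle_effect n)"
  unfolding needle_effect_def[abs_def] by (intro transfer_meas D_meas Xs_cont)

lemma regular_time_ae: "\<exists>N. negligible N \<and> (\<forall>t\<in>{a..<b} - N. regular_time t)"
proof -
  have "\<exists>N. negligible N \<and> (\<forall>t\<in>{a..<b} - N. \<forall>e>0. \<exists>d>0. \<forall>h. 0 \<le> h \<and> h < d \<and> t + h \<le> b \<longrightarrow>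
     norm (integral {t..t+h} (needle_effect n) - h *\<^sub>R needle_effect n t) \<le> e * h)" for n
    by (rule lebesgue_differentiation_right[OF needle_effect_meas[of n]]) blast
  then obtain N where N: "\<And>n. negligible (N n)" "\<And>n. \<forall>t\<in>{a..<b} - N n. \<forall>e>0. \<exists>d>0. \<forall>h. 0 \<le> h \<and> h < d \<and> t + h \<le> b \<longrightarrow>
     norm (integral {t..t+h} (needle_effect n) - h *\<^sub>R needle_effect n t) \<le> e * h"
    by metis
  have "negligible (\<Union>(range N))"
    by (rule negligible_countable_Union) (use N in auto)
  then show ?thesis
    using N(2) unfolding regular_time_def by (intro exI[of _ "\<Union>(range N)"]) blast
qed

lemma endpoint_representation:
  assumes T: "finite T" and X: "trajectory T idx r eps X"
  shows "((\<lambda>t. transfer t (pert T idx r eps t (X t) - g t (Xs t) - A t (X t - Xs t))) has_integral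
      (X b - Xs b - transfer a (X a - Xs a))) {a..b}"
proof -
  note Xc = trajectory_cont[OF X]
  define h where "h = (\<lambda>s. pert T idx r eps s (X s) - g s (Xs s))"
  define y where "y = (\<lambda>t. X t - Xs t)"
  have hm: "bmeas a b h"
    unfolding h_def by (intro bmeas_diff pert_meas g_meas T Xc Xs_cont)
  have y: "y t = (X a - Xs a) + integral {a..t} h" if t: "t \<in> {a..b}" for t
  proof -
    have sub: "{a..t} \<subseteq> {a..b}" using t by auto
    have "integral {a..t} h = integral {a..t} (\<lambda>s. pert T idx r eps s (X s)) - integral {a..t} (\<lambda>s. g s (Xs s))"
      unfolding h_def by (intro integral_diff bmeas_integrable_sub[OF _ sub] pert_meas g_meas T Xc Xs_cont)
    moreover have "X t - Xs t = (X a + integral {a..t} (\<lambda>s. pert T idx r eps s (X s))) - (Xs a + integral {a..t} (\<lambda>s. g s (Xs s)))"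
      by (rule arg_cong2[where f = minus, OF trajectory_eq[OF X t] Xs_eq[OF t]])
    ultimately show ?thesis
      unfolding y_def by (simp only: add_diff_add)
  qed
  have comp: "((\<lambda>t. costate \<beta> t \<bullet> (h t - A t (y t))) has_integral (\<beta> \<bullet> y b - costate \<beta> a \<bullet> y a)) {a..b}" for \<beta>
  proof -
    have "((\<lambda>t. costate \<beta> t \<bullet> h t - adjoint (A t) (costate \<beta> t) \<bullet> y t) has_integral
        (costate \<beta> b \<bullet> y b - costate \<beta> a \<bullet> y a)) {a..b}"
      by (rule integral_parts_lipschitz[OF _ adjoint_meas[OF bmeas_continuous[OF costate_cont]] hm costate_eq y])
         (use ab in auto)
    moreover have "costate \<beta> b = \<beta>"
      using costate_eq[of b \<beta>] ab by simp
    moreover have "costate \<beta> t \<bullet> h t - adjoint (A t) (costate \<beta> t) \<bullet> y t = costate \<beta> t \<bullet> (h t - A t (y t))"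
      if "t \<in> {a..b}" for t
      using adjoint_works[OF A_linear[OF that], of "y t" "costate \<beta> t"]
      by (simp add: inner_diff_right inner_commute)
    ultimately show ?thesis
      using has_integral_eq[of "{a..b}" "\<lambda>t. costate \<beta> t \<bullet> h t - adjoint (A t) (costate \<beta> t) \<bullet> y t"
          "\<lambda>t. costate \<beta> t \<bullet> (h t - A t (y t))"] by simp
  qed
  have "((\<lambda>t. \<Sum>\<beta>\<in>Basis. (costate \<beta> t \<bullet> (h t - A t (y t))) *\<^sub>R \<beta>) has_integral
      (\<Sum>\<beta>\<in>Basis. (\<beta> \<bullet> y b - costate \<beta> a \<bullet> y a) *\<^sub>R \<beta>)) {a..b}"
    by (intro has_integral_sum has_integral_scaleR_left comp finite_Basis)
  moreover have "(\<Sum>\<beta>\<in>Basis. (\<beta> \<bullet> y b - costate \<beta> a \<bullet> y a) *\<^sub>R \<beta>) = y b - transfer a (y a)"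
    using euclidean_representation[of "y b"]
    by (simp add: transfer_def scaleR_diff_left sum_subtractf inner_commute)
  ultimately show ?thesis
    by (simp add: transfer_def[symmetric] h_def y_def)
qed

lemma needle_integral:
  assumes "regular_time \<tau>" "e > 0"
  shows "\<exists>d>0. \<forall>r>0. \<forall>j eps. real (k + 1) * r < d \<and> j \<le> k \<and> 0 \<le> eps \<and> eps \<le> r \<and> \<tau> + real (k + 1) * r \<le> b \<longrightarrow>
     norm (integral {a..b} (\<lambda>t. indicat_real {\<tau> + real j * r ..< \<tau> + real j * r + eps} t *\<^sub>R needle_effect n t)
       - eps *\<^sub>R needle_effect n \<tau>) \<le> e * (2 * real k + 1) * r"
proof -
  obtain d where d0: "d > 0" and d: "\<And>h. 0 \<le> h \<Longrightarrow> h < d \<Longrightarrow> \<tau> + h \<le> b \<Longrightarrow>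
      norm (integral {\<tau>..\<tau>+h} (needle_effect n) - h *\<^sub>R needle_effect n \<tau>) \<le> e * h"
    using assms unfolding regular_time_def by metis
  have \<tau>: "\<tau> \<in> {a..<b}" using assms unfolding regular_time_def by blast
  show ?thesis
  proof (intro exI[of _ d] conjI d0 allI impI)
    fix r :: real and j :: nat and eps :: real
    assume "0 < r" and *: "real (k + 1) * r < d \<and> j \<le> k \<and> 0 \<le> eps \<and> eps \<le> r \<and> \<tau> + real (k + 1) * r \<le> b"
    define w where "w = needle_effect n"
    define c where "c = real j * r"
    have "c \<le> real k * r" unfolding c_def using * \<open>0 < r\<close> by (intro mult_right_mono) auto
    then have c: "c \<le> real k * r" "c + eps \<le> real (k + 1) * r"
      using * by (auto simp: distrib_right)
    have c0: "0 \<le> c"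
      using \<open>0 < r\<close> by (simp add: c_def)
    note c = c0 c
    have wm: "bmeas a b w" unfolding w_def by (rule needle_effect_meas)
    have 1: "norm (integral {\<tau>..\<tau>+c} w - c *\<^sub>R w \<tau>) \<le> e * c"
      unfolding w_def by (rule d) (use * c in auto)
    have 2: "norm (integral {\<tau>..\<tau>+(c+eps)} w - (c+eps) *\<^sub>R w \<tau>) \<le> e * (c+eps)"
      unfolding w_def by (rule d) (use * c in auto)
    have "integral {\<tau>..\<tau>+(c+eps)} w - integral {\<tau>..\<tau>+c} w = integral {\<tau>+c..\<tau>+(c+eps)} w"
      by (rule integral_diff_interval[where b=b]) (use * c \<tau> in \<open>auto intro!: bmeas_subinterval[OF wm]\<close>)
    then have "integral {\<tau>+c..\<tau>+c+eps} w - eps *\<^sub>R w \<tau>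
        = (integral {\<tau>..\<tau>+(c+eps)} w - (c+eps) *\<^sub>R w \<tau>) - (integral {\<tau>..\<tau>+c} w - c *\<^sub>R w \<tau>)"
      by (simp add: algebra_simps)
    then have "norm (integral {\<tau>+c..\<tau>+c+eps} w - eps *\<^sub>R w \<tau>) \<le> e * (c+eps) + e * c"
      using norm_triangle_le_diff[OF add_mono[OF 2 1]] by metis
    also have "\<dots> = e * (2 * c + eps)" by (simp add: algebra_simps)
    also have "\<dots> \<le> e * ((2 * real k + 1) * r)"
      using c * \<open>e > 0\<close> by (intro mult_left_mono) (auto simp: algebra_simps)
    finally have "norm (integral {\<tau>+c..\<tau>+c+eps} w - eps *\<^sub>R w \<tau>) \<le> e * (2 * real k + 1) * r"
      by (simp add: mult.assoc)
    moreover have "integral {a..b} (\<lambda>t. indicat_real {\<tau> + c ..< \<tau> + c + eps} t *\<^sub>R w t) = integral {\<tau>+c..\<tau>+c+eps} w"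
      by (rule integral_indicator_halfopen) (use * c \<tau> in auto)
    ultimately show "norm (integral {a..b} (\<lambda>t. indicat_real {\<tau> + real j * r ..< \<tau> + real j * r + eps} t *\<^sub>R needle_effect n t)
       - eps *\<^sub>R needle_effect n \<tau>) \<le> e * (2 * real k + 1) * r"
      by (simp add: w_def c_def)
  qed
qed

definition first_order :: "(real \<times> nat) set \<Rightarrow> (real \<times> nat \<Rightarrow> real) \<Rightarrow> 'a \<Rightarrow> 'a" where
  "first_order T eps \<xi> = transfer a \<xi> + (\<Sum>p\<in>T. eps p *\<^sub>R needle_effect (snd p) (fst p))"

lemma endpoint_expansion:
  assumes T: "finite T" and reg: "\<And>p. p \<in> T \<Longrightarrow> regular_time (fst p)"
    and idx: "\<And>p. p \<in> T \<Longrightarrow> idx p \<le> k" and \<kappa>: "\<kappa> > 0"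
  shows "\<exists>\<rho>>0. \<forall>r eps X. 0 < r \<and> r < \<rho> \<and> (\<forall>p\<in>T. 0 \<le> eps p \<and> eps p \<le> r) \<and> trajectory T idx r eps X \<and> norm (X a - Xs a) \<le> r \<longrightarrow>
     norm (X b - Xs b - first_order T eps (X a - Xs a)) \<le> \<kappa> * r"
proof -
  obtain B where B: "B \<ge> 0" "\<And>t y. t \<in> {a..b} \<Longrightarrow> norm (transfer t y) \<le> B * norm y"
    using transfer_bound by blast
  obtain C0 where C0: "C0 \<ge> 0" "\<And>idx r eps X t. trajectory T idx r eps X \<Longrightarrow> (\<And>p. p \<in> T \<Longrightarrow> eps p \<ge> 0) \<Longrightarrow> t \<in> {a..b} \<Longrightarrow>
     norm (X t - Xs t) \<le> C0 * (norm (X a - Xs a) + (\<Sum>p\<in>T. eps p))"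
    by (rule trajectory_near[OF T]) blast
  define C where "C = C0 * (1 + real (card T))"
  have C: "C \<ge> 0" using C0 by (simp add: C_def)
  define S where "S = (\<Sum>p\<in>T. LD (snd p))"
  have S: "S \<ge> 0" unfolding S_def by (intro sum_nonneg LD_nonneg)
  define e1 where "e1 = \<kappa> / (3 * (B * C * (b - a) + 1))"
  define e2 where "e2 = \<kappa> / (3 * (real (card T) * (2 * real k + 1) + 1))"
  define r1 where "r1 = \<kappa> / (3 * (B * C * S + 1))"
  have pos: "B * C * (b - a) + 1 > 0" "real (card T) * (2 * real k + 1) + 1 > 0" "B * C * S + 1 > 0"
    using B C S ab by (auto intro!: add_nonneg_pos mult_nonneg_nonneg)
  have e: "e1 > 0" "e2 > 0" "r1 > 0"
    unfolding e1_def e2_def r1_def using pos \<kappa> by (auto intro!: divide_pos_pos)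
  have third: "x * (\<kappa> / (3 * (x + 1))) \<le> \<kappa> / 3" if "x \<ge> 0" for x
    using that \<kappa> by (simp add: field_simps)
  have k1: "B * C * (b - a) * e1 \<le> \<kappa> / 3"
    unfolding e1_def by (rule third) (use B C ab in auto)
  have k2: "real (card T) * (2 * real k + 1) * e2 \<le> \<kappa> / 3"
    unfolding e2_def by (rule third) auto
  have k3: "B * C * S * r1 \<le> \<kappa> / 3"
    unfolding r1_def by (rule third) (use B C S in auto)
  obtain d1 where d1: "d1 > 0" "\<And>t y. t \<in> {a..b} \<Longrightarrow> norm y \<le> d1 \<Longrightarrow>
       norm (g t (Xs t + y) - g t (Xs t) - A t y) \<le> e1 * norm y"
    using g_diff[OF e(1)] by blast
  have "\<forall>p\<in>T. \<exists>d>0. \<forall>r>0. \<forall>j eps. real (k + 1) * r < d \<and> j \<le> k \<and> 0 \<le> eps \<and> eps \<le> r \<and> fst p + real (k + 1) * r \<le> b \<longrightarrow>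
     norm (integral {a..b} (\<lambda>t. indicat_real {fst p + real j * r ..< fst p + real j * r + eps} t *\<^sub>R needle_effect (snd p) t)
       - eps *\<^sub>R needle_effect (snd p) (fst p)) \<le> e2 * (2 * real k + 1) * r"
    using needle_integral[OF reg e(2)] by blast
  from bchoice[OF this] obtain dp where dp': "\<forall>p\<in>T. dp p > 0 \<and> (\<forall>r>0. \<forall>j eps. real (k + 1) * r < dp p \<and> j \<le> k \<and> 0 \<le> eps \<and> eps \<le> r \<and> fst p + real (k + 1) * r \<le> b \<longrightarrow>
     norm (integral {a..b} (\<lambda>t. indicat_real {fst p + real j * r ..< fst p + real j * r + eps} t *\<^sub>R needle_effect (snd p) t)
       - eps *\<^sub>R needle_effect (snd p) (fst p)) \<le> e2 * (2 * real k + 1) * r)"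
    by (elim exE)
  have dp: "\<And>p. p \<in> T \<Longrightarrow> dp p > 0" "\<And>p r j eps. p \<in> T \<Longrightarrow> r > 0 \<Longrightarrow> real (k + 1) * r < dp p \<Longrightarrow> j \<le> k \<Longrightarrow>
       0 \<le> eps \<Longrightarrow> eps \<le> r \<Longrightarrow> fst p + real (k + 1) * r \<le> b \<Longrightarrow>
     norm (integral {a..b} (\<lambda>t. indicat_real {fst p + real j * r ..< fst p + real j * r + eps} t *\<^sub>R needle_effect (snd p) t)
       - eps *\<^sub>R needle_effect (snd p) (fst p)) \<le> e2 * (2 * real k + 1) * r"
    using dp' by blast+
  define R where "R = insert r1 (insert (d1 / (C + 1)) ((\<lambda>p. min (dp p) (b - fst p) / real (k + 1)) ` T))"
  have R: "finite R" "R \<noteq> {}" "\<And>x. x \<in> R \<Longrightarrow> x > 0"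
    using T e d1(1) dp(1) C reg unfolding R_def regular_time_def by auto
  show ?thesis
  proof (intro exI[of _ "Min R"] conjI allI impI)
    show "Min R > 0" using R by (simp add: Min_gr_iff)
    fix r eps X
    assume *: "0 < r \<and> r < Min R \<and> (\<forall>p\<in>T. 0 \<le> eps p \<and> eps p \<le> r) \<and> trajectory T idx r eps X \<and> norm (X a - Xs a) \<le> r"
    then have r0: "r > 0" and X: "trajectory T idx r eps X" and eps: "\<And>p. p \<in> T \<Longrightarrow> 0 \<le> eps p" "\<And>p. p \<in> T \<Longrightarrow> eps p \<le> r"
      and Xa: "norm (X a - Xs a) \<le> r" by auto
    note Xc = trajectory_cont[OF X]
    have rR: "r < x" if "x \<in> R" for x
      using * Min_le[OF R(1) that] by linarith
    have rr1: "r < r1" by (rule rR) (simp add: R_def)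
    have "r < d1 / (C + 1)" by (rule rR) (simp add: R_def)
    then have rd1: "C * r \<le> d1" using C r0 by (simp add: field_simps)
    have rp: "real (k + 1) * r < dp p" "fst p + real (k + 1) * r \<le> b" if "p \<in> T" for p
    proof -
      have "r < min (dp p) (b - fst p) / real (k + 1)"
        by (rule rR) (use that in \<open>simp add: R_def\<close>)
      then have "real (k + 1) * r < min (dp p) (b - fst p)"
        by (simp add: pos_less_divide_eq mult.commute)
      then show "real (k + 1) * r < dp p" "fst p + real (k + 1) * r \<le> b" by auto
    qed
    define y where "y = (\<lambda>t. X t - Xs t)"
    have yC: "norm (y t) \<le> C * r" if t: "t \<in> {a..b}" for t
    proof -
      have "norm (y t) \<le> C0 * (norm (X a - Xs a) + (\<Sum>p\<in>T. eps p))"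
        unfolding y_def by (rule C0(2)[OF X eps(1) t])
      also have "\<dots> \<le> C0 * (r + real (card T) * r)"
        using sum_bounded_above[of T eps r] eps(2) Xa C0(1) by (intro mult_left_mono add_mono) auto
      finally show ?thesis by (simp add: C_def algebra_simps)
    qed
    define F where "F = (\<lambda>t. transfer t (pert T idx r eps t (X t) - g t (Xs t) - A t (y t)))"
    define Gp where "Gp = (\<lambda>p t. indicat_real (slot idx r eps p) t *\<^sub>R needle_effect (snd p) t)"
    have ym: "bmeas a b y"
      unfolding y_def by (intro bmeas_diff bmeas_continuous Xc Xs_cont)
    have Fm: "bmeas a b F"
      unfolding F_def by (intro transfer_meas bmeas_diff pert_meas g_meas A_comp_meas ym T Xc Xs_cont)
    have Gm: "bmeas a b (Gp p)" for p
      unfolding Gp_def by (intro bmeas_scaleR slot_meas needle_effect_meas)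
    have Fint: "integral {a..b} F = y b - transfer a (y a)"
      using integral_unique[OF endpoint_representation[OF T X]] by (simp add: F_def y_def)
    have ptw: "norm (F t - (\<Sum>p\<in>T. Gp p t)) \<le> B * e1 * C * r + (\<Sum>p\<in>T. indicat_real (slot idx r eps p) t * (B * LD (snd p) * C * r))"
      if t: "t \<in> {a..b}" for t
    proof -
      define u where "u = g t (Xs t + y t) - g t (Xs t) - A t (y t)"
      define v where "v = (\<lambda>p :: real \<times> nat. D (snd p) t (X t) - D (snd p) t (Xs t))"
      define c where "c = (\<lambda>p. indicat_real (slot idx r eps p) t)"
      have "pert T idx r eps t (X t) - g t (Xs t) - A t (y t)
          = u + ((\<Sum>p\<in>T. c p *\<^sub>R D (snd p) t (Xs t)) + (\<Sum>p\<in>T. c p *\<^sub>R v p))"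
        by (simp add: pert_def u_def v_def c_def y_def scaleR_diff_right sum_subtractf)
      then have "F t = transfer t u + ((\<Sum>p\<in>T. c p *\<^sub>R transfer t (D (snd p) t (Xs t))) + (\<Sum>p\<in>T. c p *\<^sub>R transfer t (v p)))"
        unfolding F_def by (simp only: transfer_add linear_sum[OF linear_transfer] transfer_scaleR)
      moreover have "(\<Sum>p\<in>T. Gp p t) = (\<Sum>p\<in>T. c p *\<^sub>R transfer t (D (snd p) t (Xs t)))"
        by (simp only: Gp_def needle_effect_def c_def)
      ultimately have dec: "F t - (\<Sum>p\<in>T. Gp p t) = transfer t u + (\<Sum>p\<in>T. c p *\<^sub>R transfer t (v p))"
        by simp
      have "norm (y t) \<le> d1" using yC[OF t] rd1 by linarith
      then have "norm u \<le> e1 * norm (y t)"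
        unfolding u_def by (rule d1(2)[OF t])
      also have "\<dots> \<le> e1 * (C * r)"
        using yC[OF t] e(1) by (intro mult_left_mono) auto
      finally have u: "norm (transfer t u) \<le> B * (e1 * (C * r))"
        by (rule order_trans[OF B(2)[OF t] mult_left_mono]) (rule B(1))
      have v: "norm (c p *\<^sub>R transfer t (v p)) \<le> c p * (B * (LD (snd p) * (C * r)))" for p
      proof -
        have "norm (v p) \<le> LD (snd p) * norm (y t)"
          unfolding v_def y_def by (rule D_lip[OF t])
        also have "\<dots> \<le> LD (snd p) * (C * r)"
          using yC[OF t] LD_nonneg by (intro mult_left_mono) auto
        finally have "norm (transfer t (v p)) \<le> B * (LD (snd p) * (C * r))"
          by (rule order_trans[OF B(2)[OF t] mult_left_mono]) (rule B(1))
        moreover have "0 \<le> c p" by (simp add: c_def)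
        ultimately show ?thesis by (simp add: mult_left_mono)
      qed
      have "norm (F t - (\<Sum>p\<in>T. Gp p t)) \<le> B * (e1 * (C * r)) + (\<Sum>p\<in>T. c p * (B * (LD (snd p) * (C * r))))"
        unfolding dec by (rule norm_triangle_mono[OF u sum_norm_le]) (rule v)
      then show ?thesis by (simp only: mult.assoc c_def)
    qed
    have ii: "(\<lambda>t. indicat_real (slot idx r eps p) t) integrable_on {a..b}" for p
      by (rule bmeas_integrable[OF slot_meas])
    have ii': "(\<lambda>t. \<Sum>p\<in>T. indicat_real (slot idx r eps p) t * (B * LD (snd p) * C * r)) integrable_on {a..b}"
      by (intro integrable_sum T integrable_on_mult_left ii)
    have n1: "norm (integral {a..b} (\<lambda>t. F t - (\<Sum>p\<in>T. Gp p t)))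
        \<le> integral {a..b} (\<lambda>t. B * e1 * C * r + (\<Sum>p\<in>T. indicat_real (slot idx r eps p) t * (B * LD (snd p) * C * r)))"
      by (rule norm_integral_le_integral) (intro bmeas_diff bmeas_sum Fm Gm T, intro integrable_add ii' integrable_const_ivl, rule ptw)
    have n2: "integral {a..b} (\<lambda>t. B * e1 * C * r + (\<Sum>p\<in>T. indicat_real (slot idx r eps p) t * (B * LD (snd p) * C * r)))
        = B * e1 * C * r * (b - a) + (\<Sum>p\<in>T. integral {a..b} (indicat_real (slot idx r eps p)) * (B * LD (snd p) * C * r))"
    proof -
      have s: "integral {a..b} (\<lambda>t. \<Sum>p\<in>T. indicat_real (slot idx r eps p) t * (B * LD (snd p) * C * r))
          = (\<Sum>p\<in>T. integral {a..b} (indicat_real (slot idx r eps p)) * (B * LD (snd p) * C * r))"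
        unfolding integral_sum[OF T integrable_on_mult_left[OF ii]]
        by (intro sum.cong refl Henstock_Kurzweil_Integration.integral_mult_left)
      have "integral {a..b} (\<lambda>t. B * e1 * C * r) = B * e1 * C * r * (b - a)"
        using ab by simp
      then show ?thesis
        unfolding integral_add[OF integrable_const_ivl ii'] s by (rule arg_cong2[where f = "(+)", OF _ refl])
    qed
    have n3: "(\<Sum>p\<in>T. integral {a..b} (indicat_real (slot idx r eps p)) * (B * LD (snd p) * C * r)) \<le> (\<Sum>p\<in>T. r * (B * LD (snd p) * C * r))"
    proof (intro sum_mono mult_right_mono)
      fix p assume p: "p \<in> T"
      show "integral {a..b} (indicat_real (slot idx r eps p)) \<le> r"
        using integral_indicator_le[of "fst p + real (idx p) * r" "fst p + real (idx p) * r + eps p" a b] eps[OF p]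
        by (simp add: slot_def)
      show "0 \<le> B * LD (snd p) * C * r"
        using B(1) LD_nonneg C r0 by (intro mult_nonneg_nonneg) auto
    qed
    have n4: "(\<Sum>p\<in>T. r * (B * LD (snd p) * C * r)) = B * C * S * r * r"
      by (simp add: S_def sum_distrib_left sum_distrib_right mult_ac)
    have n5: "B * C * S * r * r \<le> (B * C * S * r1) * r"
      using rr1 r0 B C S by (intro mult_right_mono mult_left_mono) auto
    have n6: "B * e1 * C * r * (b - a) + (B * C * S * r1) * r = (B * C * (b - a) * e1 + B * C * S * r1) * r"
      by (simp add: algebra_simps)
    have n7: "(B * C * (b - a) * e1 + B * C * S * r1) * r \<le> (\<kappa> / 3 + \<kappa> / 3) * r"
      using k1 k3 r0 by (intro mult_right_mono add_mono) auto
    have 1: "norm (integral {a..b} (\<lambda>t. F t - (\<Sum>p\<in>T. Gp p t))) \<le> (\<kappa> / 3 + \<kappa> / 3) * r"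
    proof -
      have m1: "norm (integral {a..b} (\<lambda>t. F t - (\<Sum>p\<in>T. Gp p t)))
          \<le> B * e1 * C * r * (b - a) + (\<Sum>p\<in>T. integral {a..b} (indicat_real (slot idx r eps p)) * (B * LD (snd p) * C * r))"
        using n1 unfolding n2 .
      note m2 = order_trans[OF m1 add_left_mono[OF n3], unfolded n4]
      note m3 = order_trans[OF m2 add_left_mono[OF n5], unfolded n6]
      show ?thesis by (rule order_trans[OF m3 n7])
    qed
    have 2: "integral {a..b} (\<lambda>t. F t - (\<Sum>p\<in>T. Gp p t)) = integral {a..b} F - (\<Sum>p\<in>T. integral {a..b} (Gp p))"
      using T by (simp add: integral_diff bmeas_integrable Fm Gm integrable_sum integral_sum)
    have "norm (\<Sum>p\<in>T. integral {a..b} (Gp p) - eps p *\<^sub>R needle_effect (snd p) (fst p)) \<le> (\<Sum>p\<in>T. e2 * (2 * real k + 1) * r)"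
    proof (rule sum_norm_le)
      fix p assume p: "p \<in> T"
      show "norm (integral {a..b} (Gp p) - eps p *\<^sub>R needle_effect (snd p) (fst p)) \<le> e2 * (2 * real k + 1) * r"
        unfolding Gp_def slot_def using dp(2)[OF p r0 rp(1)[OF p] idx[OF p] eps[OF p] rp(2)[OF p]] .
    qed
    also have "\<dots> = (real (card T) * (2 * real k + 1) * e2) * r" by simp
    also have "\<dots> \<le> \<kappa> / 3 * r" using k2 r0 by (intro mult_right_mono) auto
    finally have 3: "norm (\<Sum>p\<in>T. integral {a..b} (Gp p) - eps p *\<^sub>R needle_effect (snd p) (fst p)) \<le> \<kappa> / 3 * r" .
    have "X b - Xs b - first_order T eps (X a - Xs a)
        = integral {a..b} (\<lambda>t. F t - (\<Sum>p\<in>T. Gp p t)) + (\<Sum>p\<in>T. integral {a..b} (Gp p) - eps p *\<^sub>R needle_effect (snd p) (fst p))"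
      unfolding 2 Fint by (simp add: first_order_def y_def sum_subtractf)
    then have "norm (X b - Xs b - first_order T eps (X a - Xs a)) \<le> (\<kappa> / 3 + \<kappa> / 3) * r + \<kappa> / 3 * r"
      using norm_triangle_mono[OF 1 3] by metis
    then show "norm (X b - Xs b - first_order T eps (X a - Xs a)) \<le> \<kappa> * r"
      by (simp add: algebra_simps)
  qed
qed

end

subsection \<open>The multiplier rule for needle variations\<close>

lemma cone_separation:
  fixes K :: "'f::euclidean_space set"
  assumes "0 \<in> K" and add: "\<And>x y. x \<in> K \<Longrightarrow> y \<in> K \<Longrightarrow> x + y \<in> K"
    and scale: "\<And>c x. 0 \<le> c \<Longrightarrow> x \<in> K \<Longrightarrow> c *\<^sub>R x \<in> K" and "K \<noteq> UNIV"
  obtains \<mu> where "\<mu> \<noteq> 0" "\<And>v. v \<in> K \<Longrightarrow> 0 \<le> \<mu> \<bullet> v"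
proof -
  obtain y0 where y0: "y0 \<notin> K" using \<open>K \<noteq> UNIV\<close> by blast
  have "convex K"
    by (rule convexI) (intro add scale)
  moreover have "{y0} \<inter> K = {}" using y0 by blast
  ultimately obtain \<mu> c where \<mu>: "\<mu> \<noteq> 0" "\<And>v. v \<in> K \<Longrightarrow> c \<le> \<mu> \<bullet> v"
    using separating_hyperplane_sets[of "{y0}" K] \<open>0 \<in> K\<close> by auto
  have "0 \<le> \<mu> \<bullet> v" if "v \<in> K" for v
  proof (rule ccontr)
    assume neg: "\<not> 0 \<le> \<mu> \<bullet> v"
    define k where "k = (\<bar>c\<bar> + 1) / (- (\<mu> \<bullet> v))"
    have "k \<ge> 0" using neg by (simp add: k_def field_simps)
    then have "c \<le> \<mu> \<bullet> (k *\<^sub>R v)" using \<mu>(2) scale that by blast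
    moreover have "k * (\<mu> \<bullet> v) = - (\<bar>c\<bar> + 1)" using neg by (simp add: k_def)
    ultimately show False by simp
  qed
  then show ?thesis using that \<mu>(1) by blast
qed

text \<open>Positively homogeneous coordinates with respect to the 2 dim vectors \<open>\<plusminus>\<beta>\<close>. They turn
  preimages of these vectors under a map on a convex cone into a Lipschitz right inverse with values
  in the cone.\<close>

definition signed_basis :: "'f::euclidean_space set" where
  "signed_basis = Basis \<union> uminus ` Basis"

lemma finite_signed_basis: "finite signed_basis"
  by (simp add: signed_basis_def)

lemma norm_signed_basis: "z \<in> signed_basis \<Longrightarrow> norm z = 1"
  by (auto simp: signed_basis_def)

lemma signed_basis_representation:
  fixes w :: "'f::euclidean_space"
  shows "(\<Sum>z\<in>signed_basis. max (w \<bullet> z) 0 *\<^sub>R z) = w"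
proof -
  have disj: "(Basis :: 'f set) \<inter> uminus ` Basis = {}"
  proof (rule ccontr)
    assume "(Basis :: 'f set) \<inter> uminus ` Basis \<noteq> {}"
    then obtain \<beta> \<beta>' :: 'f where "\<beta> \<in> Basis" "\<beta>' \<in> Basis" "\<beta> = - \<beta>'" by blast
    then show False
      using inner_Basis[of \<beta>' \<beta>] inner_Basis[of \<beta>' \<beta>'] by (auto split: if_splits)
  qed
  have "(\<Sum>z\<in>signed_basis. max (w \<bullet> z) 0 *\<^sub>R z)
      = (\<Sum>\<beta>\<in>Basis. max (w \<bullet> \<beta>) 0 *\<^sub>R \<beta>) + (\<Sum>\<beta>\<in>Basis. max (w \<bullet> (- \<beta>)) 0 *\<^sub>R (- \<beta>))"
    unfolding signed_basis_def by (subst sum.union_disjoint[OF _ _ disj]) (auto simp: sum.reindex)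
  also have "\<dots> = (\<Sum>\<beta>\<in>Basis. (w \<bullet> \<beta>) *\<^sub>R \<beta>)"
    unfolding sum.distrib[symmetric] by (rule sum.cong) (auto simp: max_def)
  finally show ?thesis by (simp add: euclidean_representation)
qed

lemma signed_coordinate_lipschitz:
  assumes "z \<in> signed_basis"
  shows "\<bar>max (w \<bullet> z) 0 - max (w' \<bullet> z) 0\<bar> \<le> norm (w - w')"
proof -
  have "\<bar>max (w \<bullet> z) 0 - max (w' \<bullet> z) 0\<bar> \<le> \<bar>(w - w') \<bullet> z\<bar>"
    by (auto simp: inner_diff_left max_def)
  also have "\<dots> \<le> norm (w - w') * norm z" by (rule Cauchy_Schwarz_ineq2)
  finally show ?thesis using norm_signed_basis[OF assms] by simp
qed

context needle_variation
begin

lemma slots_separated: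
  assumes T: "finite T" and t: "\<And>p. p \<in> T \<Longrightarrow> fst p \<in> {a..<b}" and inj: "inj_on idx T"
    and idx: "\<And>p. p \<in> T \<Longrightarrow> idx p \<le> k"
  shows "\<exists>\<rho>>0. \<forall>r eps. 0 < r \<and> r < \<rho> \<and> (\<forall>p\<in>T. eps p \<le> r) \<longrightarrow>
     (\<forall>p\<in>T. slot idx r eps p \<subseteq> {a..b}) \<and> (\<forall>p\<in>T. \<forall>q\<in>T. p \<noteq> q \<longrightarrow> slot idx r eps p \<inter> slot idx r eps q = {})"
proof -
  define Q where "Q = insert 1 ((\<lambda>p. b - fst p) ` T \<union> ((\<lambda>(p,q). if fst p = fst q then 1 else \<bar>fst p - fst q\<bar>) ` (T \<times> T)))"
  have Q: "finite Q" "\<And>x. x \<in> Q \<Longrightarrow> x > 0"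
    using T t unfolding Q_def by auto
  define \<delta> where "\<delta> = Min Q"
  have \<delta>: "\<delta> > 0" unfolding \<delta>_def using Q by (subst Min_gr_iff) (auto simp: Q_def)
  have \<delta>Q: "\<delta> \<le> x" if "x \<in> Q" for x
    unfolding \<delta>_def using Q(1) that by (rule Min_le)
  show ?thesis
  proof (intro exI[of _ "\<delta> / real (k + 1)"] conjI allI impI)
    show "0 < \<delta> / real (k + 1)" using \<delta> by simp
    fix r eps assume *: "0 < r \<and> r < \<delta> / real (k + 1) \<and> (\<forall>p\<in>T. eps p \<le> r)"
    then have kr: "real (k + 1) * r < \<delta>"
      by (simp add: pos_less_divide_eq mult.commute)
    have sl: "fst p + real (idx p) * r \<le> s" "s < fst p + real (idx p + 1) * r" "real (idx p + 1) * r \<le> real (k + 1) * r"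
      "0 \<le> real (idx p) * r"
      if "p \<in> T" "s \<in> slot idx r eps p" for p s
    proof -
      show "fst p + real (idx p) * r \<le> s" "0 \<le> real (idx p) * r"
        using that * by (auto simp: slot_def)
      have "s < fst p + real (idx p) * r + eps p" "eps p \<le> r"
        using that * by (auto simp: slot_def)
      then show "s < fst p + real (idx p + 1) * r" by (simp add: algebra_simps)
      show "real (idx p + 1) * r \<le> real (k + 1) * r"
        using idx[OF that(1)] * by (intro mult_right_mono) auto
    qed
    show "\<forall>p\<in>T. slot idx r eps p \<subseteq> {a..b}"
    proof (intro ballI subsetI)
      fix p s assume p: "p \<in> T" "s \<in> slot idx r eps p"
      have "\<delta> \<le> b - fst p" by (rule \<delta>Q) (use p in \<open>auto simp: Q_def\<close>)
      then show "s \<in> {a..b}"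
        using sl[OF p] kr t[OF p(1)] by auto
    qed
    have aux: False if pq: "p \<in> T" "q \<in> T" "p \<noteq> q" "fst p < fst q \<or> fst p = fst q \<and> idx p < idx q"
      and s: "s \<in> slot idx r eps p" "s \<in> slot idx r eps q" for p q s
    proof (cases "fst p = fst q")
      case True
      then have "real (idx p + 1) * r \<le> real (idx q) * r"
        using pq * by (intro mult_right_mono) auto
      then show False
        using sl[OF pq(1) s(1)] sl[OF pq(2) s(2)] True by linarith
    next
      case False
      have "(if fst p = fst q then 1 else \<bar>fst p - fst q\<bar>) \<in> Q"
        using pq unfolding Q_def by force
      from \<delta>Q[OF this] have "\<delta> \<le> fst q - fst p" using pq False by auto
      then show False
        using sl[OF pq(1) s(1)] sl[OF pq(2) s(2)] kr by linarith
    qed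
    show "\<forall>p\<in>T. \<forall>q\<in>T. p \<noteq> q \<longrightarrow> slot idx r eps p \<inter> slot idx r eps q = {}"
    proof (intro ballI impI, rule ccontr)
      fix p q assume pq: "p \<in> T" "q \<in> T" "p \<noteq> q" "slot idx r eps p \<inter> slot idx r eps q \<noteq> {}"
      then obtain s where s: "s \<in> slot idx r eps p" "s \<in> slot idx r eps q" by blast
      have "idx p \<noteq> idx q" using inj pq by (meson inj_onD)
      then consider "fst p < fst q \<or> fst p = fst q \<and> idx p < idx q" | "fst q < fst p \<or> fst q = fst p \<and> idx q < idx p"
        by linarith
      then show False
        using aux[of p q s] aux[of q p s] pq s by cases auto
    qed
  qed
qed

lemma costate_combination:
  shows "\<exists>P. continuous_on {a..b} P \<and> (\<forall>t\<in>{a..b}. P t = P b + integral {t..b} (\<lambda>s. adjoint (A s) (P s)))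
     \<and> (\<forall>t y. P t \<bullet> y = q \<bullet> transfer t y) \<and> P b = q"
proof -
  define P where "P = (\<lambda>t. \<Sum>\<beta>\<in>Basis. (q \<bullet> \<beta>) *\<^sub>R costate \<beta> t)"
  have cont: "continuous_on {a..b} P"
    unfolding P_def by (intro continuous_intros costate_cont)
  have adj: "adjoint (A s) (P s) = (\<Sum>\<beta>\<in>Basis. (q \<bullet> \<beta>) *\<^sub>R adjoint (A s) (costate \<beta> s))" if "s \<in> {a..b}" for s
    unfolding P_def
    by (simp only: linear_sum[OF adjoint_linear[OF A_linear[OF that]]] linear_scale[OF adjoint_linear[OF A_linear[OF that]]])
  have eq: "P t = q + integral {t..b} (\<lambda>s. adjoint (A s) (P s))" if t: "t \<in> {a..b}" for t
  proof -
    have sub: "{t..b} \<subseteq> {a..b}" using t by auto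
    have int: "(\<lambda>s. (q \<bullet> \<beta>) *\<^sub>R adjoint (A s) (costate \<beta> s)) integrable_on {t..b}" for \<beta>
      by (intro bmeas_integrable bmeas_subinterval[OF _ sub] bmeas_scaleR bmeas_const adjoint_meas bmeas_continuous costate_cont)
    have "integral {t..b} (\<lambda>s. adjoint (A s) (P s)) = integral {t..b} (\<lambda>s. \<Sum>\<beta>\<in>Basis. (q \<bullet> \<beta>) *\<^sub>R adjoint (A s) (costate \<beta> s))"
      by (rule integral_cong) (use adj sub in auto)
    also have "\<dots> = (\<Sum>\<beta>\<in>Basis. integral {t..b} (\<lambda>s. (q \<bullet> \<beta>) *\<^sub>R adjoint (A s) (costate \<beta> s)))"
      by (rule integral_sum[OF finite_Basis int])
    also have "\<dots> = (\<Sum>\<beta>\<in>Basis. (q \<bullet> \<beta>) *\<^sub>R integral {t..b} (\<lambda>s. adjoint (A s) (costate \<beta> s)))"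
      by (simp only: integral_cmul)
    finally have i: "integral {t..b} (\<lambda>s. adjoint (A s) (P s)) = (\<Sum>\<beta>\<in>Basis. (q \<bullet> \<beta>) *\<^sub>R integral {t..b} (\<lambda>s. adjoint (A s) (costate \<beta> s)))" .
    have "P t = (\<Sum>\<beta>\<in>Basis. (q \<bullet> \<beta>) *\<^sub>R (\<beta> + integral {t..b} (\<lambda>s. adjoint (A s) (costate \<beta> s))))"
      unfolding P_def by (intro sum.cong refl arg_cong2[where f = scaleR] costate_eq t)
    also have "\<dots> = (\<Sum>\<beta>\<in>Basis. (q \<bullet> \<beta>) *\<^sub>R \<beta>) + (\<Sum>\<beta>\<in>Basis. (q \<bullet> \<beta>) *\<^sub>R integral {t..b} (\<lambda>s. adjoint (A s) (costate \<beta> s)))"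
      by (simp only: scaleR_add_right sum.distrib)
    finally show ?thesis
      unfolding i euclidean_representation .
  qed
  have Pb: "P b = q" using eq[of b] ab by simp
  have "P t \<bullet> y = q \<bullet> transfer t y" for t y
    unfolding P_def transfer_def by (simp add: inner_sum_left inner_sum_right mult.commute)
  then show ?thesis
    using cont eq Pb by blast
qed

theorem multiplier_rule:
  fixes E :: "'a \<times> 'a \<Rightarrow> 'f::euclidean_space"
  assumes DE: "(E has_derivative DE) (at (Xs a, Xs b))"
    and \<eta>0: "\<eta>0 > 0" and Econt: "continuous_on (cball (Xs a, Xs b) \<eta>0) E"
    and e: "norm e \<le> 1"
    and no_improvement: "\<And>T. finite T \<Longrightarrow> \<exists>\<eta>>0. \<forall>idx r eps X s \<delta>.
        (\<forall>p\<in>T. slot idx r eps p \<subseteq> {a..b}) \<and> (\<forall>p\<in>T. \<forall>q\<in>T. p \<noteq> q \<longrightarrow> slot idx r eps p \<inter> slot idx r eps q = {}) \<and>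
        trajectory T idx r eps X \<and> (\<forall>t\<in>{a..b}. norm (X t - Xs t) \<le> \<eta>) \<and> 0 \<le> s \<and> 0 < \<delta> \<longrightarrow>
        E (X a, X b) + s *\<^sub>R e \<noteq> E (Xs a, Xs b) - \<delta> *\<^sub>R e"
  shows "\<exists>\<mu> P. \<mu> \<noteq> 0 \<and> 0 \<le> \<mu> \<bullet> e \<and> continuous_on {a..b} P \<and>
     (\<forall>t\<in>{a..b}. P t = P b + integral {t..b} (\<lambda>s. adjoint (A s) (P s))) \<and>
     (\<forall>y. P b \<bullet> y = \<mu> \<bullet> DE (0, y)) \<and> (\<forall>\<xi>. P a \<bullet> \<xi> = - (\<mu> \<bullet> DE (\<xi>, 0))) \<and>
     (\<exists>N. negligible N \<and> (\<forall>t\<in>{a..<b} - N. \<forall>n. 0 \<le> P t \<bullet> D n t (Xs t)))"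
proof -
  have blDE: "bounded_linear DE" using DE by (rule has_derivative_bounded_linear)
  note lin = bounded_linear.linear[OF blDE]
  have DE_split: "DE (x, y) = DE (x, 0) + DE (0, y)" for x y
    using linear_add[OF lin, of "(x,0)" "(0,y)"] by simp
  define G where "G = (\<lambda>p. DE (0, needle_effect (snd p) (fst p)))"
  define \<Lambda> where "\<Lambda> = (\<lambda>\<xi>. DE (\<xi>, transfer a \<xi>))"
  have \<Lambda>_add: "\<Lambda> (x + y) = \<Lambda> x + \<Lambda> y" and \<Lambda>_scale: "\<Lambda> (c *\<^sub>R x) = c *\<^sub>R \<Lambda> x" for x y c
    unfolding \<Lambda>_def using linear_add[OF lin, of "(x, transfer a x)" "(y, transfer a y)"]
      linear_scale[OF lin, of c "(x, transfer a x)"]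
    by (simp_all add: transfer_add transfer_scaleR)
  have lin\<Lambda>: "linear \<Lambda>" by (rule linearI) (rule \<Lambda>_add, rule \<Lambda>_scale)
  have lin0: "linear (\<lambda>y. DE (0, y))"
    using linear_compose[of "\<lambda>y. (0, y)" DE] lin by (auto simp: o_def linear_iff)
  have DE_first: "DE (\<xi>, first_order T eps \<xi>) = (\<Sum>p\<in>T. eps p *\<^sub>R G p) + \<Lambda> \<xi>" for T eps \<xi>
  proof -
    have "DE (\<xi>, first_order T eps \<xi>) = DE (\<xi>, transfer a \<xi>) + DE (0, \<Sum>p\<in>T. eps p *\<^sub>R needle_effect (snd p) (fst p))"
      unfolding first_order_def using linear_add[OF lin, of "(\<xi>, transfer a \<xi>)" "(0, \<Sum>p\<in>T. eps p *\<^sub>R needle_effect (snd p) (fst p))"] by simp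
    also have "DE (0, \<Sum>p\<in>T. eps p *\<^sub>R needle_effect (snd p) (fst p)) = (\<Sum>p\<in>T. eps p *\<^sub>R G p)"
      using linear_sum[OF lin0, of "\<lambda>p. eps p *\<^sub>R needle_effect (snd p) (fst p)" T] linear_scale[OF lin0]
      by (simp add: G_def)
    finally show ?thesis by (simp add: \<Lambda>_def add.commute)
  qed
  define Q where "Q = (\<lambda>v T eps \<xi> s. finite T \<and> (\<forall>p\<in>T. regular_time (fst p) \<and> 0 \<le> eps p) \<and> 0 \<le> s \<and>
      v = (\<Sum>p\<in>T. eps p *\<^sub>R G p) + \<Lambda> \<xi> + s *\<^sub>R e)"
  have QD: "finite T" "p \<in> T \<Longrightarrow> regular_time (fst p)" "p \<in> T \<Longrightarrow> 0 \<le> eps p" "0 \<le> s"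
    "v = (\<Sum>p\<in>T. eps p *\<^sub>R G p) + \<Lambda> \<xi> + s *\<^sub>R e" if "Q v T eps \<xi> s" for v T eps \<xi> s p
    using that unfolding Q_def by blast+
  define K where "K = {v. \<exists>T eps \<xi> s. Q v T eps \<xi> s}"
  have KI: "v \<in> K" if "finite T" "\<And>p. p \<in> T \<Longrightarrow> regular_time (fst p)" "\<And>p. p \<in> T \<Longrightarrow> 0 \<le> eps p" "0 \<le> s"
    "v = (\<Sum>p\<in>T. eps p *\<^sub>R G p) + \<Lambda> \<xi> + s *\<^sub>R e" for v T eps \<xi> s
    unfolding K_def by (intro CollectI exI[of _ T] exI[of _ eps] exI[of _ \<xi>] exI[of _ s])
      (unfold Q_def, intro conjI ballI that)
  have extend: "(\<Sum>p\<in>T'. (if p \<in> T then eps p else 0) *\<^sub>R G p) = (\<Sum>p\<in>T. eps p *\<^sub>R G p)" if "finite T'" "T \<subseteq> T'" for T T' eps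
    by (rule sum.mono_neutral_cong_right[OF that]) auto
  have "K \<noteq> UNIV"
  proof
    assume "K = UNIV"
    let ?Z = "signed_basis :: 'f set"
    have "\<forall>z. \<exists>T eps \<xi> s. Q z T eps \<xi> s"
      using \<open>K = UNIV\<close> unfolding K_def by blast
    from choice[OF this] obtain T0 where "\<forall>z. \<exists>eps \<xi> s. Q z (T0 z) eps \<xi> s" ..
    from choice[OF this] obtain eps0 where "\<forall>z. \<exists>\<xi> s. Q z (T0 z) (eps0 z) \<xi> s" ..
    from choice[OF this] obtain \<xi>0 where "\<forall>z. \<exists>s. Q z (T0 z) (eps0 z) (\<xi>0 z) s" ..
    from choice[OF this] obtain s0 where Q: "\<forall>z. Q z (T0 z) (eps0 z) (\<xi>0 z) (s0 z)" ..
    note rep = QD[OF Q[rule_format]]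
    define T where "T = (\<Union>z\<in>?Z. T0 z)"
    have T: "finite T" unfolding T_def using finite_signed_basis rep(1) by blast
    have Treg: "\<And>p. p \<in> T \<Longrightarrow> regular_time (fst p)" unfolding T_def using rep(2) by blast
    define eps1 where "eps1 = (\<lambda>z p. if p \<in> T0 z then eps0 z p else 0)"
    have eps1: "eps1 z p \<ge> 0" for z p using rep(3) by (simp add: eps1_def)
    have rep1: "z = (\<Sum>p\<in>T. eps1 z p *\<^sub>R G p) + \<Lambda> (\<xi>0 z) + s0 z *\<^sub>R e" if "z \<in> ?Z" for z
    proof -
      have sub: "T0 z \<subseteq> T" using that unfolding T_def by blast
      show ?thesis unfolding eps1_def extend[OF T sub] by (rule rep(5))
    qed
    define c where "c = (\<lambda>w z::'f. max (w \<bullet> z) 0)"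
    define eps where "eps = (\<lambda>w p. \<Sum>z\<in>?Z. c w z * eps1 z p)"
    define \<xi> where "\<xi> = (\<lambda>w. \<Sum>z\<in>?Z. c w z *\<^sub>R \<xi>0 z)"
    define s where "s = (\<lambda>w. \<Sum>z\<in>?Z. c w z * s0 z)"
    have c0: "c w z \<ge> 0" for w z by (simp add: c_def)
    have sol: "(\<Sum>p\<in>T. eps w p *\<^sub>R G p) + \<Lambda> (\<xi> w) + s w *\<^sub>R e = w" for w
    proof -
      have "(\<Sum>p\<in>T. eps w p *\<^sub>R G p) = (\<Sum>z\<in>?Z. c w z *\<^sub>R (\<Sum>p\<in>T. eps1 z p *\<^sub>R G p))"
        unfolding eps_def by (simp add: scaleR_sum_left scaleR_sum_right) (rule sum.swap)
      moreover have "\<Lambda> (\<xi> w) = (\<Sum>z\<in>?Z. c w z *\<^sub>R \<Lambda> (\<xi>0 z))"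
        unfolding \<xi>_def by (simp add: linear_sum[OF lin\<Lambda>] \<Lambda>_scale)
      moreover have "s w *\<^sub>R e = (\<Sum>z\<in>?Z. c w z *\<^sub>R (s0 z *\<^sub>R e))"
        unfolding s_def by (simp add: scaleR_sum_left)
      ultimately have "(\<Sum>p\<in>T. eps w p *\<^sub>R G p) + \<Lambda> (\<xi> w) + s w *\<^sub>R e
          = (\<Sum>z\<in>?Z. c w z *\<^sub>R ((\<Sum>p\<in>T. eps1 z p *\<^sub>R G p) + \<Lambda> (\<xi>0 z) + s0 z *\<^sub>R e))"
        by (simp add: sum.distrib scaleR_add_right)
      also have "\<dots> = (\<Sum>z\<in>?Z. c w z *\<^sub>R z)"
        by (intro sum.cong refl arg_cong2[where f = scaleR] rep1[symmetric])
      also have "\<dots> = w" unfolding c_def by (rule signed_basis_representation)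
      finally show ?thesis .
    qed
    define R where "R = 1 + (\<Sum>z\<in>?Z. (\<Sum>p\<in>T. eps1 z p) + norm (\<xi>0 z))"
    have R1: "R \<ge> 1" unfolding R_def using eps1 by (simp add: sum_nonneg add_nonneg_nonneg)
    have Reps: "(\<Sum>z\<in>?Z. eps1 z p) \<le> R" if "p \<in> T" for p
    proof -
      have "eps1 z p \<le> (\<Sum>p\<in>T. eps1 z p) + norm (\<xi>0 z)" for z
        using member_le_sum[OF that, of "eps1 z"] eps1 T by (simp add: add_increasing2)
      then have "(\<Sum>z\<in>?Z. eps1 z p) \<le> (\<Sum>z\<in>?Z. (\<Sum>p\<in>T. eps1 z p) + norm (\<xi>0 z))"
        by (intro sum_mono)
      then show ?thesis by (simp add: R_def)
    qed
    have R\<xi>: "(\<Sum>z\<in>?Z. norm (\<xi>0 z)) \<le> R"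
    proof -
      have "(\<Sum>z\<in>?Z. norm (\<xi>0 z)) \<le> (\<Sum>z\<in>?Z. (\<Sum>p\<in>T. eps1 z p) + norm (\<xi>0 z))"
        using eps1 by (intro sum_mono) (simp add: sum_nonneg)
      then show ?thesis by (simp add: R_def)
    qed
    have epslip: "\<bar>eps w p - eps w' p\<bar> \<le> R * norm (w - w')" if "p \<in> T" for w w' p
    proof -
      have "eps w p - eps w' p = (\<Sum>z\<in>?Z. (c w z - c w' z) * eps1 z p)"
        unfolding eps_def by (simp add: sum_subtractf left_diff_distrib)
      also have "\<bar>\<dots>\<bar> \<le> (\<Sum>z\<in>?Z. norm (w - w') * eps1 z p)"
      proof (intro order_trans[OF sum_abs] sum_mono)
        fix z assume z: "z \<in> ?Z"
        have "\<bar>(c w z - c w' z) * eps1 z p\<bar> = \<bar>c w z - c w' z\<bar> * eps1 z p"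
          unfolding abs_mult abs_of_nonneg[OF eps1] ..
        then show "\<bar>(c w z - c w' z) * eps1 z p\<bar> \<le> norm (w - w') * eps1 z p"
          unfolding c_def using mult_right_mono[OF signed_coordinate_lipschitz[OF z] eps1] by simp
      qed
      also have "\<dots> = (\<Sum>z\<in>?Z. eps1 z p) * norm (w - w')" by (simp add: sum_distrib_left mult.commute)
      also have "\<dots> \<le> R * norm (w - w')" by (intro mult_right_mono Reps that) simp
      finally show ?thesis .
    qed
    have \<xi>lip: "norm (\<xi> w - \<xi> w') \<le> R * norm (w - w')" for w w'
    proof -
      have "\<xi> w - \<xi> w' = (\<Sum>z\<in>?Z. (c w z - c w' z) *\<^sub>R \<xi>0 z)"
        unfolding \<xi>_def by (simp add: sum_subtractf scaleR_diff_left)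
      also have "norm \<dots> \<le> (\<Sum>z\<in>?Z. norm (w - w') * norm (\<xi>0 z))"
        by (rule sum_norm_le) (auto simp: c_def intro!: mult_right_mono signed_coordinate_lipschitz)
      also have "\<dots> = (\<Sum>z\<in>?Z. norm (\<xi>0 z)) * norm (w - w')" by (simp add: sum_distrib_left mult.commute)
      also have "\<dots> \<le> R * norm (w - w')" by (intro mult_right_mono R\<xi>) simp
      finally show ?thesis .
    qed
    have zero: "eps 0 p = 0" "\<xi> 0 = 0" for p by (simp_all add: eps_def \<xi>_def c_def)
    have eps0: "0 \<le> eps w p" for w p
      unfolding eps_def by (intro sum_nonneg mult_nonneg_nonneg c0 eps1)
    have s0: "0 \<le> s w" for w
      unfolding s_def by (intro sum_nonneg mult_nonneg_nonneg c0 rep(4))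
    obtain idx :: "real \<times> nat \<Rightarrow> nat" where idx: "inj_on idx T" "\<And>p. p \<in> T \<Longrightarrow> idx p \<le> card T"
    proof -
      obtain h where "bij_betw h T {0..<card T}" using ex_bij_betw_finite_nat[OF T] by blast
      then have h: "inj_on h T" "h ` T = {0..<card T}" by (simp_all add: bij_betw_def)
      have "h p \<le> card T" if "p \<in> T" for p
        using imageI[OF that, of h] unfolding h(2) by simp
      then show ?thesis using that h(1) by blast
    qed
    obtain BD where BD: "BD > 0" "\<And>v. norm (DE v) \<le> norm v * BD"
      using bounded_linear.pos_bounded[OF blDE] by blast
    obtain C0 where C0: "C0 \<ge> 0" "\<And>idx r eps X t. trajectory T idx r eps X \<Longrightarrow> (\<And>p. p \<in> T \<Longrightarrow> eps p \<ge> 0) \<Longrightarrow> t \<in> {a..b} \<Longrightarrow>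
       norm (X t - Xs t) \<le> C0 * (norm (X a - Xs a) + (\<Sum>p\<in>T. eps p))"
      by (rule trajectory_near[OF T]) blast
    obtain CL where CL: "CL \<ge> 0" "\<And>idx r eps eps' X Y t. trajectory T idx r eps X \<Longrightarrow> trajectory T idx r eps' Y \<Longrightarrow>
       (\<And>p. p \<in> T \<Longrightarrow> eps p \<ge> 0) \<Longrightarrow> (\<And>p. p \<in> T \<Longrightarrow> 0 \<le> eps' p) \<Longrightarrow> (\<And>p. p \<in> T \<Longrightarrow> eps' p \<le> 1) \<Longrightarrow>
       norm (Y a - Xs a) \<le> 1 \<Longrightarrow> t \<in> {a..b} \<Longrightarrow>
       norm (X t - Y t) \<le> CL * (norm (X a - Y a) + (\<Sum>p\<in>T. \<bar>eps p - eps' p\<bar>))"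
      by (rule trajectory_lipschitz[OF T]) blast
    define C where "C = C0 * (1 + real (card T))"
    have C: "C \<ge> 0" using C0 by (simp add: C_def)
    define \<kappa> where "\<kappa> = 1 / (4 * R * BD)"
    have \<kappa>: "\<kappa> > 0" using R1 BD by (simp add: \<kappa>_def)
    define \<kappa>' where "\<kappa>' = 1 / (4 * R * (1 + C))"
    have \<kappa>': "\<kappa>' > 0" using R1 C by (simp add: \<kappa>'_def)
    obtain \<rho>1 where \<rho>1: "\<rho>1 > 0" "\<And>r eps X. 0 < r \<Longrightarrow> r < \<rho>1 \<Longrightarrow> \<forall>p\<in>T. 0 \<le> eps p \<and> eps p \<le> r \<Longrightarrow> trajectory T idx r eps X \<Longrightarrow>
        norm (X a - Xs a) \<le> r \<Longrightarrow> norm (X b - Xs b - first_order T eps (X a - Xs a)) \<le> \<kappa> * r"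
      using endpoint_expansion[where idx = idx and k = "card T", OF T Treg idx(2) \<kappa>] by blast
    have Tab: "\<And>p. p \<in> T \<Longrightarrow> fst p \<in> {a..<b}" using Treg unfolding regular_time_def by blast
    have "\<exists>\<rho>>0. \<forall>r eps. 0 < r \<and> r < \<rho> \<and> (\<forall>p\<in>T. eps p \<le> r) \<longrightarrow>
       (\<forall>p\<in>T. slot idx r eps p \<subseteq> {a..b}) \<and> (\<forall>p\<in>T. \<forall>q\<in>T. p \<noteq> q \<longrightarrow> slot idx r eps p \<inter> slot idx r eps q = {})"
      by (rule slots_separated[where k = "card T"]) (fact T Tab idx)+
    then obtain \<rho>2 where \<rho>2: "\<rho>2 > 0" "\<forall>r eps. 0 < r \<and> r < \<rho>2 \<and> (\<forall>p\<in>T. eps p \<le> r) \<longrightarrow>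
       (\<forall>p\<in>T. slot idx r eps p \<subseteq> {a..b}) \<and> (\<forall>p\<in>T. \<forall>q\<in>T. p \<noteq> q \<longrightarrow> slot idx r eps p \<inter> slot idx r eps q = {})"
      by (elim exE conjE)
    obtain d where d: "d > 0" "\<And>v. norm (v - (Xs a, Xs b)) < d \<Longrightarrow>
        norm (E v - E (Xs a, Xs b) - DE (v - (Xs a, Xs b))) \<le> \<kappa>' * norm (v - (Xs a, Xs b))"
      using DE \<kappa>' unfolding has_derivative_at_alt by blast
    obtain \<eta> where \<eta>: "\<eta> > 0" "\<forall>idx r eps X s \<delta>.
        (\<forall>p\<in>T. slot idx r eps p \<subseteq> {a..b}) \<and> (\<forall>p\<in>T. \<forall>q\<in>T. p \<noteq> q \<longrightarrow> slot idx r eps p \<inter> slot idx r eps q = {}) \<and>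
        trajectory T idx r eps X \<and> (\<forall>t\<in>{a..b}. norm (X t - Xs t) \<le> \<eta>) \<and> 0 \<le> s \<and> 0 < \<delta> \<longrightarrow>
        E (X a, X b) + s *\<^sub>R e \<noteq> E (Xs a, Xs b) - \<delta> *\<^sub>R e"
      using no_improvement[OF T] by (elim exE conjE)
    define r where "r = Min {\<rho>1 / 2, \<rho>2 / 2, d / (2 * (1 + C)), \<eta>0 / (1 + C), \<eta> / (1 + C), 1}"
    have "1 + C > 0" using C by linarith
    then have "d / (2 * (1 + C)) > 0" "\<eta>0 / (1 + C) > 0" "\<eta> / (1 + C) > 0"
      using d(1) \<eta>0 \<eta>(1) by (auto intro!: divide_pos_pos mult_pos_pos)
    then have r0: "r > 0" unfolding r_def using \<rho>1(1) \<rho>2(1) by (subst Min_gr_iff) auto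
    have rle: "r \<le> \<rho>1 / 2" "r \<le> \<rho>2 / 2" "r \<le> d / (2 * (1 + C))" "r \<le> \<eta>0 / (1 + C)" "r \<le> \<eta> / (1 + C)" "r \<le> 1"
      unfolding r_def by (rule Min_le; simp)+
    have r1: "r < \<rho>1" "r < \<rho>2" using rle r0 by linarith+
    have r2: "(1 + C) * r < d" "(1 + C) * r \<le> \<eta>0" "(1 + C) * r \<le> \<eta>"
    proof -
      have "2 * ((1 + C) * r) \<le> d" using rle(3) C by (simp add: field_simps)
      then show "(1 + C) * r < d" using d(1) C r0 by (smt (verit) mult_pos_pos)
      show "(1 + C) * r \<le> \<eta>0" "(1 + C) * r \<le> \<eta>" using rle(4,5) C by (simp_all add: field_simps)
    qed
    define \<delta> where "\<delta> = r / R"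
    have \<delta>0: "\<delta> > 0" using r0 R1 by (simp add: \<delta>_def)
    have R\<delta>: "R * \<delta> = r" using R1 by (simp add: \<delta>_def)
    have epsr: "eps w p \<le> r" if "norm w \<le> \<delta>" "p \<in> T" for w p
      using epslip[OF that(2), of w 0] zero mult_left_mono[OF that(1), of R] R1 R\<delta> by simp
    have \<xi>r: "norm (\<xi> w) \<le> r" if "norm w \<le> \<delta>" for w
      using \<xi>lip[of w 0] zero mult_left_mono[OF that(1), of R] R1 R\<delta> by simp
    have "\<forall>w. \<exists>X. trajectory T idx r (eps w) X \<and> X a = Xs a + \<xi> w"
      using trajectory_exists[OF T] by blast
    then obtain X where X: "\<And>w. trajectory T idx r (eps w) (X w)" "\<And>w. X w a = Xs a + \<xi> w"
      by metis
    have near: "norm (X w t - Xs t) \<le> C * r" if w: "norm w \<le> \<delta>" and t: "t \<in> {a..b}" for w t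
    proof -
      have "norm (X w t - Xs t) \<le> C0 * (norm (X w a - Xs a) + (\<Sum>p\<in>T. eps w p))"
        by (rule C0(2)[OF X(1) eps0 t])
      also have "\<dots> \<le> C0 * (r + real (card T) * r)"
        using sum_bounded_above[of T "eps w" r] epsr[OF w] \<xi>r[OF w] C0(1) X(2) by (intro mult_left_mono add_mono) auto
      finally show ?thesis by (simp add: C_def algebra_simps)
    qed
    define V where "V = (\<lambda>w. (X w a, X w b))"
    have Vnear: "norm (V w - (Xs a, Xs b)) \<le> (1 + C) * r" if w: "norm w \<le> \<delta>" for w
    proof -
      have "norm (V w - (Xs a, Xs b)) \<le> norm (X w a - Xs a) + norm (X w b - Xs b)"
        unfolding V_def by (simp add: norm_Pair_le)
      also have "\<dots> \<le> r + C * r"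
        using near[OF w, of b] \<xi>r[OF w] ab X(2) by (intro add_mono) auto
      finally show ?thesis by (simp add: algebra_simps)
    qed
    define F where "F = (\<lambda>w. E (V w) - E (Xs a, Xs b) + s w *\<^sub>R e)"
    have Fw: "norm (F w - w) \<le> \<delta> / 2" if w: "norm w \<le> \<delta>" for w
    proof -
      define y where "y = X w b - Xs b"
      have V: "V w - (Xs a, Xs b) = (\<xi> w, y)" by (simp add: V_def y_def X(2))
      have Vd: "norm (V w - (Xs a, Xs b)) < d" using Vnear[OF w] r2(1) by linarith
      have "\<kappa>' * ((1 + C) * r) = \<delta> / 4"
      proof -
        have "1 + C \<noteq> 0" "R \<noteq> 0" using R1 C by auto
        then show ?thesis unfolding \<kappa>'_def \<delta>_def by (simp add: divide_simps)
      qed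
      with mult_left_mono[OF Vnear[OF w] less_imp_le[OF \<kappa>']] d(2)[OF Vd]
      have 1: "norm (E (V w) - E (Xs a, Xs b) - DE (\<xi> w, y)) \<le> \<delta> / 4"
        unfolding V by linarith
      have fo: "norm (y - first_order T (eps w) (\<xi> w)) \<le> \<kappa> * r"
        using \<rho>1(2)[OF r0 r1(1) _ X(1)[of w]] eps0 epsr[OF w] \<xi>r[OF w] by (simp add: X(2) y_def)
      have "\<kappa> * r * BD = \<delta> / 4"
      proof -
        have "BD \<noteq> 0" "R \<noteq> 0" using R1 BD(1) by auto
        then show ?thesis unfolding \<kappa>_def \<delta>_def by (simp add: divide_simps)
      qed
      moreover have "norm (DE (0, y - first_order T (eps w) (\<xi> w))) \<le> norm (y - first_order T (eps w) (\<xi> w)) * BD"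
        using BD(2)[of "(0, y - first_order T (eps w) (\<xi> w))"] by (simp add: norm_Pair)
      ultimately have 2: "norm (DE (0, y - first_order T (eps w) (\<xi> w))) \<le> \<delta> / 4"
        using mult_right_mono[OF fo less_imp_le[OF BD(1)]] by linarith
      define x0 x1 x2 x3 where "x0 = E (V w) - E (Xs a, Xs b)" and "x1 = DE (\<xi> w, y)"
        and "x2 = DE (\<xi> w, first_order T (eps w) (\<xi> w))" and "x3 = DE (0, y - first_order T (eps w) (\<xi> w))"
      have "x1 = x2 + x3"
        unfolding x1_def x2_def x3_def
        using linear_add[OF lin, of "(\<xi> w, first_order T (eps w) (\<xi> w))" "(0, y - first_order T (eps w) (\<xi> w))"] by simp
      moreover have "x2 + s w *\<^sub>R e = w"
        unfolding x2_def DE_first by (rule sol)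
      then have "x0 + s w *\<^sub>R e - w = x0 - x2"
        by (metis add_diff_cancel_right)
      ultimately have "F w - w = (x0 - x1) + x3"
        unfolding F_def x0_def[symmetric] by simp
      then show ?thesis
        using norm_triangle_mono[OF 1 2] unfolding x0_def[symmetric] x1_def[symmetric] x3_def[symmetric] by simp
    qed
    have contV: "continuous_on (cball 0 \<delta>) V"
    proof -
      have lipXb: "norm (X w b - X w' b) \<le> CL * (R + real (card T) * R) * norm (w - w')"
        if w: "norm w \<le> \<delta>" "norm w' \<le> \<delta>" for w w'
      proof -
        have "norm (X w b - X w' b) \<le> CL * (norm (X w a - X w' a) + (\<Sum>p\<in>T. \<bar>eps w p - eps w' p\<bar>))"
        proof (rule CL(2)[OF X(1) X(1) eps0 eps0])
          show "eps w' p \<le> 1" if "p \<in> T" for p using epsr[OF w(2) that] rle(6) by linarith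
          show "norm (X w' a - Xs a) \<le> 1" using \<xi>r[OF w(2)] rle(6) X(2) by simp
          show "b \<in> {a..b}" using ab by simp
        qed
        also have "\<dots> \<le> CL * (R * norm (w - w') + real (card T) * (R * norm (w - w')))"
          using CL(1) \<xi>lip[of w w'] sum_bounded_above[of T "\<lambda>p. \<bar>eps w p - eps w' p\<bar>" "R * norm (w - w')"] epslip X(2)
          by (intro mult_left_mono add_mono) auto
        finally show ?thesis by (simp add: algebra_simps)
      qed
      have "continuous_on (cball 0 \<delta>) (\<lambda>w. X w b)"
        by (rule lipschitz_on_continuous_on[where L = "CL * (R + real (card T) * R)"], rule lipschitz_onI)
           (use lipXb CL(1) R1 in \<open>auto simp: dist_norm\<close>)
      moreover have "continuous_on (cball 0 \<delta>) (\<lambda>w. X w a)"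
        by (rule lipschitz_on_continuous_on[where L = R], rule lipschitz_onI)
           (use \<xi>lip R1 X(2) in \<open>auto simp: dist_norm\<close>)
      ultimately show ?thesis
        unfolding V_def by (intro continuous_on_Pair)
    qed
    have "continuous_on (cball 0 \<delta>) s"
      unfolding s_def c_def by (intro continuous_intros)
    moreover have "continuous_on (cball 0 \<delta>) (\<lambda>w. E (V w))"
      by (rule continuous_on_compose2[OF Econt contV])
         (use Vnear r2(2) in \<open>fastforce simp: dist_norm norm_minus_commute\<close>)
    ultimately have contF: "continuous_on (cball 0 \<delta>) F"
      unfolding F_def by (intro continuous_intros)
    obtain w where w: "w \<in> cball 0 \<delta>" "w - F w - (\<delta> / 2) *\<^sub>R e = w"
    proof (rule brouwer_ball[OF \<delta>0, of 0 "\<lambda>w. w - F w - (\<delta> / 2) *\<^sub>R e"])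
      show "continuous_on (cball 0 \<delta>) (\<lambda>w. w - F w - (\<delta> / 2) *\<^sub>R e)"
        by (intro continuous_intros contF)
      show "(\<lambda>w. w - F w - (\<delta> / 2) *\<^sub>R e) \<in> cball 0 \<delta> \<rightarrow> cball 0 \<delta>"
      proof
        fix w :: 'f assume "w \<in> cball 0 \<delta>"
        then have "norm (w - F w) \<le> \<delta> / 2" using Fw[of w] by (simp add: norm_minus_commute)
        moreover have "norm ((\<delta> / 2) *\<^sub>R e) \<le> \<delta> / 2"
          using e \<delta>0 mult_left_mono[of "norm e" 1 "\<delta> / 2"] by simp
        ultimately have "norm (w - F w - (\<delta> / 2) *\<^sub>R e) \<le> \<delta>"
          using norm_triangle_le_diff[of "w - F w" "(\<delta> / 2) *\<^sub>R e" \<delta>] by linarith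
        then show "w - F w - (\<delta> / 2) *\<^sub>R e \<in> cball 0 \<delta>" by simp
      qed
    qed blast
    then have wn: "norm w \<le> \<delta>" and Fe: "F w = - ((\<delta> / 2) *\<^sub>R e)" by (auto simp: algebra_simps eq_neg_iff_add_eq_0)
    have move: "x + z = y - v" if "x - y + z = - v" for x y z v :: 'f
    proof -
      have "x + z = (x - y + z) + y" by simp
      then show ?thesis unfolding that by simp
    qed
    have E1: "E (X w a, X w b) + s w *\<^sub>R e = E (Xs a, Xs b) - (\<delta> / 2) *\<^sub>R e"
      by (rule move[OF Fe[unfolded F_def V_def]])
    have E2: "E (X w a, X w b) + s w *\<^sub>R e \<noteq> E (Xs a, Xs b) - (\<delta> / 2) *\<^sub>R e"
    proof (rule \<eta>(2)[THEN spec[of _ idx], THEN spec[of _ r], THEN spec[of _ "eps w"], THEN spec[of _ "X w"],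
          THEN spec[of _ "s w"], THEN spec[of _ "\<delta> / 2"], THEN mp], intro conjI)
      have epsrw: "\<forall>p\<in>T. eps w p \<le> r" using epsr[OF wn] by blast
      have sep: "(\<forall>p\<in>T. slot idx r (eps w) p \<subseteq> {a..b}) \<and>
          (\<forall>p\<in>T. \<forall>q\<in>T. p \<noteq> q \<longrightarrow> slot idx r (eps w) p \<inter> slot idx r (eps w) q = {})"
        by (rule \<rho>2(2)[THEN spec, THEN spec, THEN mp]) (intro conjI r0 r1(2) epsrw)
      show "\<forall>p\<in>T. slot idx r (eps w) p \<subseteq> {a..b}"
        "\<forall>p\<in>T. \<forall>q\<in>T. p \<noteq> q \<longrightarrow> slot idx r (eps w) p \<inter> slot idx r (eps w) q = {}"
        by (rule sep[THEN conjunct1], rule sep[THEN conjunct2])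
      show "trajectory T idx r (eps w) (X w)" by (rule X(1))
      show "0 \<le> s w" by (rule s0)
      show "\<forall>t\<in>{a..b}. norm (X w t - Xs t) \<le> \<eta>"
      proof
        fix t assume "t \<in> {a..b}"
        from near[OF wn this] have "norm (X w t - Xs t) \<le> C * r" .
        moreover have "C * r \<le> (1 + C) * r" using r0 by (simp add: distrib_right)
        ultimately show "norm (X w t - Xs t) \<le> \<eta>"
          using r2(3) by linarith
      qed
      show "0 < \<delta> / 2" using \<delta>0 by simp
    qed
    show False by (rule notE[OF E2 E1])
  qed
  have K0: "0 \<in> K"
    by (rule KI[of "{}" "\<lambda>_. 0" 0 _ 0]) (use linear_0[OF lin\<Lambda>] in auto)
  have Kadd: "x + y \<in> K" if x: "x \<in> K" and y: "y \<in> K" for x y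
  proof -
    obtain T1 eps1 \<xi>1 s1 where "Q x T1 eps1 \<xi>1 s1" using x unfolding K_def by blast
    note 1 = QD[OF this]
    obtain T2 eps2 \<xi>2 s2 where "Q y T2 eps2 \<xi>2 s2" using y unfolding K_def by blast
    note 2 = QD[OF this]
    define eps where "eps = (\<lambda>p. (if p \<in> T1 then eps1 p else 0) + (if p \<in> T2 then eps2 p else 0))"
    have "x + y = (\<Sum>p\<in>T1 \<union> T2. eps p *\<^sub>R G p) + \<Lambda> (\<xi>1 + \<xi>2) + (s1 + s2) *\<^sub>R e"
      unfolding arg_cong2[where f = "(+)", OF 1(5) 2(5)] \<Lambda>_add eps_def scaleR_add_left sum.distrib
        extend[OF finite_UnI[OF 1(1) 2(1)] Un_upper1] extend[OF finite_UnI[OF 1(1) 2(1)] Un_upper2]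
      by simp
    then show ?thesis
      by (rule KI[rotated 4]) (use 1(1-4) 2(1-4) in \<open>auto simp: eps_def\<close>)
  qed
  have Kscale: "c *\<^sub>R x \<in> K" if c: "0 \<le> c" and x: "x \<in> K" for c x
  proof -
    obtain T eps \<xi> s where "Q x T eps \<xi> s" using x unfolding K_def by blast
    note 1 = QD[OF this]
    have "c *\<^sub>R x = (\<Sum>p\<in>T. (c * eps p) *\<^sub>R G p) + \<Lambda> (c *\<^sub>R \<xi>) + (c * s) *\<^sub>R e"
      unfolding arg_cong[where f = "scaleR c", OF 1(5)] \<Lambda>_scale by (simp add: scaleR_add_right scaleR_sum_right)
    then show ?thesis
      by (rule KI[rotated 4]) (use 1(1-4) c in auto)
  qed
  obtain \<mu> where \<mu>0: "\<mu> \<noteq> 0" and \<mu>: "\<And>v. v \<in> K \<Longrightarrow> 0 \<le> \<mu> \<bullet> v"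
    using cone_separation[OF K0 Kadd Kscale \<open>K \<noteq> UNIV\<close>] by blast
  have \<mu>e: "0 \<le> \<mu> \<bullet> e"
  proof (rule \<mu>)
    show "e \<in> K"
      by (rule KI[of "{}" "\<lambda>_. 0" 1 _ 0]) (use linear_0[OF lin\<Lambda>] in auto)
  qed
  have \<mu>\<Lambda>: "\<mu> \<bullet> \<Lambda> \<xi> = 0" for \<xi>
  proof -
    have "0 \<le> \<mu> \<bullet> \<Lambda> \<xi>" for \<xi>
    proof (rule \<mu>)
      show "\<Lambda> \<xi> \<in> K"
        by (rule KI[of "{}" "\<lambda>_. 0" 0 _ \<xi>]) auto
    qed
    from this[of \<xi>] this[of "- \<xi>"] show ?thesis
      by (simp add: linear_neg[OF lin\<Lambda>])
  qed
  have \<mu>G: "0 \<le> \<mu> \<bullet> G (t, n)" if "regular_time t" for t n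
  proof (rule \<mu>)
    show "G (t, n) \<in> K"
      by (rule KI[of "{(t, n)}" "\<lambda>_. 1" 0 _ 0]) (use that linear_0[OF lin\<Lambda>] in auto)
  qed
  define q where "q = adjoint (\<lambda>y. DE (0, y)) \<mu>"
  have q: "q \<bullet> y = \<mu> \<bullet> DE (0, y)" for y
    using adjoint_works[OF lin0, of y \<mu>] by (simp add: q_def inner_commute)
  obtain P where P: "continuous_on {a..b} P" "\<forall>t\<in>{a..b}. P t = P b + integral {t..b} (\<lambda>s. adjoint (A s) (P s))"
    "\<And>t y. P t \<bullet> y = q \<bullet> transfer t y" "P b = q"
    using costate_combination[of q] by blast
  have Pa: "P a \<bullet> \<xi> = - (\<mu> \<bullet> DE (\<xi>, 0))" for \<xi>
    using \<mu>\<Lambda>[of \<xi>] unfolding P(3) q \<Lambda>_def DE_split[of \<xi> "transfer a \<xi>"] by (simp add: inner_add_right)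
  obtain N where N: "negligible N" "\<forall>t\<in>{a..<b} - N. regular_time t"
    using regular_time_ae by blast
  have "\<forall>t\<in>{a..<b} - N. \<forall>n. 0 \<le> P t \<bullet> D n t (Xs t)"
    using N(2) \<mu>G unfolding P(3) q by (auto simp: G_def needle_effect_def)
  then show ?thesis
    using \<mu>0 \<mu>e P(1,2) Pa N(1) q P(4) by blast
qed

end

subsection \<open>Data along a tube\<close>

lemma AE_lebesgue_on_interval:
  "(AE t in lebesgue_on {a..b::real}. P t) \<longleftrightarrow> (\<exists>N. negligible N \<and> (\<forall>t\<in>{a..b} - N. P t))"
proof -
  have "(AE t in lebesgue_on {a..b}. P t) \<longleftrightarrow> (AE t in lebesgue. t \<in> {a..b} \<longrightarrow> P t)"
    by (rule AE_restrict_space_iff) simp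
  also have "\<dots> \<longleftrightarrow> (\<exists>N. negligible N \<and> (\<forall>t\<in>{a..b} - N. P t))"
    unfolding eventually_ae_filter negligible_iff_null_sets by (auto simp: subset_eq Bex_def) 
  finally show ?thesis .
qed

lemma transpose_jacobian_inner:
  fixes F :: "real^'n \<Rightarrow> real^'k"
  assumes "(F has_derivative F') (at x)"
  shows "(transpose (jacobian F (at x)) *v p) \<bullet> y = p \<bullet> F' y"
proof -
  have "F' = frechet_derivative F (at x)"
    using assms by (rule frechet_derivative_at)
  moreover have "linear F'"
    using assms has_derivative_linear by blast
  ultimately have "jacobian F (at x) *v y = F' y"
    unfolding jacobian_def by (simp add: matrix_works)
  then show ?thesis
    by (simp add: transpose_matrix_vector dot_lmul_matrix)
qed

lemma gradient_inner:
  fixes F :: "'a::euclidean_space \<Rightarrow> real"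
  assumes "(F has_derivative F') (at x)"
  shows "gradient F x \<bullet> y = F' y"
proof -
  have lin: "linear F'" using assms has_derivative_linear by blast
  define d where "d = adjoint F' 1"
  have d: "y \<bullet> d = F' y" for y
    using adjoint_works[OF lin, of y 1] by (simp add: d_def)
  have "(F has_derivative (\<lambda>h. h \<bullet> d)) (at x)" using assms by (simp add: d)
  then have g: "GDERIV F x :> d" by (simp add: gderiv_def)
  have "gradient F x = d"
    unfolding gradient_def
  proof (rule the_equality)
    show "GDERIV F x :> d" by (rule g)
    fix d' assume "GDERIV F x :> d'"
    then have "(\<lambda>h. h \<bullet> d') = (\<lambda>h. h \<bullet> d)"
      using g unfolding gderiv_def by (rule has_derivative_unique)
    then have "h \<bullet> (d' - d) = 0" for h by (simp add: inner_diff_right fun_eq_iff)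
    then show "d' = d" by (metis inner_eq_zero_iff right_minus_eq)
  qed
  then show ?thesis using d[of y] by (simp add: inner_commute)
qed

lemma abs_continuous_imp_continuous:
  fixes F :: "real \<Rightarrow> 'a::real_normed_vector"
  assumes "abs_continuous_on_interval a b F"
  shows "continuous_on {a..b} F"
  unfolding continuous_on_iff
proof (intro ballI allI impI)
  fix s e :: real assume s: "s \<in> {a..b}" and "e > 0"
  then obtain \<delta> where "\<delta> > 0" and \<delta>: "\<And>D S. D division_of S \<Longrightarrow> S \<subseteq> {a..b} \<Longrightarrow> (\<Sum>K\<in>D. Sup K - Inf K) < \<delta> \<Longrightarrow>
        (\<Sum>K\<in>D. norm (F (Sup K) - F (Inf K))) < e"
    using assms unfolding abs_continuous_on_interval_def by metis
  have *: "norm (F v - F u) < e" if "u \<le> v" "u \<in> {a..b}" "v \<in> {a..b}" "v - u < \<delta>" for u v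
  proof -
    have "{{u..v}} division_of {u..v}"
      using that division_of_self[of u v] by (simp add: box_real)
    from \<delta>[OF this] show ?thesis using that by simp
  qed
  show "\<exists>d>0. \<forall>t\<in>{a..b}. dist t s < d \<longrightarrow> dist (F t) (F s) < e"
  proof (intro exI[of _ \<delta>] conjI ballI impI \<open>\<delta> > 0\<close>)
    fix t assume "t \<in> {a..b}" "dist t s < \<delta>"
    then show "dist (F t) (F s) < e"
      using *[of s t] *[of t s] s by (cases "s \<le> t") (auto simp: dist_norm norm_minus_commute)
  qed
qed

lemma abs_continuous_subinterval:
  "abs_continuous_on_interval a b F \<Longrightarrow> {c..d} \<subseteq> {a..b} \<Longrightarrow> abs_continuous_on_interval c d F"
  unfolding abs_continuous_on_interval_def by (meson order_trans)

lemma abs_continuous_eq_integral: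
  fixes F :: "real \<Rightarrow> 'a::euclidean_space"
  assumes "abs_continuous_on_interval a b F" "negligible N"
    and "\<And>t. t \<in> {a..b} - N \<Longrightarrow> (F has_vector_derivative g t) (at t within {a..b})" and t: "t \<in> {a..b}"
  shows "F t = F a + integral {a..t} g"
proof -
  have "(g has_integral (F t - F a)) {a..t}"
  proof (rule has_integral_abs_continuous[OF _ _ assms(2)])
    show "abs_continuous_on_interval a t F"
      by (rule abs_continuous_subinterval[OF assms(1)]) (use t in auto)
    show "(F has_vector_derivative g u) (at u within {a..t})" if "u \<in> {a..t} - N" for u
      by (rule has_vector_derivative_within_subset[OF assms(3)]) (use t that in auto)
  qed (use t in auto)
  then show ?thesis by (simp add: integral_unique)
qed

lemma compact_tube:
  fixes xs :: "real \<Rightarrow> 'a::euclidean_space"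
  assumes "continuous_on {a..b} xs"
  shows "compact (tube a b xs \<gamma>)"
proof -
  have "tube a b xs \<gamma> = (\<lambda>(t, y). (t, xs t + y)) ` ({a..b} \<times> cball 0 \<gamma>)"
  proof
    show "tube a b xs \<gamma> \<subseteq> (\<lambda>(t, y). (t, xs t + y)) ` ({a..b} \<times> cball 0 \<gamma>)"
    proof
      fix z assume "z \<in> tube a b xs \<gamma>"
      then obtain t x where "z = (t, x)" "t \<in> {a..b}" "norm (x - xs t) \<le> \<gamma>" by (auto simp: tube_def)
      then show "z \<in> (\<lambda>(t, y). (t, xs t + y)) ` ({a..b} \<times> cball 0 \<gamma>)"
        by (intro image_eqI[of _ _ "(t, x - xs t)"]) auto
    qed
  qed (auto simp: tube_def)
  moreover have "continuous_on ({a..b} \<times> cball 0 \<gamma>) (\<lambda>(t, y). (t, xs t + y))"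
    unfolding split_beta
    by (intro continuous_intros continuous_on_compose2[OF assms continuous_on_fst]) auto
  ultimately show ?thesis
    by (simp only:) (intro compact_continuous_image compact_Times compact_Icc compact_cball)
qed

definition tube_C1 :: "real \<Rightarrow> real \<Rightarrow> (real \<Rightarrow> 'a::euclidean_space) \<Rightarrow> real \<Rightarrow> 'b::euclidean_space set \<Rightarrow>
    (real \<Rightarrow> 'a \<Rightarrow> 'b \<Rightarrow> 'c::euclidean_space) \<Rightarrow> (real \<Rightarrow> 'a \<Rightarrow> 'b \<Rightarrow> 'a \<Rightarrow>\<^sub>L 'c) \<Rightarrow> real \<Rightarrow> bool" where
  "tube_C1 a b xs \<gamma> U1 G G' B \<longleftrightarrow> B \<ge> 0 \<and>
    continuous_on (tube a b xs \<gamma> \<times> U1) (\<lambda>((t, x), u). G t x u) \<and>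
    continuous_on (tube a b xs \<gamma> \<times> U1) (\<lambda>((t, x), u). G' t x u) \<and>
    (\<forall>t\<in>{a..b}. \<forall>u\<in>U1. \<forall>x. norm (x - xs t) \<le> \<gamma> \<longrightarrow>
       norm (G' t x u) \<le> B \<and> ((\<lambda>y. G t y u) has_derivative blinfun_apply (G' t x u)) (at x)) \<and>
    (\<forall>t\<in>{a..b}. \<forall>u\<in>U1. \<forall>x y. norm (x - xs t) \<le> \<gamma> \<longrightarrow> norm (y - xs t) \<le> \<gamma> \<longrightarrow>
       norm (G t x u - G t y u) \<le> B * norm (x - y)) \<and>
    (\<forall>e>0. \<exists>d>0. \<forall>t\<in>{a..b}. \<forall>u\<in>U1. \<forall>y. norm y \<le> d \<longrightarrow>
       norm (G t (xs t + y) u - G t (xs t) u - blinfun_apply (G' t (xs t) u) y) \<le> e * norm y)"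

lemma tube_C1D:
  assumes "tube_C1 a b xs \<gamma> U1 G G' B"
  shows "B \<ge> 0"
    and "continuous_on (tube a b xs \<gamma> \<times> U1) (\<lambda>((t, x), u). G t x u)"
    and "continuous_on (tube a b xs \<gamma> \<times> U1) (\<lambda>((t, x), u). G' t x u)"
    and "t \<in> {a..b} \<Longrightarrow> u \<in> U1 \<Longrightarrow> norm (x - xs t) \<le> \<gamma> \<Longrightarrow> norm (G' t x u) \<le> B"
    and "t \<in> {a..b} \<Longrightarrow> u \<in> U1 \<Longrightarrow> norm (x - xs t) \<le> \<gamma> \<Longrightarrow>
       ((\<lambda>y. G t y u) has_derivative blinfun_apply (G' t x u)) (at x)"
    and "t \<in> {a..b} \<Longrightarrow> u \<in> U1 \<Longrightarrow> norm (x - xs t) \<le> \<gamma> \<Longrightarrow> norm (y - xs t) \<le> \<gamma> \<Longrightarrow>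
       norm (G t x u - G t y u) \<le> B * norm (x - y)"
    and "e > 0 \<Longrightarrow> \<exists>d>0. \<forall>t\<in>{a..b}. \<forall>u\<in>U1. \<forall>y. norm y \<le> d \<longrightarrow>
       norm (G t (xs t + y) u - G t (xs t) u - blinfun_apply (G' t (xs t) u) y) \<le> e * norm y"
  using assms unfolding tube_C1_def by blast+

lemma tube_regularity:
  fixes G :: "real \<Rightarrow> 'a::euclidean_space \<Rightarrow> 'b::euclidean_space \<Rightarrow> 'c::euclidean_space"
  assumes xs: "continuous_on {a..b} xs" and U1: "compact U1" and \<gamma>: "\<gamma> > 0"
    and diff: "unif_x_differentiable_on (tube a b xs \<gamma> \<times> U1) G"
  shows "\<exists>G' B. tube_C1 a b xs \<gamma> U1 G G' B"
proof -
  define S where "S = tube a b xs \<gamma> \<times> U1"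
  have S: "compact S" unfolding S_def by (intro compact_Times compact_tube xs U1)
  obtain G' :: "real \<Rightarrow> 'a \<Rightarrow> 'b \<Rightarrow> 'a \<Rightarrow>\<^sub>L 'c" where
    uG: "uniformly_continuous_on S (\<lambda>((t, x), u). G t x u)" and
    dG0: "\<forall>((t, x), u) \<in> S. ((\<lambda>y. G t y u) has_derivative blinfun_apply (G' t x u)) (at x)" and
    uG': "uniformly_continuous_on S (\<lambda>((t, x), u). G' t x u)"
    using diff unfolding unif_x_differentiable_on_def S_def[symmetric] by (elim conjE exE)
  have memS: "((t, x), u) \<in> S" if "t \<in> {a..b}" "u \<in> U1" "norm (x - xs t) \<le> \<gamma>" for t x u
    using that by (auto simp: S_def tube_def)
  have dG: "((\<lambda>y. G t y u) has_derivative blinfun_apply (G' t x u)) (at x)"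
    if "t \<in> {a..b}" "u \<in> U1" "norm (x - xs t) \<le> \<gamma>" for t x u
    using bspec[OF dG0 memS[OF that]] by simp
  have cG': "continuous_on S (\<lambda>((t, x), u). G' t x u)"
    by (rule uniformly_continuous_imp_continuous[OF uG'])
  have "bounded ((\<lambda>((t, x), u). G' t x u) ` S)"
    by (intro compact_imp_bounded compact_continuous_image cG' S)
  then obtain B0 where B0: "\<And>z. z \<in> S \<Longrightarrow> norm ((\<lambda>((t, x), u). G' t x u) z) \<le> B0"
    unfolding bounded_iff by blast
  define B where "B = max B0 0"
  have B: "norm (G' t x u) \<le> B" if "t \<in> {a..b}" "u \<in> U1" "norm (x - xs t) \<le> \<gamma>" for t x u
    using B0[OF memS[OF that]] by (simp add: B_def)
  have convex_ball: "{x. norm (x - xs t) \<le> r} = cball (xs t) r" for t r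
    by (auto simp: dist_norm norm_minus_commute)
  show ?thesis
    unfolding tube_C1_def
  proof (intro exI[of _ G'] exI[of _ B] conjI)
    show "B \<ge> 0" by (simp add: B_def)
    show "continuous_on (tube a b xs \<gamma> \<times> U1) (\<lambda>((t, x), u). G t x u)"
      unfolding S_def[symmetric] by (rule uniformly_continuous_imp_continuous[OF uG])
    show "continuous_on (tube a b xs \<gamma> \<times> U1) (\<lambda>((t, x), u). G' t x u)"
      unfolding S_def[symmetric] by (rule cG')
    show "\<forall>t\<in>{a..b}. \<forall>u\<in>U1. \<forall>x. norm (x - xs t) \<le> \<gamma> \<longrightarrow>
       norm (G' t x u) \<le> B \<and> ((\<lambda>y. G t y u) has_derivative blinfun_apply (G' t x u)) (at x)"
      using B dG by blast
    have lip: "norm (G t x u - G t y u) \<le> B * norm (x - y)"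
      if t: "t \<in> {a..b}" "u \<in> U1" "norm (x - xs t) \<le> \<gamma>" "norm (y - xs t) \<le> \<gamma>" for t u x y
    proof (rule differentiable_bound[where S = "{x. norm (x - xs t) \<le> \<gamma>}" and f' = "\<lambda>x. blinfun_apply (G' t x u)"])
      show "convex {x. norm (x - xs t) \<le> \<gamma>}" unfolding convex_ball by (rule convex_cball)
      fix x assume "x \<in> {x. norm (x - xs t) \<le> \<gamma>}"
      then have x: "norm (x - xs t) \<le> \<gamma>" by simp
      show "((\<lambda>y. G t y u) has_derivative blinfun_apply (G' t x u)) (at x within {x. norm (x - xs t) \<le> \<gamma>})"
        by (rule has_derivative_at_withinI[OF dG[OF t(1,2) x]])
      show "onorm (blinfun_apply (G' t x u)) \<le> B"
        using B[OF t(1,2) x] by (simp add: norm_blinfun.rep_eq)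
    qed (use t in auto)
    show "\<forall>t\<in>{a..b}. \<forall>u\<in>U1. \<forall>x y. norm (x - xs t) \<le> \<gamma> \<longrightarrow> norm (y - xs t) \<le> \<gamma> \<longrightarrow>
       norm (G t x u - G t y u) \<le> B * norm (x - y)"
      using lip by blast
    have rem: "\<exists>d>0. \<forall>t\<in>{a..b}. \<forall>u\<in>U1. \<forall>y. norm y \<le> d \<longrightarrow>
       norm (G t (xs t + y) u - G t (xs t) u - blinfun_apply (G' t (xs t) u) y) \<le> e * norm y"
      if "e > 0" for e
    proof -
    from \<open>e > 0\<close> obtain d where d: "d > 0" and d': "\<forall>z\<in>S. \<forall>z'\<in>S. dist z' z < d \<longrightarrow>
        dist ((\<lambda>((t, x), u). G' t x u) z') ((\<lambda>((t, x), u). G' t x u) z) < e"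
      using spec[OF uG'[unfolded uniformly_continuous_on_def], of e] by (elim impE exE conjE)
    show ?thesis
    proof (intro exI[of _ "min \<gamma> (d / 2)"] conjI ballI allI impI)
      show "min \<gamma> (d / 2) > 0" using \<gamma> d by simp
      fix t u and y :: 'a assume t: "t \<in> {a..b}" "u \<in> U1" and y: "norm y \<le> min \<gamma> (d / 2)"
      define W where "W = {x. norm (x - xs t) \<le> min \<gamma> (d / 2)}"
      have W: "norm (x - xs t) \<le> \<gamma>" "norm (x - xs t) < d" if "x \<in> W" for x
        using that d by (auto simp: W_def)
      have "norm (G t (xs t + y) u - G t (xs t) u - blinfun_apply (G' t (xs t) u) (xs t + y - xs t)) \<le> norm (xs t + y - xs t) * e"
      proof (rule differentiable_bound_linearization[where S = W and f' = "\<lambda>x. blinfun_apply (G' t x u)"])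
        show "xs t + s *\<^sub>R (xs t + y - xs t) \<in> W" if "s \<in> {0..1}" for s
        proof -
          have "norm (s *\<^sub>R y) \<le> 1 * norm y" using that by (simp add: mult_left_le_one_le)
          then show ?thesis using y by (simp add: W_def)
        qed
        show "xs t \<in> W" using \<gamma> d by (simp add: W_def)
        fix x assume x: "x \<in> W"
        show "((\<lambda>y. G t y u) has_derivative blinfun_apply (G' t x u)) (at x within W)"
          by (rule has_derivative_at_withinI[OF dG[OF t W(1)[OF x]]])
        have "norm (xs t - xs t) \<le> \<gamma>" using \<gamma> by simp
        from bspec[OF bspec[OF d' memS[OF t this]] memS[OF t W(1)[OF x]]]
        have "dist (G' t x u) (G' t (xs t) u) < e"
          using W(2)[OF x] by (simp add: dist_Pair_Pair dist_norm)
        then show "onorm (blinfun_apply (G' t x u) - blinfun_apply (G' t (xs t) u)) \<le> e"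
          by (simp add: dist_norm norm_blinfun.rep_eq minus_blinfun.rep_eq fun_diff_def)
      qed
      then show "norm (G t (xs t + y) u - G t (xs t) u - blinfun_apply (G' t (xs t) u) y) \<le> e * norm y"
        by (simp add: mult.commute)
    qed
    qed
    show "\<forall>e>0. \<exists>d>0. \<forall>t\<in>{a..b}. \<forall>u\<in>U1. \<forall>y. norm y \<le> d \<longrightarrow>
       norm (G t (xs t + y) u - G t (xs t) u - blinfun_apply (G' t (xs t) u) y) \<le> e * norm y"
      using rem by blast
  qed
qed

lemma bmeas_compose_continuous:
  fixes F :: "'a::euclidean_space \<Rightarrow> 'c::euclidean_space"
  assumes S: "compact S" and F: "continuous_on S F"
    and h: "h \<in> borel_measurable (lebesgue_on {a..b})" "\<And>t. t \<in> {a..b} \<Longrightarrow> h t \<in> S"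
  shows "bmeas a b (\<lambda>t. F (h t))"
proof -
  have "bounded (F ` S)"
    by (intro compact_imp_bounded compact_continuous_image F S)
  then obtain C where C: "\<And>z. z \<in> S \<Longrightarrow> norm (F z) \<le> C" unfolding bounded_iff by blast
  have "(\<lambda>z. indicator S z *\<^sub>R F z) \<in> borel_measurable borel"
    using S F by (intro borel_measurable_continuous_on_indicator) (auto intro: borel_closed compact_imp_closed)
  then have "(\<lambda>t. indicator S (h t) *\<^sub>R F (h t)) \<in> borel_measurable (lebesgue_on {a..b})"
    using h(1) by (rule measurable_compose[rotated])
  then have "(\<lambda>t. F (h t)) \<in> borel_measurable (lebesgue_on {a..b})"
    by (rule measurable_cong[THEN iffD1, rotated]) (use h(2) in simp)
  then show ?thesis
    by (rule bmeasI[where C = C]) (use C h(2) in blast)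
qed

lemma lebesgue_on_interval_pair_measurable:
  fixes x :: "real \<Rightarrow> 'a::euclidean_space" and c :: "real \<Rightarrow> 'b::euclidean_space"
  assumes "continuous_on {a..b} x" "c \<in> borel_measurable (lebesgue_on {a..b})"
  shows "(\<lambda>t. ((t, x t), c t)) \<in> borel_measurable (lebesgue_on {a..b})"
  by (intro borel_measurable_Pair assms(2) bmeas_measurable[OF bmeas_continuous] continuous_on_Pair
      continuous_on_id assms(1))

text \<open>Composing the dynamics with this retraction makes them globally Lipschitz in the state.\<close>

definition retract_tube :: "(real \<Rightarrow> 'a::euclidean_space) \<Rightarrow> real \<Rightarrow> real \<Rightarrow> 'a \<Rightarrow> 'a" where
  "retract_tube xs \<gamma> t x = xs t + closest_point (cball 0 \<gamma>) (x - xs t)"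

lemma retract_tube_in: "\<gamma> > 0 \<Longrightarrow> norm (retract_tube xs \<gamma> t x - xs t) \<le> \<gamma>"
  using closest_point_in_set[of "cball (0::'a::euclidean_space) \<gamma>" "x - xs t"] by (simp add: retract_tube_def)

lemma retract_tube_self: "norm (x - xs t) \<le> \<gamma> \<Longrightarrow> retract_tube xs \<gamma> t x = x"
  by (simp add: retract_tube_def closest_point_self)

lemma retract_tube_lipschitz:
  "\<gamma> > 0 \<Longrightarrow> norm (retract_tube xs \<gamma> t x - retract_tube xs \<gamma> t y) \<le> norm (x - y)"
  using closest_point_lipschitz[of "cball (0::'a::euclidean_space) \<gamma>" "x - xs t" "y - xs t"]
  by (simp add: retract_tube_def dist_norm)

lemma retract_tube_continuous:
  assumes "\<gamma> > 0" "continuous_on S xs" "continuous_on S x"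
  shows "continuous_on S (\<lambda>t. retract_tube xs \<gamma> t (x t))"
proof -
  have "continuous_on UNIV (closest_point (cball (0::'a) \<gamma>))"
    by (rule continuous_on_closest_point) (use assms(1) in auto)
  then show ?thesis
    unfolding retract_tube_def using assms
    by (intro continuous_intros) (auto intro: continuous_on_compose2 continuous_on_diff)
qed

subsection \<open>The control system as a needle variation\<close>

lemma lebesgue_on_interval_measurable_If:
  fixes f g :: "real \<Rightarrow> 'a::euclidean_space"
  assumes "f \<in> borel_measurable (lebesgue_on {a..b})" "g \<in> borel_measurable (lebesgue_on {a..b})" "A \<in> sets lebesgue"
  shows "(\<lambda>t. if t \<in> A then f t else g t) \<in> borel_measurable (lebesgue_on {a..b})"
  by (rule measurable_If_set[OF assms(1,2)])
     (use assms(3) in \<open>auto simp: sets_restrict_space_iff intro: sets.Int\<close>)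

lemma bounded_control_representative:
  fixes us :: "real \<Rightarrow> 'u::euclidean_space"
  assumes "Linf_on a b us" "AE t in lebesgue_on {a..b}. us t \<in> U" "U \<noteq> {}"
  obtains us' C N where "negligible N" "\<And>t. t \<in> {a..b} - N \<Longrightarrow> us' t = us t"
    "us' \<in> borel_measurable (lebesgue_on {a..b})" "\<And>t. us' t \<in> U" "\<And>t. norm (us' t) \<le> C"
proof -
  obtain u0 where u0: "u0 \<in> U" using assms(3) by blast
  obtain C where C: "AE t in lebesgue_on {a..b}. norm (us t) \<le> C"
    using assms(1) unfolding Linf_on_def by blast
  obtain N1 where N1: "negligible N1" "\<forall>t\<in>{a..b} - N1. norm (us t) \<le> C"
    using C unfolding AE_lebesgue_on_interval by blast
  obtain N2 where N2: "negligible N2" "\<forall>t\<in>{a..b} - N2. us t \<in> U"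
    using assms(2) unfolding AE_lebesgue_on_interval by blast
  define A where "A = {a..b} - (N1 \<union> N2)"
  have A: "A \<in> sets lebesgue"
    unfolding A_def using negligible_imp_sets[OF negligible_Un[OF N1(1) N2(1)]] by (intro sets.Diff) auto
  show ?thesis
  proof (rule that[of "N1 \<union> N2" "\<lambda>t. if t \<in> A then us t else u0" "max C (norm u0)"])
    show "negligible (N1 \<union> N2)" using N1(1) N2(1) by simp
    show "(\<lambda>t. if t \<in> A then us t else u0) \<in> borel_measurable (lebesgue_on {a..b})"
      by (rule lebesgue_on_interval_measurable_If[OF _ _ A]) (use assms(1) in \<open>auto simp: Linf_on_def\<close>)
    show "(if t \<in> A then us t else u0) \<in> U" for t
      using N2(2) u0 by (auto simp: A_def)
    show "norm (if t \<in> A then us t else u0) \<le> max C (norm u0)" for t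
      using N1(2) by (auto simp: A_def intro: le_max_iff_disj[THEN iffD2])
  qed (auto simp: A_def)
qed

lemma primitive_properties:
  fixes X :: "real \<Rightarrow> 'a::euclidean_space"
  assumes k: "bmeas a b k" and X: "\<And>t. t \<in> {a..b} \<Longrightarrow> X t = c + integral {a..t} k"
  shows "W1inf_on a b X"
    and "AE t in lebesgue_on {a..b}. (X has_vector_derivative k t) (at t within {a..b})"
proof -
  obtain C where C: "\<And>t. t \<in> {a..b} \<Longrightarrow> norm (k t) \<le> C"
    using bmeas_bound[OF k] by blast
  obtain N where N: "negligible N"
    "\<And>t. t \<in> {a..b} - N \<Longrightarrow> ((\<lambda>t. integral {a..t} k) has_vector_derivative k t) (at t within {a..b})"
    using lebesgue_differentiation[OF k] by blast
  show ae: "AE t in lebesgue_on {a..b}. (X has_vector_derivative k t) (at t within {a..b})"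
    unfolding AE_lebesgue_on_interval
  proof (intro exI[of _ N] conjI ballI N(1))
    fix t assume t: "t \<in> {a..b} - N"
    have "((\<lambda>t. c + integral {a..t} k) has_vector_derivative 0 + k t) (at t within {a..b})"
      by (intro derivative_intros N(2) t)
    then have "((\<lambda>t. c + integral {a..t} k) has_vector_derivative k t) (at t within {a..b})"
      by simp
    then show "(X has_vector_derivative k t) (at t within {a..b})"
      by (rule has_vector_derivative_transform[OF _ X, rotated 2]) (use t in auto)
  qed
  have "abs_continuous_on_interval a b X"
  proof (rule lipschitz_imp_abs_continuous)
    fix s t assume st: "s \<in> {a..b}" "t \<in> {a..b}"
    have "X t - X s = integral {a..t} k - integral {a..s} k"
      unfolding X[OF st(1)] X[OF st(2)] by simp
    then show "norm (X t - X s) \<le> C * \<bar>t - s\<bar>"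
      using integral_lipschitz[OF k C st] by simp
  qed
  moreover have "Linf_on a b k"
    unfolding Linf_on_def AE_lebesgue_on_interval using k C
    by (intro conjI bmeas_measurable exI[of _ C] exI[of _ "{}"]) auto
  ultimately show "W1inf_on a b X"
    unfolding W1inf_on_def using ae by blast
qed

lemma bmeas_linear_image:
  fixes F :: "'a::euclidean_space \<Rightarrow> 'b::euclidean_space"
  assumes "bmeas a b k" "bounded_linear F"
  shows "bmeas a b (\<lambda>t. F (k t))"
proof -
  obtain C where C: "C \<ge> 0" "\<And>t. t \<in> {a..b} \<Longrightarrow> norm (k t) \<le> C"
    using bmeas_bound[OF assms(1)] by blast
  obtain K where K: "K > 0" "\<And>x. norm (F x) \<le> norm x * K"
    using bounded_linear.pos_bounded[OF assms(2)] by blast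
  have "(\<lambda>t. F (k t)) \<in> borel_measurable (lebesgue_on {a..b})"
    using bmeas_measurable[OF assms(1)] borel_measurable_continuous_onI[OF linear_continuous_on[OF assms(2)]]
    by (rule measurable_compose)
  moreover have "norm (F (k t)) \<le> C * K" if "t \<in> {a..b}" for t
    using order_trans[OF K(2) mult_right_mono[OF C(2)[OF that]]] K(1) by simp
  ultimately show ?thesis by (rule bmeasI)
qed

lemma primitive_linear_image:
  fixes F :: "'a::euclidean_space \<Rightarrow> 'b::euclidean_space"
  assumes k: "bmeas a b k" and X: "\<And>t. t \<in> {a..b} \<Longrightarrow> X t = c + integral {a..t} k" and F: "bounded_linear F"
    and t: "t \<in> {a..b}"
  shows "F (X t) = F c + integral {a..t} (\<lambda>s. F (k s))"
proof -
  have "k integrable_on {a..t}"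
    by (rule bmeas_integrable_sub[OF k]) (use t in auto)
  then show ?thesis
    using integral_linear[of k "{a..t}" F] F unfolding X[OF t]
    by (simp add: o_def linear_add[OF bounded_linear.linear[OF F]])
qed

definition truncated :: "(real \<Rightarrow> 'x::euclidean_space) \<Rightarrow> real \<Rightarrow> (real \<Rightarrow> 'x \<Rightarrow> 'u \<Rightarrow> 'x) \<Rightarrow>
    (real \<Rightarrow> 'x \<Rightarrow> 'u \<Rightarrow> real) \<Rightarrow> (real \<Rightarrow> 'u) \<Rightarrow> real \<Rightarrow> 'x \<times> real \<Rightarrow> 'x \<times> real" where
  "truncated xs \<gamma> \<phi> f c t X =
     (\<phi> t (retract_tube xs \<gamma> t (fst X)) (c t), f t (retract_tube xs \<gamma> t (fst X)) (c t))"

lemma truncated_in_tube: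
  "norm (fst X - xs t) \<le> \<gamma> \<Longrightarrow> truncated xs \<gamma> \<phi> f c t X = (\<phi> t (fst X) (c t), f t (fst X) (c t))"
  by (simp add: truncated_def retract_tube_self)

lemma truncated_measurable:
  fixes xs :: "real \<Rightarrow> 'x::euclidean_space" and c :: "real \<Rightarrow> 'u::euclidean_space"
  assumes xs: "continuous_on {a..b} xs" and U1: "compact U1" and \<gamma>: "\<gamma> > 0"
    and \<phi>: "continuous_on (tube a b xs \<gamma> \<times> U1) (\<lambda>((t, x), u). \<phi> t x u)"
    and f: "continuous_on (tube a b xs \<gamma> \<times> U1) (\<lambda>((t, x), u). f t x u)"
    and c: "c \<in> borel_measurable (lebesgue_on {a..b})" "\<And>t. t \<in> {a..b} \<Longrightarrow> c t \<in> U1"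
    and X: "continuous_on {a..b} X"
  shows "bmeas a b (\<lambda>t. truncated xs \<gamma> \<phi> f c t (X t))"
proof -
  define F where "F = (\<lambda>((t, x), u). (\<phi> t x u, f t x u))"
  define h where "h = (\<lambda>t. ((t, retract_tube xs \<gamma> t (fst (X t))), c t))"
  have "continuous_on (tube a b xs \<gamma> \<times> U1) F"
    unfolding F_def using continuous_on_Pair[OF \<phi> f] by (simp add: split_beta)
  moreover have "h \<in> borel_measurable (lebesgue_on {a..b})"
    unfolding h_def
    by (intro lebesgue_on_interval_pair_measurable retract_tube_continuous \<gamma> xs continuous_on_fst X c)
  moreover have "h t \<in> tube a b xs \<gamma> \<times> U1" if "t \<in> {a..b}" for t
    using that retract_tube_in[OF \<gamma>] c(2) by (auto simp: h_def tube_def)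
  ultimately have "bmeas a b (\<lambda>t. F (h t))"
    by (intro bmeas_compose_continuous[OF compact_Times[OF compact_tube[OF xs] U1]])
  then show ?thesis by (simp add: F_def h_def truncated_def)
qed

lemma truncated_lipschitz:
  fixes xs :: "real \<Rightarrow> 'x::euclidean_space"
  assumes \<gamma>: "\<gamma> > 0" and B: "B1 \<ge> 0" "B2 \<ge> 0"
    and \<phi>: "\<And>x y. norm (x - xs t) \<le> \<gamma> \<Longrightarrow> norm (y - xs t) \<le> \<gamma> \<Longrightarrow> norm (\<phi> t x (c t) - \<phi> t y (c t)) \<le> B1 * norm (x - y)"
    and f: "\<And>x y. norm (x - xs t) \<le> \<gamma> \<Longrightarrow> norm (y - xs t) \<le> \<gamma> \<Longrightarrow> norm (f t x (c t) - f t y (c t)) \<le> B2 * norm (x - y)"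
  shows "norm (truncated xs \<gamma> \<phi> f c t X - truncated xs \<gamma> \<phi> f c t Y) \<le> (B1 + B2) * norm (X - Y)"
proof -
  define x y where "x = retract_tube xs \<gamma> t (fst X)" and "y = retract_tube xs \<gamma> t (fst Y)"
  have xy: "norm (x - xs t) \<le> \<gamma>" "norm (y - xs t) \<le> \<gamma>"
    unfolding x_def y_def by (rule retract_tube_in[OF \<gamma>])+
  have "norm (x - y) \<le> norm (fst X - fst Y)"
    unfolding x_def y_def by (rule retract_tube_lipschitz[OF \<gamma>])
  also have "\<dots> \<le> norm (X - Y)"
    by (metis fst_diff norm_fst_le prod.collapse)
  finally have le: "norm (x - y) \<le> norm (X - Y)" .
  have "norm (truncated xs \<gamma> \<phi> f c t X - truncated xs \<gamma> \<phi> f c t Y)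
      \<le> norm (\<phi> t x (c t) - \<phi> t y (c t)) + norm (f t x (c t) - f t y (c t))"
    unfolding truncated_def x_def[symmetric] y_def[symmetric]
    using norm_Pair_le[of "\<phi> t x (c t) - \<phi> t y (c t)" "f t x (c t) - f t y (c t)"] by simp
  also have "\<dots> \<le> B1 * norm (x - y) + B2 * norm (x - y)"
    by (intro add_mono \<phi> f xy)
  also have "\<dots> = (B1 + B2) * norm (x - y)" by (simp add: distrib_right)
  also have "\<dots> \<le> (B1 + B2) * norm (X - Y)"
    using B le by (intro mult_left_mono) auto
  finally show ?thesis .
qed

lemma admissible_from_integral_equation:
  fixes X :: "real \<Rightarrow> (real^'n) \<times> real" and u :: "real \<Rightarrow> real^'m"
  assumes k: "bmeas t0 t1 (\<lambda>s. (\<phi> s (fst (X s)) (u s), f s (fst (X s)) (u s)))"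
    and X: "\<And>t. t \<in> {t0..t1} \<Longrightarrow> X t = X t0 + integral {t0..t} (\<lambda>s. (\<phi> s (fst (X s)) (u s), f s (fst (X s)) (u s)))"
    and u: "bmeas t0 t1 u" "\<And>t. u t \<in> U" and "h0 (fst (X t0)) = 0" "h1 (fst (X t1)) = 0" and t01: "t0 \<le> t1"
  shows "admissible t0 t1 f \<phi> h0 h1 U (\<lambda>t. fst (X t)) u"
    and "cost t0 t1 f (\<lambda>t. fst (X t)) u = snd (X t1) - snd (X t0)"
proof -
  define k where "k = (\<lambda>s. (\<phi> s (fst (X s)) (u s), f s (fst (X s)) (u s)))"
  have km: "bmeas t0 t1 k" using k by (simp add: k_def)
  have Xk: "\<And>t. t \<in> {t0..t1} \<Longrightarrow> X t = X t0 + integral {t0..t} k"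
    unfolding k_def by (rule X)
  have f_eq: "(\<lambda>s. snd (k s)) = (\<lambda>s. f s (fst (X s)) (u s))" and p_eq: "(\<lambda>s. fst (k s)) = (\<lambda>s. \<phi> s (fst (X s)) (u s))"
    by (simp_all add: k_def)
  have fm: "bmeas t0 t1 (\<lambda>s. f s (fst (X s)) (u s))" and pm: "bmeas t0 t1 (\<lambda>s. \<phi> s (fst (X s)) (u s))"
    using bmeas_linear_image[OF km bounded_linear_snd] bmeas_linear_image[OF km bounded_linear_fst]
    by (simp_all only: f_eq p_eq)
  obtain C where C: "\<And>t. t \<in> {t0..t1} \<Longrightarrow> norm (f t (fst (X t)) (u t)) \<le> C"
    using bmeas_bound[OF fm] by blast
  have fi: "integrable (lebesgue_on {t0..t1}) (\<lambda>t. f t (fst (X t)) (u t))"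
  proof (rule finite_measure.integrable_const_bound[OF finite_measure_lebesgue_on])
    show "AE t in lebesgue_on {t0..t1}. norm (f t (fst (X t)) (u t)) \<le> C"
      using C by (intro AE_I2) simp
  qed (use bmeas_measurable[OF fm] in auto)
  have xeq: "fst (X t) = fst (X t0) + integral {t0..t} (\<lambda>s. \<phi> s (fst (X s)) (u s))" if "t \<in> {t0..t1}" for t
    using primitive_linear_image[OF km Xk bounded_linear_fst that] unfolding p_eq .
  obtain Cu where "\<And>t. t \<in> {t0..t1} \<Longrightarrow> norm (u t) \<le> Cu"
    using bmeas_bound[OF u(1)] by blast
  then have "AE t in lebesgue_on {t0..t1}. norm (u t) \<le> Cu"
    by (intro AE_I2) simp
  then have "Linf_on t0 t1 u"
    unfolding Linf_on_def using bmeas_measurable[OF u(1)] by blast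
  then show "admissible t0 t1 f \<phi> h0 h1 U (\<lambda>t. fst (X t)) u"
    unfolding admissible_def
    using primitive_properties[OF pm xeq] u(2) fi assms(5,6) by auto
  have "cost t0 t1 f (\<lambda>t. fst (X t)) u = integral {t0..t1} (\<lambda>t. f t (fst (X t)) (u t))"
    unfolding cost_def by (rule lebesgue_integral_eq_integral[OF fi]) simp
  then show "cost t0 t1 f (\<lambda>t. fst (X t)) u = snd (X t1) - snd (X t0)"
    using primitive_linear_image[OF km Xk bounded_linear_snd, of t1] t01 unfolding f_eq by simp
qed

lemma tube_C1_endpoint:
  assumes h: "tube_C1 a b xs \<gamma> U1 (\<lambda>t x u. h x) h' B" and t: "t \<in> {a..b}" and u: "u \<in> U1" and \<gamma>: "\<gamma> > 0"
  shows "(h has_derivative blinfun_apply (h' t (xs t) u)) (at (xs t))" and "continuous_on (cball (xs t) \<gamma>) h"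
proof -
  show "(h has_derivative blinfun_apply (h' t (xs t) u)) (at (xs t))"
    by (rule tube_C1D(5)[OF h t u]) (use \<gamma> in simp)
  have "norm (h x - h y) \<le> B * norm (x - y)" if "x \<in> cball (xs t) \<gamma>" "y \<in> cball (xs t) \<gamma>" for x y
    by (rule tube_C1D(6)[OF h t u]) (use that in \<open>simp_all add: dist_norm norm_minus_commute\<close>)
  then show "continuous_on (cball (xs t) \<gamma>) h"
    by (intro lipschitz_on_continuous_on[where L = B] lipschitz_onI tube_C1D(1)[OF h]) (simp add: dist_norm)
qed

lemma sum_disjoint_indicator:
  fixes w :: "'i \<Rightarrow> 'a::real_vector"
  assumes "finite T" "\<And>p q. p \<in> T \<Longrightarrow> q \<in> T \<Longrightarrow> p \<noteq> q \<Longrightarrow> S p \<inter> S q = {}" "p \<in> T" "t \<in> S p"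
  shows "(\<Sum>q\<in>T. indicat_real (S q) t *\<^sub>R w q) = w p"
proof -
  have "(\<Sum>q\<in>T. indicat_real (S q) t *\<^sub>R w q) = (\<Sum>q\<in>{p}. indicat_real (S q) t *\<^sub>R w q)"
    using assms by (intro sum.mono_neutral_right) (auto simp: indicator_def)
  then show ?thesis using assms(4) by simp
qed

lemma sum_outside_indicator:
  fixes w :: "'i \<Rightarrow> 'a::real_vector"
  assumes "\<And>q. q \<in> T \<Longrightarrow> t \<notin> S q"
  shows "(\<Sum>q\<in>T. indicat_real (S q) t *\<^sub>R w q) = 0"
  using assms by (intro sum.neutral) auto

theorem theorem5p5:
  fixes t0 t1 :: real
    and f :: "real \<Rightarrow> real^'n \<Rightarrow> real^'m \<Rightarrow> real"
    and \<phi> :: "real \<Rightarrow> real^'n \<Rightarrow> real^'m \<Rightarrow> real^'n"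
    and h0 :: "real^'n \<Rightarrow> real^'s0"
    and h1 :: "real^'n \<Rightarrow> real^'s1"
    and U :: "(real^'m) set"
    and xs :: "real \<Rightarrow> real^'n"
    and us :: "real \<Rightarrow> real^'m"
  assumes "t0 < t1"
    and "U \<noteq> {}"
    and "regular_along t0 t1 f \<phi> h0 h1 xs"
    and "strong_local_minimum t0 t1 f \<phi> h0 h1 U xs us"
  shows "\<exists>(lam0::real) (p :: real \<Rightarrow> real^'n) (l0 :: real^'s0) (l1 :: real^'s1).
    lam0 \<ge> 0 \<and> W1inf_on t0 t1 p \<and>
    \<not> (lam0 = 0 \<and> (\<forall>t\<in>{t0..t1}. p t = 0) \<and> l0 = 0 \<and> l1 = 0) \<and>
    (AE t in lebesgue_on {t0..t1}.
       (p has_vector_derivative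
          (- (transpose (jacobian (\<lambda>x. \<phi> t x (us t)) (at (xs t))) *v p t)
           + lam0 *\<^sub>R gradient (\<lambda>x. f t x (us t)) (xs t))) (at t within {t0..t1})) \<and>
    p t0 = transpose (jacobian h0 (at (xs t0))) *v l0 \<and>
    p t1 = - (transpose (jacobian h1 (at (xs t1))) *v l1) \<and>
    (AE t in lebesgue_on {t0..t1}.
       us t \<in> U \<and>
       (\<forall>v\<in>U. pontryagin f \<phi> t (xs t) v (p t) lam0 \<le> pontryagin f \<phi> t (xs t) (us t) (p t) lam0))"
proof -
  note t01 = assms(1)
  have adm: "admissible t0 t1 f \<phi> h0 h1 U xs us"
    using assms(4) unfolding strong_local_minimum_def by blast
  obtain eps0 where eps0: "eps0 > 0" and optimal: "\<And>x u. admissible t0 t1 f \<phi> h0 h1 U x u \<Longrightarrow>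
      sup_dist_on t0 t1 x xs \<le> eps0 \<Longrightarrow> cost t0 t1 f xs us \<le> cost t0 t1 f x u"
    using assms(4) unfolding strong_local_minimum_def by blast
  have xs_ac: "abs_continuous_on_interval t0 t1 xs" and us_Linf: "Linf_on t0 t1 us"
    and us_U: "AE t in lebesgue_on {t0..t1}. us t \<in> U"
    and xs_ode: "AE t in lebesgue_on {t0..t1}. (xs has_vector_derivative \<phi> t (xs t) (us t)) (at t within {t0..t1})"
    and bc: "h0 (xs t0) = 0" "h1 (xs t1) = 0"
    and cost_int: "integrable (lebesgue_on {t0..t1}) (\<lambda>t. f t (xs t) (us t))"
    using adm unfolding admissible_def W1inf_on_def by blast+
  have xs_cont: "continuous_on {t0..t1} xs" by (rule abs_continuous_imp_continuous[OF xs_ac])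
  obtain us' C N where N: "negligible N" and us': "\<And>t. t \<in> {t0..t1} - N \<Longrightarrow> us' t = us t"
    "us' \<in> borel_measurable (lebesgue_on {t0..t1})" "\<And>t. us' t \<in> U" and us'_C: "\<And>t. norm (us' t) \<le> C"
    using bounded_control_representative[OF us_Linf us_U assms(2)] by metis
  have C0: "C \<ge> 0" using us'_C[of 0] norm_ge_zero order_trans by blast

  obtain V where V: "countable V" "V \<subseteq> U" "U \<subseteq> closure V" using separable[of U] by blast
  have "V \<noteq> {}" using V(3) assms(2) by auto
  define v where "v = from_nat_into V"
  have rv: "range v = V" unfolding v_def by (rule range_from_nat_into[OF \<open>V \<noteq> {}\<close> V(1)])
  have vU: "v n \<in> U" for n using rv V(2) by blast

  have reg: "\<exists>\<gamma>>0. unif_x_differentiable_on (tube t0 t1 xs \<gamma> \<times> U1) f \<and>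
          unif_x_differentiable_on (tube t0 t1 xs \<gamma> \<times> U1) \<phi> \<and>
          unif_x_differentiable_on (tube t0 t1 xs \<gamma> \<times> U1) (\<lambda>t x u. h0 x) \<and>
          unif_x_differentiable_on (tube t0 t1 xs \<gamma> \<times> U1) (\<lambda>t x u. h1 x)" if "compact U1" for U1 :: "(real^'m) set"
    using assms(3) that unfolding regular_along_def by blast

  define U0 where "U0 = cball (0 :: real^'m) C"
  have U0: "compact U0" "us' t \<in> U0" "0 \<in> U0" for t
    using us'_C C0 by (auto simp: U0_def)
  obtain \<gamma>0 where \<gamma>0: "\<gamma>0 > 0" and reg_f: "unif_x_differentiable_on (tube t0 t1 xs \<gamma>0 \<times> U0) f"
    and reg_\<phi>: "unif_x_differentiable_on (tube t0 t1 xs \<gamma>0 \<times> U0) \<phi>"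
    and reg_h0: "unif_x_differentiable_on (tube t0 t1 xs \<gamma>0 \<times> U0) (\<lambda>t x u. h0 x)"
    and reg_h1: "unif_x_differentiable_on (tube t0 t1 xs \<gamma>0 \<times> U0) (\<lambda>t x u. h1 x)"
    using reg[OF U0(1)] by (elim exE conjE)
  obtain f' Bf where "tube_C1 t0 t1 xs \<gamma>0 U0 f f' Bf"
    using tube_regularity[OF xs_cont U0(1) \<gamma>0 reg_f] by (elim exE)
  note f_tube = tube_C1D[OF this]
  obtain \<phi>' B\<phi> where "tube_C1 t0 t1 xs \<gamma>0 U0 \<phi> \<phi>' B\<phi>"
    using tube_regularity[OF xs_cont U0(1) \<gamma>0 reg_\<phi>] by (elim exE)
  note \<phi>_tube = tube_C1D[OF this]
  note Bf = f_tube(1) and B\<phi> = \<phi>_tube(1)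
  note f_cont = f_tube(2) and \<phi>_cont = \<phi>_tube(2) and f'_cont = f_tube(3) and \<phi>'_cont = \<phi>_tube(3)
  note f_lip = f_tube(6) and \<phi>_lip = \<phi>_tube(6) and f_diff = f_tube(7) and \<phi>_diff = \<phi>_tube(7)

  define g where "g = truncated xs \<gamma>0 \<phi> f us'"
  define A where "A = (\<lambda>t (Y :: (real^'n) \<times> real). (blinfun_apply (\<phi>' t (xs t) (us' t)) (fst Y), blinfun_apply (f' t (xs t) (us' t)) (fst Y)))"
  have xs_tube: "norm (xs t - xs t) \<le> \<gamma>0" for t using \<gamma>0 by simp

  define W where "W = (\<lambda>n. cball (0 :: real^'m) (max C (norm (v n))))"
  have W: "compact (W n)" "us' t \<in> W n" "v n \<in> W n" for n t
    using us'_C by (auto simp: W_def intro: le_max_iff_disj[THEN iffD2])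
  define Q where "Q = (\<lambda>n \<gamma> B. \<gamma> > 0 \<and> B \<ge> 0 \<and>
      continuous_on (tube t0 t1 xs \<gamma> \<times> W n) (\<lambda>((t, x), u). \<phi> t x u) \<and>
      continuous_on (tube t0 t1 xs \<gamma> \<times> W n) (\<lambda>((t, x), u). f t x u) \<and>
      (\<forall>t\<in>{t0..t1}. \<forall>u\<in>W n. \<forall>x y. norm (x - xs t) \<le> \<gamma> \<longrightarrow> norm (y - xs t) \<le> \<gamma> \<longrightarrow>
         norm (\<phi> t x u - \<phi> t y u) \<le> B * norm (x - y) \<and> norm (f t x u - f t y u) \<le> B * norm (x - y)))"
  have "\<forall>n. \<exists>\<gamma> B. Q n \<gamma> B"
  proof
    fix n
    obtain \<gamma> where \<gamma>: "\<gamma> > 0" "unif_x_differentiable_on (tube t0 t1 xs \<gamma> \<times> W n) f"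
      "unif_x_differentiable_on (tube t0 t1 xs \<gamma> \<times> W n) \<phi>"
      using reg[OF W(1)[of n]] by blast
    obtain B1 f1 where "tube_C1 t0 t1 xs \<gamma> (W n) f f1 B1"
      using tube_regularity[OF xs_cont W(1) \<gamma>(1,2)] by (elim exE)
    note B1 = tube_C1D(1,2,6)[OF this]
    obtain B2 f2 where "tube_C1 t0 t1 xs \<gamma> (W n) \<phi> f2 B2"
      using tube_regularity[OF xs_cont W(1) \<gamma>(1,3)] by (elim exE)
    note B2 = tube_C1D(1,2,6)[OF this]
    have "norm (\<phi> t x u - \<phi> t y u) \<le> max B1 B2 * norm (x - y) \<and> norm (f t x u - f t y u) \<le> max B1 B2 * norm (x - y)"
      if "t \<in> {t0..t1}" "u \<in> W n" "norm (x - xs t) \<le> \<gamma>" "norm (y - xs t) \<le> \<gamma>" for t u x y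
      by (intro conjI order_trans[OF B2(3)[OF that] mult_right_mono] order_trans[OF B1(3)[OF that] mult_right_mono]) simp_all
    then have "Q n \<gamma> (max B1 B2)"
      unfolding Q_def using \<gamma>(1) B1(1,2) B2(2) by (intro conjI) auto
    then show "\<exists>\<gamma> B. Q n \<gamma> B" by blast
  qed
  from choice[OF this] obtain \<gamma> where "\<forall>n. \<exists>B. Q n (\<gamma> n) B" ..
  from choice[OF this] obtain B where Q: "\<forall>n. Q n (\<gamma> n) (B n)" ..
  have \<gamma>: "\<And>n. \<gamma> n > 0" and B: "\<And>n. B n \<ge> 0"
    and \<phi>W: "\<And>n. continuous_on (tube t0 t1 xs (\<gamma> n) \<times> W n) (\<lambda>((t, x), u). \<phi> t x u)"
    and fW: "\<And>n. continuous_on (tube t0 t1 xs (\<gamma> n) \<times> W n) (\<lambda>((t, x), u). f t x u)"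
    and lipW: "\<And>n t u x y. t \<in> {t0..t1} \<Longrightarrow> u \<in> W n \<Longrightarrow> norm (x - xs t) \<le> \<gamma> n \<Longrightarrow> norm (y - xs t) \<le> \<gamma> n \<Longrightarrow>
         norm (\<phi> t x u - \<phi> t y u) \<le> B n * norm (x - y) \<and> norm (f t x u - f t y u) \<le> B n * norm (x - y)"
    using Q unfolding Q_def by blast+
  define D where "D = (\<lambda>n t X. truncated xs (\<gamma> n) \<phi> f (\<lambda>_. v n) t X - truncated xs (\<gamma> n) \<phi> f us' t X)"

  have g_meas: "bmeas t0 t1 (\<lambda>t. g t (X t))" if "continuous_on {t0..t1} X" for X
    unfolding g_def by (rule truncated_measurable[OF xs_cont U0(1) \<gamma>0 \<phi>_cont f_cont us'(2) U0(2) that])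
  have D_meas: "bmeas t0 t1 (\<lambda>t. D n t (X t))" if "continuous_on {t0..t1} X" for n X
    unfolding D_def
    by (intro bmeas_diff truncated_measurable[OF xs_cont W(1) \<gamma> \<phi>W fW _ _ that] us'(2) W(2) W(3) borel_measurable_const)
  have xsc: "continuous_on {t0..t1} (\<lambda>t. (xs t, 0 :: real))"
    by (intro continuous_intros xs_cont)
  have g_xs: "g t (xs t, r) = (\<phi> t (xs t) (us' t), f t (xs t) (us' t))" for t r
    unfolding g_def by (subst truncated_in_tube) (use \<gamma>0 in auto)
  have k_meas: "bmeas t0 t1 (\<lambda>t. (\<phi> t (xs t) (us' t), f t (xs t) (us' t)))"
    using g_meas[OF xsc] unfolding g_xs .
  define Xs where "Xs = (\<lambda>t. (xs t, integral {t0..t} (\<lambda>s. f s (xs s) (us' s))))"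
  have f_meas: "bmeas t0 t1 (\<lambda>t. f t (xs t) (us' t))"
    using bmeas_linear_image[OF k_meas bounded_linear_snd] by simp
  have xs_eq: "xs t = xs t0 + integral {t0..t} (\<lambda>s. \<phi> s (xs s) (us' s))" if t: "t \<in> {t0..t1}" for t
  proof -
    obtain N2 where N2: "negligible N2" "\<forall>t\<in>{t0..t1} - N2. (xs has_vector_derivative \<phi> t (xs t) (us t)) (at t within {t0..t1})"
      using xs_ode unfolding AE_lebesgue_on_interval by blast
    show ?thesis
    proof (rule abs_continuous_eq_integral[OF xs_ac _ _ t])
      show "negligible (N \<union> N2)" using N N2(1) by simp
      show "(xs has_vector_derivative \<phi> t (xs t) (us' t)) (at t within {t0..t1})" if "t \<in> {t0..t1} - (N \<union> N2)" for t
        using bspec[OF N2(2), of t] us'(1)[of t] that by simp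
    qed
  qed
  have Xs_cont: "continuous_on {t0..t1} Xs"
    unfolding Xs_def by (intro continuous_on_Pair xs_cont indefinite_integral_continuous_1 bmeas_integrable f_meas)
  have Xs_eq: "Xs t = Xs t0 + integral {t0..t} (\<lambda>s. g s (Xs s))" if t: "t \<in> {t0..t1}" for t
  proof -
    have "(\<lambda>s. g s (Xs s)) = (\<lambda>s. (\<phi> s (xs s) (us' s), f s (xs s) (us' s)))"
      unfolding Xs_def g_xs ..
    moreover have "integral {t0..t} (\<lambda>s. (\<phi> s (xs s) (us' s), f s (xs s) (us' s)))
        = (integral {t0..t} (\<lambda>s. \<phi> s (xs s) (us' s)), integral {t0..t} (\<lambda>s. f s (xs s) (us' s)))"
      (is "integral _ ?k = _")
    proof -
      have "?k integrable_on {t0..t}"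
        by (rule bmeas_integrable_sub[OF k_meas]) (use t in auto)
      from integral_linear[OF this bounded_linear_fst] integral_linear[OF this bounded_linear_snd]
      show ?thesis by (simp add: o_def prod_eq_iff)
    qed
    ultimately show ?thesis
      unfolding Xs_def using xs_eq[OF t] by simp
  qed

  interpret nv: needle_variation t0 t1 g D A Xs "B\<phi> + Bf" "\<lambda>n. (B n + B n) + (B n + B n)"
  proof (rule needle_variation.intro)
    show "t0 < t1" by (rule t01)
    show "0 \<le> B\<phi> + Bf" using B\<phi> Bf by simp
    show "0 \<le> (B n + B n) + (B n + B n)" for n using B[of n] by simp
    show "continuous_on {t0..t1} Xs" by (rule Xs_cont)
    show "Xs t = Xs t0 + integral {t0..t} (\<lambda>s. g s (Xs s))" if "t \<in> {t0..t1}" for t by (rule Xs_eq[OF that])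
    show "bmeas t0 t1 (\<lambda>t. g t (x t))" if "continuous_on {t0..t1} x" for x by (rule g_meas[OF that])
    show "bmeas t0 t1 (\<lambda>t. D n t (x t))" if "continuous_on {t0..t1} x" for x n by (rule D_meas[OF that])
    show "norm (g t x1 - g t x2) \<le> (B\<phi> + Bf) * norm (x1 - x2)" if t: "t \<in> {t0..t1}" for t x1 x2
      unfolding g_def
    proof (rule truncated_lipschitz[OF \<gamma>0 B\<phi> Bf])
      show "norm (\<phi> t x (us' t) - \<phi> t y (us' t)) \<le> B\<phi> * norm (x - y)" "norm (f t x (us' t) - f t y (us' t)) \<le> Bf * norm (x - y)"
        if "norm (x - xs t) \<le> \<gamma>0" "norm (y - xs t) \<le> \<gamma>0" for x y
        by (rule \<phi>_lip[OF t U0(2) that], rule f_lip[OF t U0(2) that])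
    qed
    show "norm (D n t x1 - D n t x2) \<le> ((B n + B n) + (B n + B n)) * norm (x1 - x2)" if t: "t \<in> {t0..t1}" for n t x1 x2
    proof -
      have l: "norm (truncated xs (\<gamma> n) \<phi> f c t x1 - truncated xs (\<gamma> n) \<phi> f c t x2) \<le> (B n + B n) * norm (x1 - x2)"
        if c: "c t \<in> W n" for c
      proof (rule truncated_lipschitz[OF \<gamma> B B])
        show "norm (\<phi> t x (c t) - \<phi> t y (c t)) \<le> B n * norm (x - y)" "norm (f t x (c t) - f t y (c t)) \<le> B n * norm (x - y)"
          if "norm (x - xs t) \<le> \<gamma> n" "norm (y - xs t) \<le> \<gamma> n" for x y
          by (rule conjunct1[OF lipW[OF t c that]], rule conjunct2[OF lipW[OF t c that]])
      qed
      have "D n t x1 - D n t x2 = (truncated xs (\<gamma> n) \<phi> f (\<lambda>_. v n) t x1 - truncated xs (\<gamma> n) \<phi> f (\<lambda>_. v n) t x2)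
          - (truncated xs (\<gamma> n) \<phi> f us' t x1 - truncated xs (\<gamma> n) \<phi> f us' t x2)"
        unfolding D_def by simp
      then have "norm (D n t x1 - D n t x2) \<le> (B n + B n) * norm (x1 - x2) + (B n + B n) * norm (x1 - x2)"
        using norm_triangle_le_diff[OF add_mono[OF l[of "\<lambda>_. v n", OF W(3)] l[of us', OF W(2)]]] by simp
      then show ?thesis by (simp add: distrib_right)
    qed
    show "linear (A t)" if "t \<in> {t0..t1}" for t
      unfolding A_def by (rule linearI) (simp_all add: blinfun.add_right blinfun.scaleR_right)
    show "norm (A t y) \<le> (B\<phi> + Bf) * norm y" if t: "t \<in> {t0..t1}" for t y
    proof -
      have "norm (A t y) \<le> norm (blinfun_apply (\<phi>' t (xs t) (us' t)) (fst y)) + norm (blinfun_apply (f' t (xs t) (us' t)) (fst y))"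
        unfolding A_def by (rule norm_Pair_le)
      also have "\<dots> \<le> norm (\<phi>' t (xs t) (us' t)) * norm (fst y) + norm (f' t (xs t) (us' t)) * norm (fst y)"
        by (intro add_mono norm_blinfun)
      also have "\<dots> \<le> B\<phi> * norm y + Bf * norm y"
        using \<phi>_tube(4)[OF t U0(2) xs_tube] f_tube(4)[OF t U0(2) xs_tube] norm_fst_le[of "fst y" "snd y"] B\<phi> Bf
        by (intro add_mono mult_mono) auto
      finally show ?thesis by (simp add: distrib_right)
    qed
    show "bmeas t0 t1 (\<lambda>t. A t y)" for y
    proof -
      have h: "(\<lambda>t. ((t, xs t), us' t)) \<in> borel_measurable (lebesgue_on {t0..t1})"
        by (rule lebesgue_on_interval_pair_measurable[OF xs_cont us'(2)])
      have hS: "((t, xs t), us' t) \<in> tube t0 t1 xs \<gamma>0 \<times> U0" if "t \<in> {t0..t1}" for t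
        using that \<gamma>0 U0(2) by (simp add: tube_def)
      have "continuous_on (tube t0 t1 xs \<gamma>0 \<times> U0) (\<lambda>z. (blinfun_apply ((\<lambda>((t, x), u). \<phi>' t x u) z) (fst y), blinfun_apply ((\<lambda>((t, x), u). f' t x u) z) (fst y)))"
        by (intro continuous_on_Pair bounded_bilinear.continuous_on[OF bounded_bilinear_blinfun_apply]
            \<phi>'_cont f'_cont continuous_on_const)
      from bmeas_compose_continuous[OF compact_Times[OF compact_tube[OF xs_cont] U0(1)] this h hS]
      show ?thesis by (simp add: A_def)
    qed
    fix e :: real assume "0 < e"
    then have e2: "e / 2 > 0" by simp
    obtain d1 where d1: "d1 > 0" "\<forall>t\<in>{t0..t1}. \<forall>u\<in>U0. \<forall>y. norm y \<le> d1 \<longrightarrow>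
       norm (\<phi> t (xs t + y) u - \<phi> t (xs t) u - blinfun_apply (\<phi>' t (xs t) u) y) \<le> e / 2 * norm y"
      using \<phi>_diff[OF e2] by blast
    obtain d2 where d2: "d2 > 0" "\<forall>t\<in>{t0..t1}. \<forall>u\<in>U0. \<forall>y. norm y \<le> d2 \<longrightarrow>
       norm (f t (xs t + y) u - f t (xs t) u - blinfun_apply (f' t (xs t) u) y) \<le> e / 2 * norm y"
      using f_diff[OF e2] by blast
    show "\<exists>d>0. \<forall>t\<in>{t0..t1}. \<forall>y. norm y \<le> d \<longrightarrow> norm (g t (Xs t + y) - g t (Xs t) - A t y) \<le> e * norm y"
    proof (intro exI[of _ "min \<gamma>0 (min d1 d2)"] conjI ballI allI impI)
      show "0 < min \<gamma>0 (min d1 d2)" using \<gamma>0 d1(1) d2(1) by simp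
      fix t and Y :: "(real^'n) \<times> real" assume t: "t \<in> {t0..t1}" and Y: "norm Y \<le> min \<gamma>0 (min d1 d2)"
      define y where "y = fst Y"
      have yY: "norm y \<le> norm Y" using norm_fst_le[of "fst Y" "snd Y"] by (simp add: y_def)
      have gX: "g t (Xs t) = (\<phi> t (xs t) (us' t), f t (xs t) (us' t))"
        unfolding Xs_def by (rule g_xs)
      have gY: "g t (Xs t + Y) = (\<phi> t (xs t + y) (us' t), f t (xs t + y) (us' t))"
        unfolding g_def by (subst truncated_in_tube) (use yY Y in \<open>auto simp: Xs_def y_def\<close>)
      have "norm (g t (Xs t + Y) - g t (Xs t) - A t Y)
          \<le> norm (\<phi> t (xs t + y) (us' t) - \<phi> t (xs t) (us' t) - blinfun_apply (\<phi>' t (xs t) (us' t)) y)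
           + norm (f t (xs t + y) (us' t) - f t (xs t) (us' t) - blinfun_apply (f' t (xs t) (us' t)) y)"
        unfolding gX gY A_def y_def[symmetric] diff_Pair by (rule norm_Pair_le)
      also have "\<dots> \<le> e / 2 * norm y + e / 2 * norm y"
        by (intro add_mono d1(2)[rule_format] d2(2)[rule_format] t U0(2)) (use yY Y in auto)
      also have "\<dots> \<le> e * norm Y" using yY \<open>e > 0\<close> by simp
      finally show "norm (g t (Xs t + Y) - g t (Xs t) - A t Y) \<le> e * norm Y" .
    qed
  qed

  have t0_in: "t0 \<in> {t0..t1}" and t1_in: "t1 \<in> {t0..t1}" using t01 by auto
  obtain h0' Bh0 where h0': "tube_C1 t0 t1 xs \<gamma>0 U0 (\<lambda>t x u. h0 x) h0' Bh0"
    using tube_regularity[OF xs_cont U0(1) \<gamma>0 reg_h0] by (elim exE)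
  obtain h1' Bh1 where h1': "tube_C1 t0 t1 xs \<gamma>0 U0 (\<lambda>t x u. h1 x) h1' Bh1"
    using tube_regularity[OF xs_cont U0(1) \<gamma>0 reg_h1] by (elim exE)
  define H0 where "H0 = blinfun_apply (h0' t0 (xs t0) 0)"
  define H1 where "H1 = blinfun_apply (h1' t1 (xs t1) 0)"
  have H0: "(h0 has_derivative H0) (at (xs t0))" and h0_cont: "continuous_on (cball (xs t0) \<gamma>0) h0"
    unfolding H0_def by (rule tube_C1_endpoint[OF h0' t0_in U0(3) \<gamma>0])+
  have H1: "(h1 has_derivative H1) (at (xs t1))" and h1_cont: "continuous_on (cball (xs t1) \<gamma>0) h1"
    unfolding H1_def by (rule tube_C1_endpoint[OF h1' t1_in U0(3) \<gamma>0])+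
  define J where "J = snd (Xs t1) - snd (Xs t0)"
  define E where "E = (\<lambda>z :: ((real^'n) \<times> real) \<times> ((real^'n) \<times> real). (snd (snd z) - snd (fst z) - J, h0 (fst (fst z)), h1 (fst (snd z))))"
  define DE where "DE = (\<lambda>z :: ((real^'n) \<times> real) \<times> ((real^'n) \<times> real). (snd (snd z) - snd (fst z), H0 (fst (fst z)), H1 (fst (snd z))))"
  define e where "e = (1 :: real, 0 :: real^'s0, 0 :: real^'s1)"
  have DE: "(E has_derivative DE) (at (Xs t0, Xs t1))"
    unfolding E_def DE_def
  proof (intro has_derivative_Pair)
    show "((\<lambda>z. snd (snd z) - snd (fst z) - J) has_derivative (\<lambda>z. snd (snd z) - snd (fst z))) (at (Xs t0, Xs t1))"
      by (auto intro!: derivative_eq_intros)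
    show "((\<lambda>z. h0 (fst (fst z))) has_derivative (\<lambda>z. H0 (fst (fst z)))) (at (Xs t0, Xs t1))"
      by (rule has_derivative_compose[where g = h0]) (use H0 in \<open>auto intro!: derivative_intros simp: Xs_def\<close>)
    show "((\<lambda>z. h1 (fst (snd z))) has_derivative (\<lambda>z. H1 (fst (snd z)))) (at (Xs t0, Xs t1))"
      by (rule has_derivative_compose[where g = h1]) (use H1 in \<open>auto intro!: derivative_intros simp: Xs_def\<close>)
  qed
  have Econt: "continuous_on (cball (Xs t0, Xs t1) \<gamma>0) E"
    unfolding E_def
  proof (intro continuous_on_Pair continuous_intros)
    have "dist (xs t0) (fst (fst z)) \<le> \<gamma>0" "dist (xs t1) (fst (snd z)) \<le> \<gamma>0" if "z \<in> cball (Xs t0, Xs t1) \<gamma>0" for z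
      using that dist_fst_le[of "(Xs t0, Xs t1)" z] dist_fst_le[of "Xs t0" "fst z"]
        dist_snd_le[of "(Xs t0, Xs t1)" z] dist_fst_le[of "Xs t1" "snd z"] by (simp_all add: Xs_def)
    then show "continuous_on (cball (Xs t0, Xs t1) \<gamma>0) (\<lambda>z. h0 (fst (fst z)))"
      "continuous_on (cball (Xs t0, Xs t1) \<gamma>0) (\<lambda>z. h1 (fst (snd z)))"
      by (auto intro!: continuous_on_compose2[OF h0_cont] continuous_on_compose2[OF h1_cont] continuous_intros)
  qed
  have cost_xs: "cost t0 t1 f xs us = J"
  proof -
    have "cost t0 t1 f xs us = integral {t0..t1} (\<lambda>t. f t (xs t) (us t))"
      unfolding cost_def by (rule lebesgue_integral_eq_integral[OF cost_int]) simp
    also have "\<dots> = integral {t0..t1} (\<lambda>t. f t (xs t) (us' t))"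
      by (rule integral_spike[OF N]) (use us'(1) in simp)
    finally show ?thesis by (simp add: J_def Xs_def)
  qed
  have us'_bmeas: "bmeas t0 t1 us'" by (rule bmeasI[OF us'(2) us'_C])
  have e1: "norm e \<le> 1" by (simp add: e_def norm_Pair)
  have no_improvement: "\<exists>\<eta>>0. \<forall>idx r eps X s \<delta>.
        (\<forall>p\<in>T. nv.slot idx r eps p \<subseteq> {t0..t1}) \<and> (\<forall>p\<in>T. \<forall>q\<in>T. p \<noteq> q \<longrightarrow> nv.slot idx r eps p \<inter> nv.slot idx r eps q = {}) \<and>
        nv.trajectory T idx r eps X \<and> (\<forall>t\<in>{t0..t1}. norm (X t - Xs t) \<le> \<eta>) \<and> 0 \<le> s \<and> 0 < \<delta> \<longrightarrow>
        E (X t0, X t1) + s *\<^sub>R e \<noteq> E (Xs t0, Xs t1) - \<delta> *\<^sub>R e" if T: "finite T" for T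
  proof -
    define Q where "Q = insert eps0 (insert \<gamma>0 (\<gamma> ` snd ` T))"
    define \<eta> where "\<eta> = Min Q"
    have Q: "finite Q" "Q \<noteq> {}" "\<And>x. x \<in> Q \<Longrightarrow> x > 0"
      using T eps0 \<gamma>0 \<gamma> by (auto simp: Q_def)
    have \<eta>: "\<eta> > 0" unfolding \<eta>_def using Q by (simp add: Min_gr_iff)
    have \<eta>Q: "\<eta> \<le> x" if "x \<in> Q" for x unfolding \<eta>_def by (rule Min_le[OF Q(1) that])
    have \<eta>_le: "\<eta> \<le> eps0" "\<eta> \<le> \<gamma>0" "\<And>p. p \<in> T \<Longrightarrow> \<eta> \<le> \<gamma> (snd p)"
      by (rule \<eta>Q; simp add: Q_def)+
    have improvement_False: False
      if sub: "\<forall>p\<in>T. nv.slot idx r eps p \<subseteq> {t0..t1}"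
        and disj: "\<forall>p\<in>T. \<forall>q\<in>T. p \<noteq> q \<longrightarrow> nv.slot idx r eps p \<inter> nv.slot idx r eps q = {}"
        and tr: "nv.trajectory T idx r eps X" and near: "\<forall>t\<in>{t0..t1}. norm (X t - Xs t) \<le> \<eta>"
        and s: "0 \<le> s" and \<delta>: "0 < \<delta>" and eq: "E (X t0, X t1) + s *\<^sub>R e = E (Xs t0, Xs t1) - \<delta> *\<^sub>R e"
      for idx r eps X s \<delta>
    proof -
      note Xc = nv.trajectory_cont[OF tr]
      define S where "S = nv.slot idx r eps"
      have disjS: "S p \<inter> S q = {}" if "p \<in> T" "q \<in> T" "p \<noteq> q" for p q
        using disj that unfolding S_def by blast
      define u where "u = (\<lambda>t. if \<exists>p\<in>T. t \<in> S p then v (snd (SOME p. p \<in> T \<and> t \<in> S p)) else us' t)"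
      have u_in: "u t = v (snd p)" if "p \<in> T" "t \<in> S p" for t p
      proof -
        have "(SOME p. p \<in> T \<and> t \<in> S p) = p"
          by (rule some_equality) (use that disjS in blast)+
        then show ?thesis using that by (auto simp: u_def)
      qed
      have u_out: "u t = us' t" if "\<And>p. p \<in> T \<Longrightarrow> t \<notin> S p" for t
        using that by (auto simp: u_def)
      have uU: "u t \<in> U" for t
        using vU us'(3) by (simp add: u_def)
      have "u t = us' t + (\<Sum>p\<in>T. indicat_real (S p) t *\<^sub>R (v (snd p) - us' t))" for t
      proof (cases "\<exists>p\<in>T. t \<in> S p")
        case True
        then obtain p where p: "p \<in> T" "t \<in> S p" by blast
        have "(\<Sum>p\<in>T. indicat_real (S p) t *\<^sub>R (v (snd p) - us' t)) = v (snd p) - us' t"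
          by (rule sum_disjoint_indicator[where S = S]) (use T disjS p in blast)+
        then show ?thesis
          unfolding u_in[OF p] by simp
      next
        case False
        then show ?thesis
          using u_out[of t] sum_outside_indicator[of T t S "\<lambda>p. v (snd p) - us' t"] by auto
      qed
      then have u_eq: "u = (\<lambda>t. us' t + (\<Sum>p\<in>T. indicat_real (S p) t *\<^sub>R (v (snd p) - us' t)))"
        by (rule ext)
      have u_meas: "bmeas t0 t1 u"
        unfolding u_eq
        unfolding S_def
        by (intro bmeas_add bmeas_sum bmeas_scaleR bmeas_diff bmeas_const us'_bmeas nv.slot_meas T)

      have nearx: "norm (fst (X t) - xs t) \<le> \<eta>" if t: "t \<in> {t0..t1}" for t
      proof -
        have "norm (fst (X t - Xs t)) \<le> norm (X t - Xs t)"
          by (metis norm_fst_le prod.collapse)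
        then show ?thesis
          using bspec[OF near t] by (simp add: Xs_def)
      qed
      define k where "k = (\<lambda>t. (\<phi> t (fst (X t)) (u t), f t (fst (X t)) (u t)))"
      have pert: "nv.pert T idx r eps t (X t) = k t" if t: "t \<in> {t0..t1}" for t
      proof -
        have gX: "g t (X t) = (\<phi> t (fst (X t)) (us' t), f t (fst (X t)) (us' t))"
          unfolding g_def by (rule truncated_in_tube) (use nearx[OF t] \<eta>_le(2) in linarith)
        show ?thesis
        proof (cases "\<exists>p\<in>T. t \<in> S p")
          case True
          then obtain p where p: "p \<in> T" "t \<in> S p" by blast
          have "norm (fst (X t) - xs t) \<le> \<gamma> (snd p)"
            using nearx[OF t] \<eta>_le(3)[OF p(1)] by linarith
          then have "D (snd p) t (X t) = (\<phi> t (fst (X t)) (v (snd p)), f t (fst (X t)) (v (snd p)))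
              - (\<phi> t (fst (X t)) (us' t), f t (fst (X t)) (us' t))"
            unfolding D_def by (simp only: truncated_in_tube)
          moreover have "(\<Sum>p\<in>T. indicat_real (S p) t *\<^sub>R D (snd p) t (X t)) = D (snd p) t (X t)"
            by (rule sum_disjoint_indicator[where S = S]) (use T disjS p in blast)+
          ultimately show ?thesis
            unfolding nv.pert_def S_def[symmetric] gX k_def u_in[OF p] by simp
        next
          case False
          then have out: "t \<notin> S p" if "p \<in> T" for p using that by blast
          have ut: "u t = us' t" by (rule u_out) (rule out)
          have "(\<Sum>p\<in>T. indicat_real (S p) t *\<^sub>R D (snd p) t (X t)) = 0"
            by (rule sum_outside_indicator) (rule out)
          then show ?thesis
            unfolding nv.pert_def S_def[symmetric] gX k_def ut by simp
        qed
      qed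
      have k_bm: "bmeas t0 t1 k"
        using nv.pert_meas[OF T Xc, of idx r eps] bmeas_cong[of t0 t1 "\<lambda>t. nv.pert T idx r eps t (X t)" k] pert by blast
      have X_eq: "X t = X t0 + integral {t0..t} k" if t: "t \<in> {t0..t1}" for t
      proof -
        have "integral {t0..t} (\<lambda>s. nv.pert T idx r eps s (X s)) = integral {t0..t} k"
          by (rule integral_cong) (use pert t in auto)
        then show ?thesis using nv.trajectory_eq[OF tr t] by (simp only:)
      qed
      have "snd (X t1) - snd (X t0) - J + s = - \<delta>" and h: "h0 (fst (X t0)) = 0" "h1 (fst (X t1)) = 0"
        using eq bc by (auto simp: E_def e_def Xs_def J_def zero_prod_def)
      have adm_X: "admissible t0 t1 f \<phi> h0 h1 U (\<lambda>t. fst (X t)) u" "cost t0 t1 f (\<lambda>t. fst (X t)) u = snd (X t1) - snd (X t0)"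
        by (rule admissible_from_integral_equation; (fact k_bm[unfolded k_def] X_eq[unfolded k_def] u_meas uU h less_imp_le[OF t01])?)+
      have "sup_dist_on t0 t1 (\<lambda>t. fst (X t)) xs \<le> eps0"
        unfolding sup_dist_on_def
      proof (rule cSUP_least)
        show "norm (fst (X t) - xs t) \<le> eps0" if "t \<in> {t0..t1}" for t
          using nearx[OF that] \<eta>_le(1) by linarith
      qed (use t01 in auto)
      from optimal[OF adm_X(1) this] show False
        unfolding cost_xs adm_X(2) using \<open>snd (X t1) - snd (X t0) - J + s = - \<delta>\<close> s \<delta> by linarith
    qed
    show ?thesis
    proof (intro exI[of _ \<eta>] conjI allI impI notI \<eta>)
      fix idx r eps X s \<delta>
      assume h: "(\<forall>p\<in>T. nv.slot idx r eps p \<subseteq> {t0..t1}) \<and>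
          (\<forall>p\<in>T. \<forall>q\<in>T. p \<noteq> q \<longrightarrow> nv.slot idx r eps p \<inter> nv.slot idx r eps q = {}) \<and>
          nv.trajectory T idx r eps X \<and> (\<forall>t\<in>{t0..t1}. norm (X t - Xs t) \<le> \<eta>) \<and> 0 \<le> s \<and> 0 < \<delta>"
        and eq: "E (X t0, X t1) + s *\<^sub>R e = E (Xs t0, Xs t1) - \<delta> *\<^sub>R e"
      show False
        using h by (elim conjE)
          (rule improvement_False[where idx = idx and r = r and eps = eps and X = X and s = s and \<delta> = \<delta>, OF _ _ _ _ _ _ eq])
    qed
  qed
  have "\<exists>\<mu> P. \<mu> \<noteq> 0 \<and> 0 \<le> \<mu> \<bullet> e \<and> continuous_on {t0..t1} P \<and>
     (\<forall>t\<in>{t0..t1}. P t = P t1 + integral {t..t1} (\<lambda>s. adjoint (A s) (P s))) \<and>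
     (\<forall>y. P t1 \<bullet> y = \<mu> \<bullet> DE (0, y)) \<and> (\<forall>\<xi>. P t0 \<bullet> \<xi> = - (\<mu> \<bullet> DE (\<xi>, 0))) \<and>
     (\<exists>N. negligible N \<and> (\<forall>t\<in>{t0..<t1} - N. \<forall>n. 0 \<le> P t \<bullet> D n t (Xs t)))"
    by (rule nv.multiplier_rule[OF DE \<gamma>0 Econt e1]) (rule no_improvement)
  then obtain \<mu> P N3 where \<mu>0: "\<mu> \<noteq> 0" and \<mu>e: "0 \<le> \<mu> \<bullet> e" and P_cont: "continuous_on {t0..t1} P"
    and P_eq: "\<forall>t\<in>{t0..t1}. P t = P t1 + integral {t..t1} (\<lambda>s. adjoint (A s) (P s))"
    and P1: "\<forall>y. P t1 \<bullet> y = \<mu> \<bullet> DE (0, y)" and P0: "\<forall>\<xi>. P t0 \<bullet> \<xi> = - (\<mu> \<bullet> DE (\<xi>, 0))"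
    and N3: "negligible N3" "\<forall>t\<in>{t0..<t1} - N3. \<forall>n. 0 \<le> P t \<bullet> D n t (Xs t)"
    by (elim exE conjE)
  define lam0 l0 l1 where "lam0 = fst \<mu>" and "l0 = fst (snd \<mu>)" and "l1 = snd (snd \<mu>)"
  have \<mu>_inner: "\<mu> \<bullet> (x, y, z) = lam0 * x + l0 \<bullet> y + l1 \<bullet> z" for x y z
    by (cases \<mu>) (auto simp: lam0_def l0_def l1_def inner_Pair)
  have P_inner: "Y \<bullet> (y, r) = fst Y \<bullet> y + snd Y * r" for Y :: "(real^'n) \<times> real" and y r
    by (cases Y) (simp add: inner_Pair)
  have H_zero: "H0 0 = 0" "H1 0 = 0"
    using linear_0[OF has_derivative_linear[OF H0]] linear_0[OF has_derivative_linear[OF H1]] by auto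
  have P1_fst: "fst (P t1) \<bullet> y = l1 \<bullet> H1 y" for y
    using spec[OF P1, of "(y, 0)"] by (simp add: DE_def \<mu>_inner H_zero P_inner)
  have P1_snd: "snd (P t1) = lam0"
    using spec[OF P1, of "(0, 1)"] by (simp add: DE_def \<mu>_inner H_zero P_inner)
  have P0_fst: "fst (P t0) \<bullet> y = - (l0 \<bullet> H0 y)" for y
    using spec[OF P0, of "(y, 0)"] by (simp add: DE_def \<mu>_inner H_zero P_inner)

  define k where "k = (\<lambda>t. adjoint (A t) (P t))"
  have k_bm: "bmeas t0 t1 k"
    unfolding k_def by (intro nv.adjoint_meas bmeas_continuous P_cont)
  have k_fst: "fst (k t) \<bullet> y = fst (P t) \<bullet> blinfun_apply (\<phi>' t (xs t) (us' t)) y + snd (P t) * blinfun_apply (f' t (xs t) (us' t)) y"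
    and k_snd: "snd (k t) = 0" if t: "t \<in> {t0..t1}" for t y
    using adjoint_works[OF nv.A_linear[OF t], of "(y, 0)" "P t"] adjoint_works[OF nv.A_linear[OF t], of "(0, 1)" "P t"]
    by (simp_all add: k_def A_def inner_prod_def inner_commute mult.commute blinfun.zero_right)
  have P_snd: "snd (P t) = lam0" if t: "t \<in> {t0..t1}" for t
  proof -
    have "k integrable_on {t..t1}" by (rule bmeas_integrable_sub[OF k_bm]) (use t in auto)
    then have "snd (integral {t..t1} k) = integral {t..t1} (\<lambda>s. snd (k s))"
      using integral_linear[OF _ bounded_linear_snd, of k "{t..t1}"] by (simp add: o_def)
    also have "\<dots> = integral {t..t1} (\<lambda>s. 0)"
      by (rule integral_cong) (use k_snd t in auto)
    finally have "snd (integral {t..t1} k) = 0" by simp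
    then show ?thesis
      using bspec[OF P_eq t] P1_snd unfolding k_def[symmetric] by simp
  qed
  define p where "p = (\<lambda>t. - fst (P t))"
  have p_eq: "p t = p t0 + integral {t0..t} (\<lambda>s. fst (k s))" if t: "t \<in> {t0..t1}" for t
  proof -
    have "integral {t0..t} k + integral {t..t1} k = integral {t0..t1} k"
      by (rule Henstock_Kurzweil_Integration.integral_combine) (use t bmeas_integrable[OF k_bm] in auto)
    then have "P t0 = P t + integral {t0..t} k"
      using bspec[OF P_eq t] bspec[OF P_eq t0_in] unfolding k_def[symmetric] by (simp only: add_ac)
    moreover have "k integrable_on {t0..t}" by (rule bmeas_integrable_sub[OF k_bm]) (use t in auto)
    then have "fst (integral {t0..t} k) = integral {t0..t} (\<lambda>s. fst (k s))"
      using integral_linear[OF _ bounded_linear_fst, of k "{t0..t}"] by (simp add: o_def)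
    ultimately show ?thesis by (simp add: p_def)
  qed
  note p_prop = primitive_properties[OF bmeas_linear_image[OF k_bm bounded_linear_fst] p_eq]

  have k_adjoint: "fst (k t) = - (transpose (jacobian (\<lambda>x. \<phi> t x (us t)) (at (xs t))) *v p t) + lam0 *\<^sub>R gradient (\<lambda>x. f t x (us t)) (xs t)"
    if t: "t \<in> {t0..t1} - N" for t
  proof -
    have tin: "t \<in> {t0..t1}" and ueq: "us t = us' t" using t us'(1) by auto
    have dphi: "((\<lambda>x. \<phi> t x (us t)) has_derivative blinfun_apply (\<phi>' t (xs t) (us' t))) (at (xs t))"
      unfolding ueq by (rule \<phi>_tube(5)[OF tin U0(2) xs_tube])
    have df: "((\<lambda>x. f t x (us t)) has_derivative blinfun_apply (f' t (xs t) (us' t))) (at (xs t))"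
      unfolding ueq by (rule f_tube(5)[OF tin U0(2) xs_tube])
    have "fst (k t) \<bullet> y = (- (transpose (jacobian (\<lambda>x. \<phi> t x (us t)) (at (xs t))) *v p t) + lam0 *\<^sub>R gradient (\<lambda>x. f t x (us t)) (xs t)) \<bullet> y" for y
      unfolding k_fst[OF tin] P_snd[OF tin] inner_add_left inner_minus_left inner_scaleR_left
        transpose_jacobian_inner[OF dphi] gradient_inner[OF df] by (simp add: p_def)
    then show ?thesis using vector_eq_rdot by blast
  qed
  have ode: "AE t in lebesgue_on {t0..t1}. (p has_vector_derivative
          (- (transpose (jacobian (\<lambda>x. \<phi> t x (us t)) (at (xs t))) *v p t)
           + lam0 *\<^sub>R gradient (\<lambda>x. f t x (us t)) (xs t))) (at t within {t0..t1})"
  proof -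
    obtain N1 where N1: "negligible N1" "\<forall>t\<in>{t0..t1} - N1. (p has_vector_derivative fst (k t)) (at t within {t0..t1})"
      using p_prop(2) unfolding AE_lebesgue_on_interval by blast
    show ?thesis
      unfolding AE_lebesgue_on_interval
    proof (intro exI[of _ "N1 \<union> N"] conjI ballI)
      show "negligible (N1 \<union> N)" using N N1(1) by simp
      fix t assume t: "t \<in> {t0..t1} - (N1 \<union> N)"
      then have "t \<in> {t0..t1} - N" and "t \<in> {t0..t1} - N1" by auto
      from bspec[OF N1(2) this(2)] show "(p has_vector_derivative
          (- (transpose (jacobian (\<lambda>x. \<phi> t x (us t)) (at (xs t))) *v p t)
           + lam0 *\<^sub>R gradient (\<lambda>x. f t x (us t)) (xs t))) (at t within {t0..t1})"
        unfolding k_adjoint[OF \<open>t \<in> {t0..t1} - N\<close>] .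
    qed
  qed

  have H_cont: "continuous_on S (\<lambda>u. pontryagin f \<phi> t (xs t) u (p t) lam0)" if t: "t \<in> {t0..t1}" for t S
  proof -
    have "isCont (\<lambda>u. pontryagin f \<phi> t (xs t) u (p t) lam0) u" for u
    proof (rule continuous_on_interior)
      show "u \<in> interior (cball 0 (norm u + 1))"
        by (simp add: interior_cball)
      obtain \<gamma>' where g': "\<gamma>' > 0" "unif_x_differentiable_on (tube t0 t1 xs \<gamma>' \<times> cball 0 (norm u + 1)) f"
        "unif_x_differentiable_on (tube t0 t1 xs \<gamma>' \<times> cball 0 (norm u + 1)) \<phi>"
        using reg[OF compact_cball[of 0 "norm u + 1"]] by blast
      have m: "((t, xs t), w) \<in> tube t0 t1 xs \<gamma>' \<times> cball 0 (norm u + 1)" if "w \<in> cball 0 (norm u + 1)" for w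
        using that t g'(1) by (simp add: tube_def)
      have pair: "continuous_on (cball 0 (norm u + 1)) (\<lambda>w :: real^'m. ((t, xs t), w))"
        by (intro continuous_intros)
      have img: "(\<lambda>w. ((t, xs t), w)) ` cball 0 (norm u + 1) \<subseteq> tube t0 t1 xs \<gamma>' \<times> cball 0 (norm u + 1)"
        using m by blast
      have "continuous_on (cball 0 (norm u + 1)) (\<lambda>w. \<phi> t (xs t) w)"
        using continuous_on_compose2[OF uniformly_continuous_imp_continuous[OF
            g'(3)[unfolded unif_x_differentiable_on_def, THEN conjunct1]] pair img] by (simp only: prod.case)
      moreover have "continuous_on (cball 0 (norm u + 1)) (\<lambda>w. f t (xs t) w)"
        using continuous_on_compose2[OF uniformly_continuous_imp_continuous[OF
            g'(2)[unfolded unif_x_differentiable_on_def, THEN conjunct1]] pair img] by (simp only: prod.case)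
      ultimately show "continuous_on (cball 0 (norm u + 1)) (\<lambda>u. pontryagin f \<phi> t (xs t) u (p t) lam0)"
        unfolding pontryagin_def by (intro continuous_on_diff continuous_on_mult continuous_on_inner continuous_on_const)
    qed
    then show ?thesis by (simp add: continuous_at_imp_continuous_on)
  qed
  have maximum: "AE t in lebesgue_on {t0..t1}. us t \<in> U \<and>
       (\<forall>w\<in>U. pontryagin f \<phi> t (xs t) w (p t) lam0 \<le> pontryagin f \<phi> t (xs t) (us t) (p t) lam0)"
  proof -

    show ?thesis
      unfolding AE_lebesgue_on_interval
    proof (intro exI[of _ "N \<union> N3 \<union> {t1}"] conjI ballI)
      show "negligible (N \<union> N3 \<union> {t1})" using N N3(1) by simp
      fix t assume t: "t \<in> {t0..t1} - (N \<union> N3 \<union> {t1})"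
      then have tin: "t \<in> {t0..t1}" and t3: "t \<in> {t0..<t1} - N3" and ueq: "us t = us' t"
        using us'(1) by auto
      show "us t \<in> U" unfolding ueq by (rule us'(3))
      have le: "pontryagin f \<phi> t (xs t) (v n) (p t) lam0 \<le> pontryagin f \<phi> t (xs t) (us t) (p t) lam0" for n
      proof -
        have "norm (fst (Xs t) - xs t) \<le> \<gamma> n" using \<gamma>[of n] by (simp add: Xs_def)
        then have "D n t (Xs t) = (\<phi> t (xs t) (v n) - \<phi> t (xs t) (us' t), f t (xs t) (v n) - f t (xs t) (us' t))"
          unfolding D_def by (simp only: truncated_in_tube) (simp add: Xs_def)
        then have "0 \<le> fst (P t) \<bullet> (\<phi> t (xs t) (v n) - \<phi> t (xs t) (us' t)) + lam0 * (f t (xs t) (v n) - f t (xs t) (us' t))"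
          using spec[OF bspec[OF N3(2) t3], of n] P_snd[OF tin] by (simp add: inner_prod_def)
        then show ?thesis
          unfolding pontryagin_def ueq p_def by (simp add: inner_diff_right algebra_simps)
      qed
      fix w assume "w \<in> U"
      then have "w \<in> closure V" using V(3) by blast
      then show "pontryagin f \<phi> t (xs t) w (p t) lam0 \<le> pontryagin f \<phi> t (xs t) (us t) (p t) lam0"
        by (rule continuous_le_on_closure[OF H_cont[OF tin]]) (use le rv in blast)
    qed
  qed
  have "p t0 \<bullet> y = (transpose (jacobian h0 (at (xs t0))) *v l0) \<bullet> y" for y
    unfolding transpose_jacobian_inner[OF H0] p_def by (simp add: P0_fst)
  moreover have "p t1 \<bullet> y = (- (transpose (jacobian h1 (at (xs t1))) *v l1)) \<bullet> y" for y
    unfolding inner_minus_left transpose_jacobian_inner[OF H1] p_def by (simp add: P1_fst)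
  ultimately have p_end: "p t0 = transpose (jacobian h0 (at (xs t0))) *v l0"
    "p t1 = - (transpose (jacobian h1 (at (xs t1))) *v l1)"
    using vector_eq_rdot by blast+
  have "lam0 \<ge> 0" using \<mu>e by (simp add: e_def \<mu>_inner)
  moreover have "\<not> (lam0 = 0 \<and> (\<forall>t\<in>{t0..t1}. p t = 0) \<and> l0 = 0 \<and> l1 = 0)"
    using \<mu>0 by (auto simp: lam0_def l0_def l1_def prod_eq_iff)
  ultimately show ?thesis
    using p_prop(1) ode p_end maximum by blast
qed

end
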